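(* Let $\alpha$ be an ordinal. Then the space $C([0,\alpha])$ admits an equivalent norm which is $C^1$-smooth, LUR, and a limit (uniform on bounded sets) of $C^\infty$-smooth norms.
   Context: $C([0,\alpha])$ is the Banach space of real continuous functions on the ordinal interval $[0,\alpha]$ (with the order topology), with the supremum norm. A norm is $C^k$-smooth if it is $k$ times continuously Fréchet differentiable away from the origin ($C^\infty$-smooth if this holds for every $k$). A norm $p$ on $X$ is locally uniformly rotund (LUR) if $\lim_r p(x_r-x)=0$ whenever $x,x_r\in X$ and $\lim_r\left(2p(x_r)^2+2p(x)^2-p(x_r+x)^2\right)=0$. *)

theory Defs
  imports "HOL-Analysis.Analysis"
begin

text \<open>
  The ordinal interval \<open>[0, \<alpha>]\<close> is rendered as an arbitrary type \<open>'a\<close> of the sort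
  \<open>{wellorder, order_top, linorder_topology}\<close>, i.e. a well-order with a greatest element
  (which plays the role of \<open>\<alpha>\<close>), carrying its order topology.  Up to order isomorphism, the
  well-orders with a greatest element are exactly the intervals \<open>[0, \<alpha>]\<close>.
  The Banach space \<open>C([0, \<alpha>])\<close> is the type \<open>'a \<Rightarrow>\<^sub>C real\<close> of bounded continuous
  functions with the supremum norm; the two lemmas below show that \<open>[0, \<alpha>]\<close> is compact
  and that boundedness is therefore no restriction.
\<close>

lemma compact_ordinal_atMost:
  fixes a :: "'a :: {wellorder, linorder_topology}"
  shows "compact {..a}"
proof (induction a rule: less_induct)
  case (less a)
  show ?case
  proof (rule compactI)
    fix \<C> :: "'a set set"
    assume op: "\<forall>B\<in>\<C>. open B" and cov: "{..a} \<subseteq> \<Union>\<C>"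
    from cov obtain U where U: "U \<in> \<C>" "a \<in> U" by auto
    show "\<exists>\<C>'\<subseteq>\<C>. finite \<C>' \<and> {..a} \<subseteq> \<Union>\<C>'"
    proof (cases "\<exists>b. b < a")
      case False
      then have "{..a} = {a}" by (auto simp: not_less intro: antisym)
      then have "{..a} \<subseteq> \<Union>{U}" using U(2) by simp
      then show ?thesis using U(1) by (intro exI[of _ "{U}"]) auto
    next
      case True
      then obtain y where "y < a" by blast
      with op U obtain b where b: "b < a" "{b<..a} \<subseteq> U"
        using open_left[of U a y] by blast
      have "{..b} \<subseteq> {..a}" using b(1) by simp
      with cov have "{..b} \<subseteq> \<Union>\<C>" by (rule order_trans[rotated])
      with less[OF b(1)] op obtain \<D> where D: "\<D> \<subseteq> \<C>" "finite \<D>" "{..b} \<subseteq> \<Union>\<D>"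
        by (auto elim: compactE)
      have "{..a} \<subseteq> {..b} \<union> {b<..a}" by (auto simp: not_le)
      then have "{..a} \<subseteq> \<Union>(insert U \<D>)" using D(3) b(2) by auto
      then show ?thesis using D U(1) by (intro exI[of _ "insert U \<D>"]) auto
    qed
  qed
qed

lemma bcontfun_ordinal_interval:
  "(bcontfun :: ('a :: {wellorder, order_top, linorder_topology} \<Rightarrow> real) set)
     = {f. continuous_on UNIV f}"
proof -
  have "{..top} = (UNIV :: 'a set)" by auto
  then have "compact (UNIV :: 'a set)" using compact_ordinal_atMost[of "top :: 'a"] by simp
  then show ?thesis
    by (auto simp: bcontfun_def intro: compact_imp_bounded compact_continuous_image)
qed


definition is_norm :: "('v::real_vector \<Rightarrow> real) \<Rightarrow> bool" where
  "is_norm p \<longleftrightarrow> (\<forall>x. 0 \<le> p x) \<and> (\<forall>x. p x = 0 \<longleftrightarrow> x = 0) \<and>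
     (\<forall>c x. p (c *\<^sub>R x) = \<bar>c\<bar> * p x) \<and> (\<forall>x y. p (x + y) \<le> p x + p y)"

definition equivalent_norm :: "('v::real_normed_vector \<Rightarrow> real) \<Rightarrow> bool" where
  "equivalent_norm p \<longleftrightarrow> is_norm p \<and>
     (\<exists>a>0. \<exists>b>0. \<forall>x. a * norm x \<le> p x \<and> p x \<le> b * norm x)"


text \<open>
  The \<open>k\<close>-th Frechet derivative takes values in the space of bounded \<open>k\<close>-linear maps with the
  operator norm. Since this space depends on \<open>k\<close>, a \<open>k\<close>-linear map is represented by a function
  on lists, of which only the values on lists of length \<open>k\<close> are relevant.
  \<open>multilinear_norm_le k T c\<close> says that the operator norm of \<open>T\<close> is at most \<open>c\<close>.
\<close>

definition multilinear_norm_le ::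
  "nat \<Rightarrow> ('v::real_normed_vector list \<Rightarrow> 'w::real_normed_vector) \<Rightarrow> real \<Rightarrow> bool" where
  "multilinear_norm_le k T c \<longleftrightarrow>
     (\<forall>vs. length vs = k \<longrightarrow> norm (T vs) \<le> c * prod_list (map norm vs))"

definition bounded_multilinear ::
  "nat \<Rightarrow> ('v::real_normed_vector list \<Rightarrow> 'w::real_normed_vector) \<Rightarrow> bool" where
  "bounded_multilinear k T \<longleftrightarrow>
     (\<forall>vs i. length vs = k \<longrightarrow> i < k \<longrightarrow> linear (\<lambda>h. T (vs[i := h]))) \<and>
     (\<exists>c. multilinear_norm_le k T c)"

text \<open>
  Under the isometry between bounded linear maps into \<open>k\<close>-linear maps and \<open>(k + 1)\<close>-linear maps,
  the value at \<open>h\<close> of a derivative \<open>B\<close> is \<open>\<lambda>vs. B (h # vs)\<close>.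
\<close>

definition multilinear_has_derivative_at ::
  "nat \<Rightarrow> ('v::real_normed_vector \<Rightarrow> 'v list \<Rightarrow> 'w::real_normed_vector) \<Rightarrow> ('v list \<Rightarrow> 'w) \<Rightarrow> 'v \<Rightarrow> bool"
where
  "multilinear_has_derivative_at k A B x \<longleftrightarrow> bounded_multilinear (Suc k) B \<and>
     (\<forall>e>0. \<exists>d>0. \<forall>h. norm h < d \<longrightarrow>
        multilinear_norm_le k (\<lambda>vs. A (x + h) vs - A x vs - B (h # vs)) (e * norm h))"

definition multilinear_continuous_on ::
  "nat \<Rightarrow> 'v::real_normed_vector set \<Rightarrow> ('v \<Rightarrow> 'v list \<Rightarrow> 'w::real_normed_vector) \<Rightarrow> bool" where
  "multilinear_continuous_on k U A \<longleftrightarrow>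
     (\<forall>x\<in>U. \<forall>e>0. \<exists>d>0. \<forall>y\<in>U. dist y x < d \<longrightarrow>
        multilinear_norm_le k (\<lambda>vs. A y vs - A x vs) e)"

text \<open>\<open>D j x\<close> is the \<open>j\<close>-th derivative of \<open>f\<close> at \<open>x\<close>.\<close>

definition Ck_on ::
  "nat \<Rightarrow> 'v::real_normed_vector set \<Rightarrow> ('v \<Rightarrow> 'w::real_normed_vector) \<Rightarrow> bool" where
  "Ck_on k U f \<longleftrightarrow> open U \<and>
     (\<exists>D :: nat \<Rightarrow> 'v \<Rightarrow> 'v list \<Rightarrow> 'w.
        (\<forall>x. D 0 x [] = f x) \<and>
        (\<forall>j<k. \<forall>x\<in>U. multilinear_has_derivative_at j (D j) (D (Suc j) x) x) \<and>
        (\<forall>j\<le>k. multilinear_continuous_on j U (D j)))"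

lemma Ck_on_1_iff:
  fixes f :: "'v::real_normed_vector \<Rightarrow> 'w::real_normed_vector"
  assumes "open U"
  shows "Ck_on 1 U f \<longleftrightarrow>
    (\<exists>f'. continuous_on U f' \<and> (\<forall>x\<in>U. (f has_derivative blinfun_apply (f' x)) (at x)))"
  (is "?L \<longleftrightarrow> ?R")
proof -
  have len1: "(length vs = Suc 0) \<longleftrightarrow> (\<exists>v. vs = [v])" for vs :: "'v list"
    by (cases vs) auto
  have der: "multilinear_has_derivative_at 0 A B x \<longleftrightarrow>
      ((\<lambda>y. A y []) has_derivative (\<lambda>h. B [h])) (at x)"
    for A :: "'v \<Rightarrow> 'v list \<Rightarrow> 'w" and B x
  proof -
    have bl: "bounded_multilinear (Suc 0) B \<longleftrightarrow> bounded_linear (\<lambda>h. B [h])"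
    proof -
      have "(\<exists>c. multilinear_norm_le (Suc 0) B c) \<longleftrightarrow> (\<exists>c. \<forall>h. norm (B [h]) \<le> norm h * c)"
        unfolding multilinear_norm_le_def len1
        by (intro arg_cong[of _ _ Ex] ext) (auto simp: mult.commute)
      moreover have "(\<forall>vs i. length vs = Suc 0 \<longrightarrow> i < Suc 0 \<longrightarrow> linear (\<lambda>h. B (vs[i := h])))
          \<longleftrightarrow> linear (\<lambda>h. B [h])"
        unfolding len1 by auto
      ultimately show ?thesis
        by (simp add: bounded_multilinear_def bounded_linear_def bounded_linear_axioms_def)
    qed
    show ?thesis
      unfolding multilinear_has_derivative_at_def bl has_derivative_at_alt multilinear_norm_le_def
    proof (intro conj_cong refl iffI allI impI)
      fix e :: real assume "0 < e" and H: "\<forall>e>0. \<exists>d>0. \<forall>h. norm h < d \<longrightarrow>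
        (\<forall>vs. length vs = 0 \<longrightarrow> norm (A (x + h) vs - A x vs - B (h # vs))
           \<le> e * norm h * prod_list (map norm vs))"
      then obtain d where "d > 0" and d: "\<And>h. norm h < d \<Longrightarrow>
          norm (A (x + h) [] - A x [] - B [h]) \<le> e * norm h" by force
      show "\<exists>d>0. \<forall>y. norm (y - x) < d \<longrightarrow>
          norm (A y [] - A x [] - B [y - x]) \<le> e * norm (y - x)"
      proof (intro exI[of _ d] conjI allI impI \<open>d > 0\<close>)
        fix y assume "norm (y - x) < d"
        from d[OF this] show "norm (A y [] - A x [] - B [y - x]) \<le> e * norm (y - x)" by simp
      qed
    next
      fix e :: real assume "0 < e" and H: "\<forall>e>0. \<exists>d>0. \<forall>y. norm (y - x) < d \<longrightarrow>
          norm (A y [] - A x [] - B [y - x]) \<le> e * norm (y - x)"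
      then obtain d where "d > 0" and d: "\<And>y. norm (y - x) < d \<Longrightarrow>
          norm (A y [] - A x [] - B [y - x]) \<le> e * norm (y - x)" by blast
      show "\<exists>d>0. \<forall>h. norm h < d \<longrightarrow>
        (\<forall>vs. length vs = 0 \<longrightarrow> norm (A (x + h) vs - A x vs - B (h # vs))
           \<le> e * norm h * prod_list (map norm vs))"
        using d[of "x + _"] \<open>d > 0\<close> by (intro exI[of _ d]) auto
    qed
  qed
  show ?thesis
  proof
    assume ?L
    then obtain D :: "nat \<Rightarrow> 'v \<Rightarrow> 'v list \<Rightarrow> 'w" where D0: "\<And>x. D 0 x [] = f x"
      and D1: "\<And>x. x \<in> U \<Longrightarrow> multilinear_has_derivative_at 0 (D 0) (D 1 x) x"
      and D2: "multilinear_continuous_on 1 U (D 1)"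
      unfolding Ck_on_def by (metis One_nat_def le_refl zero_less_one)
    define f' where "f' x = Blinfun (\<lambda>h. D 1 x [h])" for x
    have hd: "(f has_derivative (\<lambda>h. D 1 x [h])) (at x)" if "x \<in> U" for x
      using D1[OF that] by (simp add: der D0)
    have ap: "blinfun_apply (f' x) = (\<lambda>h. D 1 x [h])" if "x \<in> U" for x
      unfolding f'_def using has_derivative_bounded_linear[OF hd[OF that]]
      by (simp add: bounded_linear_Blinfun_apply)
    have "continuous_on U f'"
      unfolding continuous_on_iff
    proof (intro ballI allI impI)
      fix x and e :: real assume x: "x \<in> U" and "0 < e"
      then have "e / 2 > 0" by simp
      with D2 x obtain d where "d > 0" and d: "\<And>y. y \<in> U \<Longrightarrow> dist y x < d \<Longrightarrow>
          multilinear_norm_le 1 (\<lambda>vs. D 1 y vs - D 1 x vs) (e/2)"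
        unfolding multilinear_continuous_on_def by meson
      have "dist (f' y) (f' x) < e" if y: "y \<in> U" "dist y x < d" for y
      proof -
        have "norm (f' y - f' x) \<le> e / 2"
          using d[OF y] \<open>0 < e\<close>
          by (intro norm_blinfun_bound)
            (auto simp: blinfun.diff_left ap x y multilinear_norm_le_def len1)
        then show ?thesis using \<open>0 < e\<close> by (simp add: dist_norm)
      qed
      with \<open>d > 0\<close> show "\<exists>d>0. \<forall>y\<in>U. dist y x < d \<longrightarrow> dist (f' y) (f' x) < e" by blast
    qed
    with hd ap show ?R by (intro exI[of _ f']) auto
  next
    assume ?R
    then obtain f' where c: "continuous_on U f'"
      and hd: "\<And>x. x \<in> U \<Longrightarrow> (f has_derivative blinfun_apply (f' x)) (at x)" by blast
    define D where "D j x vs = (if j = 0 then f x else blinfun_apply (f' x) (hd vs))"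
      for j :: nat and x and vs :: "'v list"
    have "continuous_on U f"
      by (meson hd continuous_at_imp_continuous_on has_derivative_continuous)
    then have c0: "multilinear_continuous_on 0 U (D 0)"
      unfolding multilinear_continuous_on_def multilinear_norm_le_def D_def continuous_on_iff
      by (simp add: dist_norm) (meson less_imp_le)
    have c1: "multilinear_continuous_on 1 U (D 1)"
      unfolding multilinear_continuous_on_def
    proof (intro ballI allI impI)
      fix x and e :: real assume x: "x \<in> U" and "0 < e"
      with c obtain d where "d > 0" and d: "\<And>y. y \<in> U \<Longrightarrow> dist y x < d \<Longrightarrow> dist (f' y) (f' x) < e"
        unfolding continuous_on_iff by meson
      have "multilinear_norm_le 1 (\<lambda>vs. D 1 y vs - D 1 x vs) e" if y: "y \<in> U" "dist y x < d" for y
      proof -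
        have "norm (f' y h - f' x h) \<le> e * norm h" for h
        proof -
          have "norm (f' y h - f' x h) = norm ((f' y - f' x) h)" by (simp add: blinfun.diff_left)
          also have "\<dots> \<le> norm (f' y - f' x) * norm h" by (rule norm_blinfun)
          also have "\<dots> \<le> e * norm h"
            using d[OF y] by (intro mult_right_mono) (auto simp: dist_norm)
          finally show ?thesis .
        qed
        then show ?thesis by (auto simp: multilinear_norm_le_def D_def len1)
      qed
      with \<open>d > 0\<close> show "\<exists>d>0. \<forall>y\<in>U. dist y x < d \<longrightarrow>
          multilinear_norm_le 1 (\<lambda>vs. D 1 y vs - D 1 x vs) e" by blast
    qed
    have "\<forall>j\<le>1. multilinear_continuous_on j U (D j)"
      using c0 c1 by (auto simp: le_Suc_eq)
    moreover have "\<forall>x\<in>U. multilinear_has_derivative_at 0 (D 0) (D 1 x) x"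
      using hd by (simp add: der D_def)
    ultimately show ?L
      unfolding Ck_on_def using assms by (intro conjI exI[of _ D]) (auto simp: D_def)
  qed
qed

definition Ck_smooth_norm :: "nat \<Rightarrow> ('v::real_normed_vector \<Rightarrow> real) \<Rightarrow> bool" where
  "Ck_smooth_norm k p \<longleftrightarrow> is_norm p \<and> Ck_on k (- {0}) p"

definition Cinf_smooth_norm :: "('v::real_normed_vector \<Rightarrow> real) \<Rightarrow> bool" where
  "Cinf_smooth_norm p \<longleftrightarrow> (\<forall>k. Ck_smooth_norm k p)"

definition LUR_norm :: "('v::real_vector \<Rightarrow> real) \<Rightarrow> bool" where
  "LUR_norm p \<longleftrightarrow> is_norm p \<and>
     (\<forall>x xs. (\<lambda>r. 2 * (p (xs r))\<^sup>2 + 2 * (p x)\<^sup>2 - (p (xs r + x))\<^sup>2) \<longlonglongrightarrow> 0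
        \<longrightarrow> (\<lambda>r. p (xs r - x)) \<longlonglongrightarrow> 0)"

end

theory Submission
  imports Defs
begin

text \<open>
  The norm is \<open>p = sqrt (\<Sum>n. 2\<^sup>-\<^sup>n q\<^sub>n\<^sup>2)\<close> for a sequence of \<open>C\<^sup>\<infinity>\<close>-smooth norms with a common bound
  \<open>q\<^sub>n \<le> 4 \<parallel>\<cdot>\<parallel>\<close>. The derivatives of the \<open>q\<^sub>n\<^sup>2\<close> are then summable uniformly on bounded sets, so \<open>p\<close>
  is \<open>C\<^sup>1\<close>-smooth, and the square roots of the partial sums are \<open>C\<^sup>\<infinity>\<close>-smooth norms that converge
  to \<open>p\<close> uniformly on bounded sets. If \<open>2 p(x\<^sub>r)\<^sup>2 + 2 p(x)\<^sup>2 - p(x\<^sub>r + x)\<^sup>2\<close> tends to \<open>0\<close>, then the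
  same is true for every \<open>q\<^sub>n\<close>, that is, \<open>q\<^sub>n(x\<^sub>r) \<rightarrow> q\<^sub>n(x)\<close> and \<open>q\<^sub>n(x\<^sub>r + x) \<rightarrow> 2 q\<^sub>n(x)\<close>. It remains
  to find countably many smooth norms for which these limits force \<open>x\<^sub>r \<rightarrow> x\<close>.

  All these norms are Minkowski functionals of bodies \<open>{u. \<Sum>\<^sub>i \<Theta>\<^sub>i(u) \<le> 1}\<close> with smooth convex
  even functions \<open>\<Theta>\<^sub>i \<ge> 0\<close> of which only finitely many do not vanish near a given point of the
  body. Implicit differentiation makes the Minkowski functional smooth (\<open>smooth_at_mink\<close>), and
  convexity passes the rotundity hypothesis on to each \<open>\<Theta>\<^sub>i\<close>: its convexity gap tends to \<open>0\<close>
  (\<open>rotundity_gap\<close>).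

  The geometry of \<open>C([0, \<alpha>])\<close> enters through the jumps \<open>f(t) - f(t + 1)\<close>, where \<open>f(\<alpha> + 1) = 0\<close>.
  Only finitely many of them exceed a given size; the last point at which \<open>\<bar>f\<bar>\<close> attains its
  maximum has a nonzero jump; and a finite set of points that contains all sufficiently large
  jumps cuts \<open>[0, \<alpha>]\<close> into pieces on which \<open>f\<close> is nearly constant (\<open>step_approximates\<close>). The
  first two facts give a \<open>C\<^sup>\<infinity>\<close>-smooth norm \<open>N\<close> equivalent to the supremum norm, with one summand
  for every point \<open>t\<close> that is active only if the jump at \<open>t\<close> is large compared with the distance
  of \<open>\<bar>f(t)\<bar>\<close> from \<open>1\<close>.

  For rotundity there is one summand \<open>ramp (Z\<^sub>A(u) - m)\<close> for every finite set \<open>A\<close>, where the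
  score \<open>Z\<^sub>A(u)\<close> is the sum of \<open>jump\<^sup>2 - 8\<close> over \<open>A\<close> plus a small multiple of a remainder. The
  remainder contains the squares of the values of \<open>u\<close> on \<open>A\<close> and a smooth function of \<open>N(u - S\<^sub>A
  u)\<close>, where \<open>S\<^sub>A u\<close> is the step function that \<open>A\<close> and \<open>u\<close> determine. Since every point costs
  \<open>8\<close>, an active set contains exactly the large jumps of \<open>u\<close> up to a bounded tolerance, and
  locally only finitely many sets are active. If \<open>\<rho>\<close> is the value of the norm at \<open>f\<close>, a set that
  is active at \<open>f / \<rho>\<close> contains all jumps of \<open>f\<close> of size \<open>4 \<rho>\<close>, and \<open>\<rho> \<rightarrow> 0\<close> as \<open>m \<rightarrow> \<infinity>\<close>. So for
  large \<open>m\<close> the function \<open>f\<close> is close to its step function over an active \<open>A\<close>; by the convexity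
  gap the values of \<open>x\<^sub>r\<close> on \<open>A\<close> converge to those of \<open>f\<close>, and \<open>x\<^sub>r\<close> is also close to its step
  function over \<open>A\<close> (\<open>lur_norm_detects\<close>).
\<close>

section \<open>Functions of finitely many linear functionals\<close>

text \<open>
  A derivative is kept as a list of pairs of a scalar function and a fixed linear functional, so
  that all coefficients of derivatives of every order are again real-valued functions.
\<close>

definition lin_comb :: "(('v \<Rightarrow> real) \<times> ('v \<Rightarrow> real)) list \<Rightarrow> 'v \<Rightarrow> 'v \<Rightarrow> real" where
  "lin_comb ps x h = (\<Sum>(g, l)\<leftarrow>ps. g x * l h)"

text \<open>
  Continuous differentiability of order \<open>k\<close> where the derivatives of all orders are built from
  finitely many linear functionals. All smooth functions below are of this kind locally, and for
  them the recursion on \<open>k\<close> never leaves the real-valued functions: closure under products,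
  composition and implicit definition is proved by plain induction, without higher-order
  derivatives.
\<close>

fun fsmooth :: "nat \<Rightarrow> 'v::real_normed_vector set \<Rightarrow> ('v \<Rightarrow> real) \<Rightarrow> bool" where
  "fsmooth 0 U f \<longleftrightarrow> continuous_on U f"
| "fsmooth (Suc k) U f \<longleftrightarrow> (\<exists>ps. (\<forall>(g, l)\<in>set ps. fsmooth k U g \<and> bounded_linear l) \<and>
     (\<forall>x\<in>U. (f has_derivative lin_comb ps x) (at x)))"

lemma lin_comb_Nil [simp]: "lin_comb [] x h = 0"
  and lin_comb_Cons [simp]: "lin_comb ((g, l) # ps) x h = g x * l h + lin_comb ps x h"
  and lin_comb_append [simp]: "lin_comb (ps @ qs) x h = lin_comb ps x h + lin_comb qs x h"
  by (simp_all add: lin_comb_def)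

lemma lin_comb_scale: "lin_comb (map (\<lambda>(g, l). (\<lambda>x. c x * g x, l)) ps) x h = c x * lin_comb ps x h"
  by (induction ps) (auto simp: algebra_simps)

lemma lin_comb_subst: "lin_comb (map (\<lambda>(g, l). (\<lambda>x. g (u x), l)) ps) x h = lin_comb ps (u x) h"
  by (induction ps) auto

lemma lin_comb_pull: "lin_comb (map (\<lambda>(g, l). (\<lambda>x. g (u x), \<lambda>h. l (v h))) ps) x h = lin_comb ps (u x) (v h)"
  by (induction ps) auto

lemma bounded_linear_lin_comb:
  "\<forall>(g, l)\<in>set ps. bounded_linear l \<Longrightarrow> bounded_linear (lin_comb ps x)"
proof (induction ps)
  case Nil
  then show ?case by (simp add: lin_comb_def[abs_def])
next
  case (Cons p ps)
  obtain g l where p: "p = (g, l)" by force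
  from Cons have "bounded_linear (\<lambda>h. g x * l h + lin_comb ps x h)"
    by (intro bounded_linear_add) (auto simp: p intro: bounded_linear_const_mult)
  moreover have "lin_comb (p # ps) x = (\<lambda>h. g x * l h + lin_comb ps x h)" by (auto simp: p)
  ultimately show ?case by simp
qed

lemma fsmooth_imp_continuous_on: "fsmooth k U f \<Longrightarrow> continuous_on U f"
  by (cases k) (auto intro!: continuous_at_imp_continuous_on dest!: bspec intro: has_derivative_continuous)

lemma fsmooth_SucD: "fsmooth (Suc k) U f \<Longrightarrow> fsmooth k U f"
proof (induction k arbitrary: f)
  case 0
  then show ?case using fsmooth_imp_continuous_on[of "Suc 0" U f] by (simp only: fsmooth.simps(1) One_nat_def)
next
  case (Suc k)
  from Suc.prems obtain ps where ps: "\<forall>(g, l)\<in>set ps. fsmooth (Suc k) U g \<and> bounded_linear l"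
    "\<forall>x\<in>U. (f has_derivative lin_comb ps x) (at x)" by (subst (asm) fsmooth.simps) blast
  then have "\<forall>(g, l)\<in>set ps. fsmooth k U g \<and> bounded_linear l"
    using Suc.IH by fast
  with ps(2) show ?case by auto
qed

lemma fsmooth_subset:
  assumes "fsmooth k U f" "V \<subseteq> U"
  shows "fsmooth k V f"
  using assms(1)
proof (induction k arbitrary: f)
  case 0
  then show ?case using assms(2) continuous_on_subset by auto
next
  case (Suc k)
  then show ?case using assms(2) by simp fast
qed

lemma fsmooth_cong:
  assumes "open U" "\<And>x. x \<in> U \<Longrightarrow> f x = g x" "fsmooth k U f"
  shows "fsmooth k U g"
proof (cases k)
  case 0
  then show ?thesis using assms by (auto cong: continuous_on_cong)
next
  case (Suc j)
  have "(g has_derivative D) (at x)" if "(f has_derivative D) (at x)" "x \<in> U" for D x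
    using has_derivative_transform_within_open[OF that(1) assms(1) that(2)] assms(2) by blast
  then show ?thesis using assms(3) unfolding Suc by simp blast
qed

lemma fsmooth_const [intro]: "fsmooth k U (\<lambda>_. c)"
proof (cases k)
  case (Suc j)
  have "((\<lambda>_. c) has_derivative lin_comb [] x) (at x)" for x :: 'a
    by (simp add: lin_comb_def[abs_def])
  then show ?thesis unfolding Suc by (auto intro!: exI[of _ "[]"])
qed auto

lemma fsmooth_linear:
  assumes "bounded_linear l"
  shows "fsmooth k U l"
proof (cases k)
  case 0
  then show ?thesis using assms by (simp add: linear_continuous_on)
next
  case (Suc j)
  have "(l has_derivative lin_comb [(\<lambda>_. 1, l)] x) (at x)" for x
    using bounded_linear_imp_has_derivative[OF assms] by (simp add: lin_comb_def[abs_def])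
  then show ?thesis unfolding Suc using assms by (auto intro!: exI[of _ "[(\<lambda>_. 1, l)]"])
qed

lemma fsmooth_add:
  assumes "fsmooth k U f" "fsmooth k U g"
  shows "fsmooth k U (\<lambda>x. f x + g x)"
proof (cases k)
  case 0
  then show ?thesis using assms by (auto intro: continuous_on_add)
next
  case (Suc j)
  from assms obtain ps qs where
    ps: "\<forall>(g, l)\<in>set ps. fsmooth j U g \<and> bounded_linear l" "\<forall>x\<in>U. (f has_derivative lin_comb ps x) (at x)"
    and qs: "\<forall>(g, l)\<in>set qs. fsmooth j U g \<and> bounded_linear l" "\<forall>x\<in>U. (g has_derivative lin_comb qs x) (at x)"
    unfolding Suc by auto
  have "((\<lambda>x. f x + g x) has_derivative lin_comb (ps @ qs) x) (at x)" if "x \<in> U" for x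
    using has_derivative_add[of f "lin_comb ps x" "at x" g "lin_comb qs x"] ps(2) qs(2) that
    by (simp add: lin_comb_append[abs_def])
  then show ?thesis unfolding Suc using ps(1) qs(1) by (auto intro!: exI[of _ "ps @ qs"])
qed

lemma fsmooth_mult:
  assumes "fsmooth k U f" "fsmooth k U g"
  shows "fsmooth k U (\<lambda>x. f x * g x)"
  using assms
proof (induction k arbitrary: f g)
  case 0
  then show ?case by (auto intro: continuous_on_mult)
next
  case (Suc j)
  from Suc.prems obtain ps qs where
    ps: "\<forall>(g, l)\<in>set ps. fsmooth j U g \<and> bounded_linear l" "\<forall>x\<in>U. (f has_derivative lin_comb ps x) (at x)"
    and qs: "\<forall>(g, l)\<in>set qs. fsmooth j U g \<and> bounded_linear l" "\<forall>x\<in>U. (g has_derivative lin_comb qs x) (at x)"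
    by auto
  let ?rs = "map (\<lambda>(a, l). (\<lambda>x. f x * a x, l)) qs @ map (\<lambda>(a, l). (\<lambda>x. g x * a x, l)) ps"
  have "((\<lambda>x. f x * g x) has_derivative lin_comb ?rs x) (at x)" if "x \<in> U" for x
  proof -
    have "lin_comb ?rs x = (\<lambda>h. f x * lin_comb qs x h + lin_comb ps x h * g x)"
      by (auto simp: lin_comb_scale)
    then show ?thesis
      using has_derivative_mult[of f "lin_comb ps x" x UNIV g "lin_comb qs x"] ps(2) qs(2) that by simp
  qed
  moreover have "\<forall>(a, l)\<in>set ?rs. fsmooth j U a \<and> bounded_linear l"
    using ps(1) qs(1) Suc.IH fsmooth_SucD[OF Suc.prems(1)] fsmooth_SucD[OF Suc.prems(2)] by auto
  ultimately show ?case by (subst fsmooth.simps) blast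
qed

lemma fsmooth_lin_comb:
  assumes "\<forall>(g, l)\<in>set ps. fsmooth k U (\<lambda>x. g (u x)) \<and> fsmooth k U (\<lambda>x. l (v x))"
  shows "fsmooth k U (\<lambda>x. lin_comb ps (u x) (v x))"
  using assms by (induction ps) (auto intro!: fsmooth_add fsmooth_mult)

lemma fsmooth_compose:
  assumes "fsmooth k T \<phi>" "fsmooth k U f" "f ` U \<subseteq> T"
  shows "fsmooth k U (\<lambda>x. \<phi> (f x))"
  using assms
proof (induction k arbitrary: \<phi> f)
  case 0
  then show ?case using continuous_on_compose2 by auto
next
  case (Suc k)
  from Suc.prems obtain ps qs where
    ps: "\<forall>(g, l)\<in>set ps. fsmooth k T g \<and> bounded_linear l" "\<forall>x\<in>T. (\<phi> has_derivative lin_comb ps x) (at x)"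
    and qs: "\<forall>(g, l)\<in>set qs. fsmooth k U g \<and> bounded_linear l" "\<forall>x\<in>U. (f has_derivative lin_comb qs x) (at x)"
    by auto
  let ?c = "\<lambda>x. lin_comb ps (f x) 1"
  let ?rs = "map (\<lambda>(a, l). (\<lambda>x. ?c x * a x, l)) qs"
  have c: "fsmooth k U ?c"
    using ps(1) Suc.IH[OF _ fsmooth_SucD[OF Suc.prems(2)] Suc.prems(3)]
    by (intro fsmooth_lin_comb) fast
  have "((\<lambda>x. \<phi> (f x)) has_derivative lin_comb ?rs x) (at x)" if "x \<in> U" for x
  proof -
    have "linear (lin_comb ps (f x))" using ps(1) by (intro bounded_linear.linear bounded_linear_lin_comb) auto
    then have "lin_comb ps (f x) s = s * lin_comb ps (f x) 1" for s
      using linear_cmul[of "lin_comb ps (f x)" s 1] by simp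
    then have "lin_comb ?rs x = (\<lambda>h. lin_comb ps (f x) (lin_comb qs x h))"
      unfolding lin_comb_scale[abs_def] by (metis mult.commute)
    then show ?thesis
      using has_derivative_compose[of f "lin_comb qs x" x UNIV \<phi> "lin_comb ps (f x)"] ps(2) qs(2) that
        Suc.prems(3) by auto
  qed
  moreover have "\<forall>(a, l)\<in>set ?rs. fsmooth k U a \<and> bounded_linear l"
    using qs(1) c by (auto intro!: fsmooth_mult)
  ultimately show ?case by (subst fsmooth.simps) blast
qed

lemma fsmooth_precompose_linear:
  assumes "bounded_linear S" "fsmooth k U f" "S ` V \<subseteq> U"
  shows "fsmooth k V (\<lambda>x. f (S x))"
  using assms(2)
proof (induction k arbitrary: f)
  case 0
  then show ?case
    using continuous_on_compose2[OF _ linear_continuous_on[OF assms(1)] assms(3)] by auto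
next
  case (Suc k)
  then obtain ps where
    ps: "\<forall>(g, l)\<in>set ps. fsmooth k U g \<and> bounded_linear l" "\<forall>x\<in>U. (f has_derivative lin_comb ps x) (at x)"
    by auto
  let ?rs = "map (\<lambda>(g, l). (\<lambda>x. g (S x), \<lambda>h. l (S h))) ps"
  have "((\<lambda>x. f (S x)) has_derivative lin_comb ?rs x) (at x)" if "x \<in> V" for x
    using has_derivative_compose[OF bounded_linear_imp_has_derivative[OF assms(1)], of f "lin_comb ps (S x)" x UNIV]
      ps(2) that assms(3) by (auto simp: lin_comb_pull[abs_def])
  moreover have "\<forall>(a, l)\<in>set ?rs. fsmooth k V a \<and> bounded_linear l"
    using ps(1) Suc.IH assms(1) by (auto intro: bounded_linear_compose[unfolded o_def])
  ultimately show ?case by (subst fsmooth.simps) blast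
qed

lemma fsmooth_inverse: "fsmooth k (- {0}) (inverse :: real \<Rightarrow> real)"
proof (induction k)
  case 0
  then show ?case by (auto intro: continuous_on_inverse)
next
  case (Suc k)
  let ?ps = "[(\<lambda>x::real. - 1 * (inverse x * inverse x), \<lambda>h::real. h)]"
  have "(inverse has_derivative lin_comb ?ps x) (at x)" if "x \<noteq> 0" for x :: real
    using has_derivative_inverse'[OF that, of UNIV] by (simp add: lin_comb_def[abs_def] ac_simps)
  moreover have "fsmooth k (- {0::real}) (\<lambda>x. - 1 * (inverse x * inverse x))"
    using Suc by (intro fsmooth_mult fsmooth_const)
  ultimately show ?case
    by (subst fsmooth.simps, intro exI[of _ ?ps]) (simp add: bounded_linear_ident)
qed

lemma fsmooth_sqrt: "fsmooth k {0<..} sqrt"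
proof (induction k)
  case 0
  then show ?case by (auto intro: continuous_intros)
next
  case (Suc k)
  let ?ps = "[(\<lambda>x::real. 1/2 * inverse (sqrt x), \<lambda>h::real. h)]"
  have "(sqrt has_derivative lin_comb ?ps x) (at x)" if "x > 0" for x :: real
  proof -
    have "(*) (inverse (sqrt x) / 2) = lin_comb ?ps x" by (rule ext) simp
    then show ?thesis
      using DERIV_real_sqrt[OF that] unfolding has_field_derivative_def by metis
  qed
  moreover have "fsmooth k {0<..} (\<lambda>x. 1/2 * inverse (sqrt x))"
    using Suc by (intro fsmooth_mult fsmooth_const fsmooth_compose[OF fsmooth_inverse]) auto
  ultimately show ?case
    by (subst fsmooth.simps, intro exI[of _ ?ps]) (simp add: bounded_linear_ident)
qed

text \<open>
  The normalisation \<open>x \<mapsto> x / N x\<close> is not a linear substitution, but it only rescales its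
  argument by a scalar function; the chain rule then involves only the functionals that occur in
  \<open>H\<close> and \<open>c\<close>.
\<close>

lemma fsmooth_scaled_argument:
  assumes "fsmooth k W H" "fsmooth k U c" "\<And>x. x \<in> U \<Longrightarrow> c x *\<^sub>R x \<in> W"
  shows "fsmooth k U (\<lambda>x. H (c x *\<^sub>R x))"
  using assms
proof (induction k arbitrary: H c)
  case 0
  have "continuous_on U (\<lambda>x. c x *\<^sub>R x)" using 0 by (auto intro: continuous_intros)
  then show ?case using 0 by (auto intro: continuous_on_compose2)
next
  case (Suc k)
  from Suc.prems obtain ps qs where
    ps: "\<forall>(g, l)\<in>set ps. fsmooth k W g \<and> bounded_linear l" "\<forall>x\<in>W. (H has_derivative lin_comb ps x) (at x)"
    and qs: "\<forall>(g, l)\<in>set qs. fsmooth k U g \<and> bounded_linear l" "\<forall>x\<in>U. (c has_derivative lin_comb qs x) (at x)"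
    by auto
  have c: "fsmooth k U c" by (rule fsmooth_SucD) fact
  have sub: "fsmooth k U (\<lambda>x. g (c x *\<^sub>R x))" if "(g, l) \<in> set ps" for g l
    using Suc.IH[OF _ c Suc.prems(3)] ps(1) that by fast
  let ?ps = "map (\<lambda>(g, l). (\<lambda>x. g (c x *\<^sub>R x), l)) ps"
  let ?d = "\<lambda>x. lin_comb ps (c x *\<^sub>R x) x"
  let ?rs = "map (\<lambda>(a, l). (\<lambda>x. c x * a x, l)) ?ps @ map (\<lambda>(a, l). (\<lambda>x. ?d x * a x, l)) qs"
  have d: "fsmooth k U ?d"
    using sub ps(1) by (intro fsmooth_lin_comb) (auto intro: fsmooth_linear)
  have "((\<lambda>x. H (c x *\<^sub>R x)) has_derivative lin_comb ?rs x) (at x)" if "x \<in> U" for x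
  proof -
    have lin: "linear (lin_comb ps (c x *\<^sub>R x))"
      using ps(1) by (intro bounded_linear.linear bounded_linear_lin_comb) auto
    have 1: "((\<lambda>x. c x *\<^sub>R x) has_derivative (\<lambda>h. c x *\<^sub>R h + lin_comb qs x h *\<^sub>R x)) (at x)"
      using has_derivative_scaleR[of c "lin_comb qs x" x UNIV "\<lambda>x. x" "\<lambda>h. h"] qs(2) that by simp
    have "lin_comb ?rs x = (\<lambda>h. lin_comb ps (c x *\<^sub>R x) (c x *\<^sub>R h + lin_comb qs x h *\<^sub>R x))"
      by (rule ext)
        (simp only: lin_comb_append lin_comb_scale lin_comb_subst linear_add[OF lin] linear_cmul[OF lin] real_scaleR_def, simp)
    then show ?thesis
      using has_derivative_compose[OF 1, of H "lin_comb ps (c x *\<^sub>R x)"] ps(2) that Suc.prems(3) by auto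
  qed
  moreover have "\<forall>(a, l)\<in>set ?rs. fsmooth k U a \<and> bounded_linear l"
    using qs(1) ps(1) c d sub by (auto intro!: fsmooth_mult)
  ultimately show ?case by (subst fsmooth.simps) blast
qed

text \<open>
  Implicit differentiation of the equation \<open>\<Phi> (x / N x) = 1\<close>. With \<open>u = x / N x\<close> and \<open>v = y / N
  y\<close> one has \<open>v - u = ((y - x) - (N y - N x) u) / N y\<close>, so that \<open>0 = \<Phi> v - \<Phi> u \<approx> D (v - u)\<close>
  determines \<open>N y - N x\<close> up to an error of smaller order, because the Lipschitz condition bounds
  \<open>v - u\<close> by a multiple of \<open>y - x\<close>.
\<close>

lemma implicit_norm_has_derivative:
  fixes N :: "'v::real_normed_vector \<Rightarrow> real"
  assumes U: "open U" "x \<in> U" and pos: "\<And>y. y \<in> U \<Longrightarrow> N y > 0"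
    and lip: "\<And>y. \<bar>N y - N x\<bar> \<le> C * norm (y - x)"
    and level: "\<And>y. y \<in> U \<Longrightarrow> \<Phi> (inverse (N y) *\<^sub>R y) = 1"
    and D: "(\<Phi> has_derivative D) (at (inverse (N x) *\<^sub>R x))"
    and nz: "D (inverse (N x) *\<^sub>R x) \<noteq> 0"
  shows "(N has_derivative (\<lambda>h. inverse (D (inverse (N x) *\<^sub>R x)) * D h)) (at x)"
proof -
  define u where "u = inverse (N x) *\<^sub>R x"
  define K where "K = 1 + \<bar>C\<bar> * norm u"
  have K: "K \<ge> 1" by (simp add: K_def)
  interpret D: bounded_linear D by (rule has_derivative_bounded_linear[OF D])
  have Nx: "N x > 0" using pos U by blast
  have diff: "inverse (N y) *\<^sub>R y - u = inverse (N y) *\<^sub>R ((y - x) - (N y - N x) *\<^sub>R u)"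
    if "y \<in> U" for y
    using pos[OF that] Nx by (simp add: u_def algebra_simps)
  have bd: "norm ((y - x) - (N y - N x) *\<^sub>R u) \<le> K * norm (y - x)" for y
  proof -
    have "norm ((y - x) - (N y - N x) *\<^sub>R u) \<le> norm (y - x) + \<bar>N y - N x\<bar> * norm u"
      by (metis norm_scaleR norm_triangle_ineq4)
    also have "\<bar>N y - N x\<bar> \<le> \<bar>C\<bar> * norm (y - x)"
      using lip[of y] by (smt (verit) mult_right_mono norm_ge_zero)
    finally show ?thesis by (simp add: K_def algebra_simps mult_right_mono)
  qed
  show ?thesis
    unfolding has_derivative_at_alt u_def[symmetric]
  proof (intro conjI allI impI)
    show "bounded_linear (\<lambda>h. inverse (D u) * D h)"
      by (intro bounded_linear_const_mult D.bounded_linear)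
  next
    fix e :: real assume e: "e > 0"
    define e' where "e' = e * \<bar>D u\<bar> / K"
    have Du: "D u \<noteq> 0" using nz by (simp add: u_def)
    have e': "e' > 0" using e Du K by (simp add: e'_def)
    obtain d where d: "d > 0" "\<And>v. norm (v - u) < d \<Longrightarrow> norm (\<Phi> v - \<Phi> u - D (v - u)) \<le> e' * norm (v - u)"
      using D e' unfolding has_derivative_at_alt u_def[symmetric] by blast
    obtain d1 where d1: "d1 > 0" "\<And>y. dist y x < d1 \<Longrightarrow> y \<in> U"
      using U by (auto simp: open_dist)
    \<comment> \<open>\<open>d2\<close> ensures \<open>N y \<ge> N x / 2\<close>; with it, \<open>d3\<close> brings \<open>y / N y\<close> within \<open>d\<close> of \<open>u\<close>.\<close>
    define d2 where "d2 = N x / (2 * (\<bar>C\<bar> + 1))"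
    define d3 where "d3 = d * N x / (2 * K)"
    have d23: "d2 > 0" "d3 > 0" using Nx d K by (auto simp: d2_def d3_def)
    show "\<exists>d>0. \<forall>y. norm (y - x) < d \<longrightarrow> norm (N y - N x - inverse (D u) * D (y - x)) \<le> e * norm (y - x)"
    proof (intro exI[of _ "min d1 (min d2 d3)"] conjI allI impI)
      show "min d1 (min d2 d3) > 0" using d1 d23 by simp
      fix y assume y: "norm (y - x) < min d1 (min d2 d3)"
      have yU: "y \<in> U" using d1 y by (auto simp: dist_norm)
      let ?w = "(y - x) - (N y - N x) *\<^sub>R u"
      let ?v = "inverse (N y) *\<^sub>R y"
      have Ny: "N y > 0" by (rule pos[OF yU])
      have "\<bar>N y - N x\<bar> \<le> (\<bar>C\<bar> + 1) * norm (y - x)"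
        using lip[of y] by (smt (verit) mult_right_mono norm_ge_zero)
      also have "\<dots> \<le> (\<bar>C\<bar> + 1) * d2" using y by (intro mult_left_mono) auto
      also have "\<dots> = N x / 2" by (simp add: d2_def field_simps)
      finally have Ny2: "N y \<ge> N x / 2" by linarith
      have "norm (?v - u) = norm ?w / N y"
        unfolding diff[OF yU] norm_scaleR using Ny by (simp add: field_simps)
      also have "\<dots> \<le> K * norm (y - x) / (N x / 2)"
        using bd Ny2 Nx K by (intro frac_le) auto
      also have "\<dots> < K * d3 / (N x / 2)"
        using y K Nx by (intro divide_strict_right_mono mult_strict_left_mono) auto
      also have "\<dots> = d" using K Nx by (simp add: d3_def)
      finally have "norm (\<Phi> ?v - \<Phi> u - D (?v - u)) \<le> e' * norm (?v - u)" by (rule d(2))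
      moreover have "\<Phi> ?v = 1" "\<Phi> u = 1" using level[OF yU] level[OF U(2)] by (simp_all add: u_def)
      ultimately have "\<bar>D (?v - u)\<bar> \<le> e' * norm (?v - u)" by simp
      then have "inverse (N y) * \<bar>D ?w\<bar> \<le> inverse (N y) * (e' * norm ?w)"
        unfolding diff[OF yU] using Ny by (simp only: D.scaleR norm_scaleR) (simp add: abs_mult algebra_simps)
      then have "\<bar>D ?w\<bar> \<le> e' * norm ?w" using Ny by simp
      also have "\<dots> \<le> e' * (K * norm (y - x))" using e' bd by (intro mult_left_mono) auto
      also have "\<dots> = \<bar>D u\<bar> * (e * norm (y - x))" using K by (simp add: e'_def)
      finally have *: "\<bar>D ?w\<bar> \<le> \<bar>D u\<bar> * (e * norm (y - x))" .
      have "\<bar>D u\<bar> * norm (N y - N x - inverse (D u) * D (y - x)) = \<bar>D u * (N y - N x) - D (y - x)\<bar>"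
        unfolding real_norm_def abs_mult[symmetric] using Du
        by (simp add: right_diff_distrib mult.assoc[symmetric])
      also have "\<dots> = \<bar>D ?w\<bar>" by (simp add: D.diff D.scaleR abs_minus_commute mult.commute)
      also note *
      finally show "norm (N y - N x - inverse (D u) * D (y - x)) \<le> e * norm (y - x)" using Du by simp
    qed
  qed
qed

text \<open>
  The formula for the derivative of \<open>N\<close> contains \<open>N\<close> itself only through the normalisation, so
  one more derivative of \<open>N\<close> costs one derivative of \<open>\<Phi>\<close> and uses the previous order for \<open>N\<close>.
\<close>

lemma fsmooth_implicit_norm:
  fixes N :: "'v::real_normed_vector \<Rightarrow> real"
  assumes U: "open U" and pos: "\<And>y. y \<in> U \<Longrightarrow> N y > 0"
    and lip: "\<And>x y. \<bar>N y - N x\<bar> \<le> C * norm (y - x)"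
    and \<Phi>: "\<And>k. fsmooth k W \<Phi>" and W: "\<And>y. y \<in> U \<Longrightarrow> inverse (N y) *\<^sub>R y \<in> W"
    and level: "\<And>y. y \<in> U \<Longrightarrow> \<Phi> (inverse (N y) *\<^sub>R y) = 1"
    and nz: "\<And>y D. y \<in> U \<Longrightarrow> (\<Phi> has_derivative D) (at (inverse (N y) *\<^sub>R y)) \<Longrightarrow> D (inverse (N y) *\<^sub>R y) \<noteq> 0"
  shows "fsmooth k U N"
proof (induction k)
  case 0
  have "\<bar>N y - N x\<bar> \<le> \<bar>C\<bar> * norm (y - x)" for x y
    using lip[of y x] by (smt (verit) mult_right_mono norm_ge_zero)
  then have "\<bar>C\<bar>-lipschitz_on U N"
    by (intro lipschitz_onI) (auto simp: dist_norm)
  then show ?case by (simp add: lipschitz_on_continuous_on)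
next
  case (Suc k)
  obtain ps where
    ps: "\<forall>(g, l)\<in>set ps. fsmooth k W g \<and> bounded_linear l" "\<forall>x\<in>W. (\<Phi> has_derivative lin_comb ps x) (at x)"
    using \<Phi>[of "Suc k"] by auto
  let ?u = "\<lambda>x. inverse (N x) *\<^sub>R x"
  have inv: "fsmooth k U (\<lambda>x. inverse (N x))"
    using pos by (intro fsmooth_compose[OF fsmooth_inverse Suc]) fastforce
  have sub: "fsmooth k U (\<lambda>x. g (?u x))" if "(g, l) \<in> set ps" for g l
    using fsmooth_scaled_argument[OF _ inv W] ps(1) that by fast
  let ?d = "\<lambda>x. lin_comb ps (?u x) (?u x)"
  have nz': "?d x \<noteq> 0" if "x \<in> U" for x using nz[OF that] ps(2) W[OF that] by blast
  have d: "fsmooth k U (\<lambda>x. inverse (?d x))"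
  proof (rule fsmooth_compose[OF fsmooth_inverse])
    show "fsmooth k U ?d"
      using sub ps(1) fsmooth_scaled_argument[OF fsmooth_linear[of _ k UNIV] inv]
      by (intro fsmooth_lin_comb) fast
    show "?d ` U \<subseteq> - {0}" using nz' by auto
  qed
  let ?rs = "map (\<lambda>(a, l). (\<lambda>x. inverse (?d x) * a x, l)) (map (\<lambda>(g, l). (\<lambda>x. g (?u x), l)) ps)"
  have "(N has_derivative lin_comb ?rs x) (at x)" if "x \<in> U" for x
  proof -
    have "lin_comb ?rs x = (\<lambda>h. inverse (?d x) * lin_comb ps (?u x) h)"
      by (rule ext) (simp only: lin_comb_scale lin_comb_subst)
    moreover have "(N has_derivative (\<lambda>h. inverse (?d x) * lin_comb ps (?u x) h)) (at x)"
      by (rule implicit_norm_has_derivative[where U = U and C = C and \<Phi> = \<Phi>])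
        (use U that pos lip level nz'[OF that] ps(2) W[OF that] in auto)
    ultimately show ?thesis by simp
  qed
  moreover have "\<forall>(a, l)\<in>set ?rs. fsmooth k U a \<and> bounded_linear l"
    using ps(1) d sub by (auto intro!: fsmooth_mult)
  ultimately show ?case by (subst fsmooth.simps) blast
qed

section \<open>Smoothness at a point and derivatives of all orders\<close>

definition smooth_at :: "('v::real_normed_vector \<Rightarrow> real) \<Rightarrow> 'v \<Rightarrow> bool" where
  "smooth_at f x \<longleftrightarrow> (\<exists>W. open W \<and> x \<in> W \<and> (\<forall>k. fsmooth k W f))"

lemma smooth_atI: "open W \<Longrightarrow> x \<in> W \<Longrightarrow> (\<And>k. fsmooth k W f) \<Longrightarrow> smooth_at f x"
  unfolding smooth_at_def by blast

lemma smooth_at_imp_isCont: "smooth_at f x \<Longrightarrow> isCont f x"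
  unfolding smooth_at_def by (metis fsmooth_imp_continuous_on continuous_on_eq_continuous_at)

lemma smooth_at_const [intro]: "smooth_at (\<lambda>_. c) x"
  by (rule smooth_atI[of UNIV]) auto

lemma smooth_at_linear: "bounded_linear l \<Longrightarrow> smooth_at l x"
  by (rule smooth_atI[of UNIV]) (auto intro: fsmooth_linear)

lemma smooth_at_common:
  assumes "smooth_at f x" "smooth_at g x"
  obtains W where "open W" "x \<in> W" "\<And>k. fsmooth k W f" "\<And>k. fsmooth k W g"
proof -
  from assms obtain V W where "open V" "x \<in> V" "\<forall>k. fsmooth k V f" "open W" "x \<in> W" "\<forall>k. fsmooth k W g"
    unfolding smooth_at_def by blast
  then show ?thesis
    by (intro that[of "V \<inter> W"]) (auto intro: fsmooth_subset)
qed

lemma smooth_at_add: "smooth_at f x \<Longrightarrow> smooth_at g x \<Longrightarrow> smooth_at (\<lambda>x. f x + g x) x"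
  by (erule (1) smooth_at_common) (auto intro: smooth_atI fsmooth_add)

lemma smooth_at_mult: "smooth_at f x \<Longrightarrow> smooth_at g x \<Longrightarrow> smooth_at (\<lambda>x. f x * g x) x"
  by (erule (1) smooth_at_common) (auto intro: smooth_atI fsmooth_mult)

lemma smooth_at_diff:
  assumes "smooth_at f x" "smooth_at g x"
  shows "smooth_at (\<lambda>x. f x - g x) x"
proof -
  have "smooth_at (\<lambda>x. f x + (- 1) * g x) x"
    by (intro smooth_at_add smooth_at_mult smooth_at_const assms)
  then show ?thesis by simp
qed

lemma smooth_at_power2: "smooth_at f x \<Longrightarrow> smooth_at (\<lambda>x. (f x)\<^sup>2) x"
  unfolding power2_eq_square by (intro smooth_at_mult)

lemma smooth_at_sum:
  "(\<And>i. i \<in> I \<Longrightarrow> smooth_at (f i) x) \<Longrightarrow> smooth_at (\<lambda>x. \<Sum>i\<in>I. f i x) x"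
  by (induction I rule: infinite_finite_induct) (auto intro: smooth_at_add)

lemma smooth_at_compose:
  assumes "smooth_at f x" "smooth_at \<phi> (f x)"
  shows "smooth_at (\<lambda>x. \<phi> (f x)) x"
proof -
  from assms obtain V T where V: "open V" "x \<in> V" "\<And>k. fsmooth k V f"
    and T: "open T" "f x \<in> T" "\<And>k. fsmooth k T \<phi>" unfolding smooth_at_def by blast
  have "open (V \<inter> f -` T)"
    using fsmooth_imp_continuous_on[OF V(3)] V(1) T(1) by (rule continuous_open_preimage)
  then show ?thesis
    using V T by (intro smooth_atI[of "V \<inter> f -` T"] fsmooth_compose[OF T(3)])
      (auto intro: fsmooth_subset)
qed

lemma smooth_at_precompose_linear:
  assumes "bounded_linear S" "smooth_at f (S x)"
  shows "smooth_at (\<lambda>x. f (S x)) x"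
proof -
  from assms obtain V where V: "open V" "S x \<in> V" "\<And>k. fsmooth k V f" unfolding smooth_at_def by blast
  have "open (S -` V)" using V(1) linear_continuous_on[OF assms(1)] by (simp add: open_vimage)
  then show ?thesis
    using V by (intro smooth_atI[of "S -` V"] fsmooth_precompose_linear[OF assms(1) V(3)]) auto
qed

lemma smooth_at_cong:
  assumes "smooth_at f x" "open W" "x \<in> W" "\<And>y. y \<in> W \<Longrightarrow> f y = g y"
  shows "smooth_at g x"
proof -
  from assms obtain V where V: "open V" "x \<in> V" "\<And>k. fsmooth k V f" unfolding smooth_at_def by blast
  show ?thesis
  proof (rule smooth_atI[of "V \<inter> W"])
    show "open (V \<inter> W)" "x \<in> V \<inter> W" using V assms(2,3) by auto
    fix k
    have "fsmooth k (V \<inter> W) f" by (rule fsmooth_subset[OF V(3)]) auto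
    then show "fsmooth k (V \<inter> W) g"
      by (rule fsmooth_cong[rotated -1]) (use V assms(2,4) in auto)
  qed
qed

lemma smooth_at_inverse: "smooth_at f x \<Longrightarrow> f x \<noteq> 0 \<Longrightarrow> smooth_at (\<lambda>x. inverse (f x)) x"
  using smooth_at_compose[of f x inverse] smooth_atI[of "- {0}" "f x" inverse] fsmooth_inverse by auto

lemma smooth_at_sqrt: "smooth_at f x \<Longrightarrow> f x > 0 \<Longrightarrow> smooth_at (\<lambda>x. sqrt (f x)) x"
  using smooth_at_compose[of f x sqrt] smooth_atI[of "{0<..}" "f x" sqrt] fsmooth_sqrt by auto

text \<open>
  Multilinear forms of the shape \<open>l\<^sub>1(v\<^sub>1) \<dots> l\<^sub>j(v\<^sub>j)\<close>, and sums of these with coefficients that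
  depend on the point. The derivatives of the functions considered here are all of this form.
\<close>

definition ml_prod :: "('v \<Rightarrow> real) list \<Rightarrow> 'v list \<Rightarrow> real" where
  "ml_prod ls vs = prod_list (map2 (\<lambda>l v. l v) ls vs)"

definition ml_sum :: "(('v \<Rightarrow> real) \<times> ('v \<Rightarrow> real) list) list \<Rightarrow> 'v \<Rightarrow> 'v list \<Rightarrow> real" where
  "ml_sum qs x vs = (\<Sum>(g, ls)\<leftarrow>qs. g x * ml_prod ls vs)"

lemma ml_sum_simps [simp]:
  "ml_sum [] x vs = 0" "ml_sum ((g, ls) # qs) x vs = g x * ml_prod ls vs + ml_sum qs x vs"
  "ml_sum (qs @ qs') x vs = ml_sum qs x vs + ml_sum qs' x vs"
  by (simp_all add: ml_sum_def)

lemma ml_prod_simps [simp]: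
  "ml_prod [] [] = 1" "ml_prod (l # ls) (v # vs) = l v * ml_prod ls vs"
  by (simp_all add: ml_prod_def)

lemma ml_prod_bound:
  assumes "\<forall>l\<in>set ls. bounded_linear l"
  shows "\<exists>K>0. multilinear_norm_le (length ls) (ml_prod ls) K"
  using assms
proof (induction ls)
  case Nil
  then show ?case by (auto simp: multilinear_norm_le_def intro!: exI[of _ 1])
next
  case (Cons l ls)
  then obtain K where K: "K > 0" "multilinear_norm_le (length ls) (ml_prod ls) K" by auto
  from Cons.prems obtain C where C: "C > 0" "\<And>v. norm (l v) \<le> norm v * C"
    using bounded_linear.pos_bounded[of l] by auto
  have "norm (ml_prod (l # ls) vs) \<le> (C * K) * prod_list (map norm vs)" if len: "length vs = length (l # ls)" for vs
  proof -
    obtain v ws where vs: "vs = v # ws" "length ws = length ls" using len by (auto simp: length_Suc_conv)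
    have "norm (ml_prod (l # ls) vs) = norm (l v) * norm (ml_prod ls ws)"
      by (simp add: vs abs_mult)
    also have "\<dots> \<le> (norm v * C) * (K * prod_list (map norm ws))"
      using K(2) vs(2) C by (intro mult_mono) (auto simp: multilinear_norm_le_def intro: mult_nonneg_nonneg)
    finally show ?thesis by (simp add: vs ac_simps)
  qed
  then show ?case using C K by (intro exI[of _ "C * K"]) (auto simp: multilinear_norm_le_def)
qed

lemma ml_prod_linear_slot:
  assumes "\<forall>l\<in>set ls. bounded_linear l" "length vs = length ls" "i < length ls"
  shows "linear (\<lambda>h. ml_prod ls (vs[i := h]))"
  using assms
proof (induction ls arbitrary: vs i)
  case Nil
  then show ?case by simp
next
  case (Cons l ls)
  obtain v ws where vs: "vs = v # ws" "length ws = length ls" using Cons.prems by (auto simp: length_Suc_conv)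
  show ?case
  proof (cases i)
    case 0
    have "linear l" using Cons.prems by (auto intro: bounded_linear.linear)
    then have "linear (\<lambda>h. ml_prod ls ws *\<^sub>R l h)" by (rule linear_compose_scale_right)
    then show ?thesis by (simp add: vs 0 mult.commute)
  next
    case (Suc j)
    have "linear (\<lambda>h. ml_prod ls (ws[j := h]))" using Cons vs Suc by simp
    then have "linear (\<lambda>h. l v *\<^sub>R ml_prod ls (ws[j := h]))" by (rule linear_compose_scale_right)
    then show ?thesis by (simp add: vs Suc)
  qed
qed

lemma prod_list_norm_nonneg: "0 \<le> prod_list (map norm vs)"
  by (induction vs) auto

lemma multilinear_norm_le_add:
  assumes "multilinear_norm_le k A a" "multilinear_norm_le k B b"
  shows "multilinear_norm_le k (\<lambda>vs. A vs + B vs) (a + b)"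
  using assms unfolding multilinear_norm_le_def distrib_right
  by (auto intro!: order_trans[OF norm_triangle_ineq] add_mono)

lemma multilinear_norm_le_scale:
  fixes A :: "'v::real_normed_vector list \<Rightarrow> real"
  assumes "multilinear_norm_le k A a" "\<bar>c\<bar> \<le> C" "0 \<le> a"
  shows "multilinear_norm_le k (\<lambda>vs. c * A vs) (C * a)"
  unfolding multilinear_norm_le_def
proof (intro allI impI)
  fix vs :: "'v list" assume "length vs = k"
  then have "norm (A vs) \<le> a * prod_list (map norm vs)" using assms(1) by (simp add: multilinear_norm_le_def)
  then have "\<bar>c\<bar> * norm (A vs) \<le> C * (a * prod_list (map norm vs))"
    using assms(2,3) by (intro mult_mono) (auto intro: prod_list_norm_nonneg mult_nonneg_nonneg)
  then show "norm (c * A vs) \<le> C * a * prod_list (map norm vs)" by (simp add: abs_mult ac_simps)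
qed

definition ml_ok :: "nat \<Rightarrow> nat \<Rightarrow> 'v::real_normed_vector set \<Rightarrow> (('v \<Rightarrow> real) \<times> ('v \<Rightarrow> real) list) list \<Rightarrow> bool" where
  "ml_ok j k W qs \<longleftrightarrow> (\<forall>(g, ls)\<in>set qs. fsmooth k W g \<and> length ls = j \<and> (\<forall>l\<in>set ls. bounded_linear l))"

lemma ml_ok_simps [simp]: "ml_ok j k W []"
  "ml_ok j k W ((g, ls) # qs) \<longleftrightarrow> fsmooth k W g \<and> length ls = j \<and> (\<forall>l\<in>set ls. bounded_linear l) \<and> ml_ok j k W qs"
  by (auto simp: ml_ok_def)

lemma ml_sum_bounded_multilinear: "ml_ok j k W qs \<Longrightarrow> bounded_multilinear j (ml_sum qs x)"
proof (induction qs)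
  case Nil
  show ?case
    by (auto simp: bounded_multilinear_def multilinear_norm_le_def linear_zero intro!: exI[of _ 0])
next
  case (Cons q qs)
  obtain g ls where q: "q = (g, ls)" by force
  have ls: "length ls = j" "\<forall>l\<in>set ls. bounded_linear l" using Cons.prems by (auto simp: q)
  obtain K where K: "K > 0" "multilinear_norm_le j (ml_prod ls) K" using ml_prod_bound[OF ls(2)] ls(1) by auto
  have IH: "bounded_multilinear j (ml_sum qs x)" using Cons by (auto simp: q)
  then obtain c where c: "multilinear_norm_le j (ml_sum qs x) c" by (auto simp: bounded_multilinear_def)
  have "linear (\<lambda>h. g x *\<^sub>R ml_prod ls (vs[i := h]) + ml_sum qs x (vs[i := h]))" if "length vs = j" "i < j" for vs i
    using IH ml_prod_linear_slot[OF ls(2)] that ls(1)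
    by (intro linear_compose_add linear_compose_scale_right) (auto simp: bounded_multilinear_def)
  moreover have "multilinear_norm_le j (\<lambda>vs. g x * ml_prod ls vs + ml_sum qs x vs) (\<bar>g x\<bar> * K + c)"
    using K c by (intro multilinear_norm_le_add multilinear_norm_le_scale) auto
  ultimately show ?case
    unfolding bounded_multilinear_def q
    by (auto simp: multilinear_norm_le_def)
qed

definition ml_deriv ::
  "(('v \<Rightarrow> real) \<Rightarrow> (('v \<Rightarrow> real) \<times> ('v \<Rightarrow> real)) list) \<Rightarrow>
   (('v \<Rightarrow> real) \<times> ('v \<Rightarrow> real) list) list \<Rightarrow> (('v \<Rightarrow> real) \<times> ('v \<Rightarrow> real) list) list" where
  "ml_deriv P qs = concat (map (\<lambda>(g, ls). map (\<lambda>(a, l). (a, l # ls)) (P g)) qs)"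

lemma ml_deriv_simps [simp]: "ml_deriv P [] = []"
  "ml_deriv P ((g, ls) # qs) = map (\<lambda>(a, l). (a, l # ls)) (P g) @ ml_deriv P qs"
  by (simp_all add: ml_deriv_def)

lemma ml_sum_deriv_item: "ml_sum (map (\<lambda>(a, l). (a, l # ls)) ps) x (h # vs) = lin_comb ps x h * ml_prod ls vs"
  by (induction ps) (auto simp: algebra_simps)

lemma ml_sum_has_derivative:
  assumes "\<And>g ls. (g, ls) \<in> set qs \<Longrightarrow> (g has_derivative lin_comb (P g) x) (at x)"
  shows "((\<lambda>y. ml_sum qs y vs) has_derivative (\<lambda>h. ml_sum (ml_deriv P qs) x (h # vs))) (at x)"
  using assms
proof (induction qs)
  case Nil
  then show ?case by simp
next
  case (Cons q qs)
  obtain g ls where q: "q = (g, ls)" by force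
  from Cons show ?case
    by (auto simp: q ml_sum_deriv_item intro!: has_derivative_add has_derivative_mult_left)
qed

lemma ml_sum_derivative_error:
  assumes "\<And>g ls. (g, ls) \<in> set qs \<Longrightarrow> (g has_derivative lin_comb (P g) x) (at x)"
    and "\<And>g ls. (g, ls) \<in> set qs \<Longrightarrow> length ls = j \<and> (\<forall>l\<in>set ls. bounded_linear l)" and "e > 0"
  shows "\<exists>d>0. \<forall>h. norm h < d \<longrightarrow>
    multilinear_norm_le j (\<lambda>vs. ml_sum qs (x + h) vs - ml_sum qs x vs - ml_sum (ml_deriv P qs) x (h # vs)) (e * norm h)"
  using assms
proof (induction qs arbitrary: e)
  case Nil
  then show ?case
    by (auto simp: multilinear_norm_le_def intro!: exI[of _ 1] mult_nonneg_nonneg prod_list_norm_nonneg)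
next
  case (Cons q qs)
  obtain g ls where q: "q = (g, ls)" by force
  have ls: "length ls = j" "\<forall>l\<in>set ls. bounded_linear l" using Cons.prems(2)[of g ls] by (simp_all add: q)
  obtain K where K: "K > 0" "multilinear_norm_le j (ml_prod ls) K" using ml_prod_bound[OF ls(2)] ls(1) by auto
  have "\<exists>d>0. \<forall>h. norm h < d \<longrightarrow>
    multilinear_norm_le j (\<lambda>vs. ml_sum qs (x + h) vs - ml_sum qs x vs - ml_sum (ml_deriv P qs) x (h # vs)) (e / 2 * norm h)"
    by (intro Cons.IH; use Cons.prems in \<open>fastforce simp: q\<close>)
  then obtain d where d: "d > 0" "\<And>h. norm h < d \<Longrightarrow>
    multilinear_norm_le j (\<lambda>vs. ml_sum qs (x + h) vs - ml_sum qs x vs - ml_sum (ml_deriv P qs) x (h # vs)) (e / 2 * norm h)"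
    by blast
  have "(g has_derivative lin_comb (P g) x) (at x)" using Cons.prems(1) by (auto simp: q)
  moreover have "e / (2 * K) > 0" using Cons.prems(3) K by simp
  ultimately obtain d' where d': "d' > 0" "\<And>y. norm (y - x) < d' \<Longrightarrow>
      norm (g y - g x - lin_comb (P g) x (y - x)) \<le> e / (2 * K) * norm (y - x)"
    unfolding has_derivative_at_alt by blast
  show ?case
  proof (intro exI[of _ "min d d'"] conjI allI impI)
    show "min d d' > 0" using d d' by simp
    fix h :: 'a assume h: "norm h < min d d'"
    have "\<bar>g (x + h) - g x - lin_comb (P g) x h\<bar> \<le> e / (2 * K) * norm h" using d'(2)[of "x + h"] h by simp
    then have "multilinear_norm_le j (\<lambda>vs. (g (x + h) - g x - lin_comb (P g) x h) * ml_prod ls vs +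
        (ml_sum qs (x + h) vs - ml_sum qs x vs - ml_sum (ml_deriv P qs) x (h # vs)))
        (e / (2 * K) * norm h * K + e / 2 * norm h)"
      using K h d(2) by (intro multilinear_norm_le_add multilinear_norm_le_scale) auto
    moreover have "e / (2 * K) * norm h * K + e / 2 * norm h = e * norm h"
      using K(1) by (simp add: field_simps)
    ultimately show "multilinear_norm_le j (\<lambda>vs. ml_sum (q # qs) (x + h) vs - ml_sum (q # qs) x vs -
        ml_sum (ml_deriv P (q # qs)) x (h # vs)) (e * norm h)"
      by (simp add: q ml_sum_deriv_item algebra_simps)
  qed
qed

lemma ml_sum_continuous:
  assumes "\<And>g ls. (g, ls) \<in> set qs \<Longrightarrow> isCont g x"
    and "\<And>g ls. (g, ls) \<in> set qs \<Longrightarrow> length ls = j \<and> (\<forall>l\<in>set ls. bounded_linear l)" and "e > 0"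
  shows "\<exists>d>0. \<forall>y. dist y x < d \<longrightarrow> multilinear_norm_le j (\<lambda>vs. ml_sum qs y vs - ml_sum qs x vs) e"
  using assms
proof (induction qs arbitrary: e)
  case Nil
  then show ?case
    by (auto simp: multilinear_norm_le_def intro!: exI[of _ 1] mult_nonneg_nonneg prod_list_norm_nonneg)
next
  case (Cons q qs)
  obtain g ls where q: "q = (g, ls)" by force
  have ls: "length ls = j" "\<forall>l\<in>set ls. bounded_linear l" using Cons.prems(2)[of g ls] by (simp_all add: q)
  obtain K where K: "K > 0" "multilinear_norm_le j (ml_prod ls) K" using ml_prod_bound[OF ls(2)] ls(1) by auto
  have "\<exists>d>0. \<forall>y. dist y x < d \<longrightarrow> multilinear_norm_le j (\<lambda>vs. ml_sum qs y vs - ml_sum qs x vs) (e / 2)"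
    by (intro Cons.IH; use Cons.prems in \<open>fastforce simp: q\<close>)
  then obtain d where d: "d > 0" "\<And>y. dist y x < d \<Longrightarrow>
      multilinear_norm_le j (\<lambda>vs. ml_sum qs y vs - ml_sum qs x vs) (e / 2)"
    by blast
  have "isCont g x" using Cons.prems(1) by (auto simp: q)
  moreover have "e / (2 * K) > 0" using Cons.prems(3) K by simp
  ultimately obtain d' where d': "d' > 0" "\<And>y. dist y x < d' \<Longrightarrow> \<bar>g y - g x\<bar> < e / (2 * K)"
    unfolding continuous_at_eps_delta dist_real_def by blast
  show ?case
  proof (intro exI[of _ "min d d'"] conjI allI impI)
    show "min d d' > 0" using d d' by simp
    fix y assume y: "dist y x < min d d'"
    have "multilinear_norm_le j (\<lambda>vs. (g y - g x) * ml_prod ls vs + (ml_sum qs y vs - ml_sum qs x vs))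
        (e / (2 * K) * K + e / 2)"
      using K y d(2) d'(2)[of y] by (intro multilinear_norm_le_add multilinear_norm_le_scale) auto
    then show "multilinear_norm_le j (\<lambda>vs. ml_sum (q # qs) y vs - ml_sum (q # qs) x vs) e"
      using K(1) by (simp add: q algebra_simps)
  qed
qed

lemma directional_DERIV:
  fixes f :: "'v::real_normed_vector \<Rightarrow> real"
  assumes D: "(f has_derivative D) (at x)"
  shows "((\<lambda>t. f (x + t *\<^sub>R h)) has_real_derivative D h) (at 0)"
proof -
  interpret D: bounded_linear D by (rule has_derivative_bounded_linear[OF D])
  have "((\<lambda>t. x + t *\<^sub>R h) has_derivative (\<lambda>t. t *\<^sub>R h)) (at 0)"
    by (auto intro!: derivative_eq_intros)
  from has_derivative_compose[OF this, of f D] D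
  have "((\<lambda>t. f (x + t *\<^sub>R h)) has_derivative (\<lambda>t. D (t *\<^sub>R h))) (at 0)" by simp
  moreover have "(\<lambda>t. D (t *\<^sub>R h)) = (*) (D h)" by (rule ext) (simp add: D.scaleR mult.commute)
  ultimately show ?thesis by (simp add: has_field_derivative_def)
qed

text \<open>
  The candidate for the derivative of order \<open>length vs\<close> is defined by directional derivatives.
  This makes it canonical, so that descriptions on different neighbourhoods need no gluing.
\<close>

primrec iterated_deriv :: "('v::real_normed_vector \<Rightarrow> real) \<Rightarrow> 'v list \<Rightarrow> 'v \<Rightarrow> real" where
  "iterated_deriv f [] = f"
| "iterated_deriv f (h # vs) = (\<lambda>x. deriv (\<lambda>t. iterated_deriv f vs (x + t *\<^sub>R h)) 0)"

lemma ml_ok_has_derivative: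
  assumes "ml_ok j (Suc k) W qs"
  obtains P where "\<And>g ls x. (g, ls) \<in> set qs \<Longrightarrow> x \<in> W \<Longrightarrow> (g has_derivative lin_comb (P g) x) (at x)"
    "ml_ok (Suc j) k W (ml_deriv P qs)"
proof -
  have "\<forall>g\<in>fst ` set qs. \<exists>ps. (\<forall>(a, l)\<in>set ps. fsmooth k W a \<and> bounded_linear l) \<and>
      (\<forall>x\<in>W. (g has_derivative lin_comb ps x) (at x))"
    using assms by (force simp: ml_ok_def)
  then obtain P where P: "\<And>g. g \<in> fst ` set qs \<Longrightarrow> (\<forall>(a, l)\<in>set (P g). fsmooth k W a \<and> bounded_linear l) \<and>
      (\<forall>x\<in>W. (g has_derivative lin_comb (P g) x) (at x))"
    by metis
  have "ml_ok (Suc j) k W (ml_deriv P qs)"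
    unfolding ml_ok_def
  proof (intro ballI, clarify)
    fix a ms assume "(a, ms) \<in> set (ml_deriv P qs)"
    then obtain g ls l where g: "(g, ls) \<in> set qs" "(a, l) \<in> set (P g)" "ms = l # ls"
      by (auto simp: ml_deriv_def)
    have "fsmooth k W a \<and> bounded_linear l" using P[of g] g by force
    moreover have "length ls = j \<and> (\<forall>l\<in>set ls. bounded_linear l)"
      using assms g(1) unfolding ml_ok_def by blast
    ultimately show "fsmooth k W a \<and> length ms = Suc j \<and> (\<forall>l\<in>set ms. bounded_linear l)"
      using g(3) by simp
  qed
  moreover have "(g has_derivative lin_comb (P g) x) (at x)" if "(g, ls) \<in> set qs" "x \<in> W" for g ls x
    using P[of g] that by force
  ultimately show ?thesis using that by blast
qed

lemma iterated_deriv_step: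
  assumes W: "open W" "x \<in> W"
    and eq: "\<And>y. y \<in> W \<Longrightarrow> iterated_deriv f vs y = ml_sum qs y vs"
    and P: "\<And>g ls. (g, ls) \<in> set qs \<Longrightarrow> (g has_derivative lin_comb (P g) x) (at x)"
  shows "iterated_deriv f (h # vs) x = ml_sum (ml_deriv P qs) x (h # vs)"
proof -
  have "((\<lambda>y. ml_sum qs y vs) has_derivative (\<lambda>h. ml_sum (ml_deriv P qs) x (h # vs))) (at x)"
    by (rule ml_sum_has_derivative[OF P])
  then have "(iterated_deriv f vs has_derivative (\<lambda>h. ml_sum (ml_deriv P qs) x (h # vs))) (at x)"
    by (rule has_derivative_transform_within_open[OF _ W]) (simp add: eq)
  from directional_DERIV[OF this] show ?thesis by (simp add: DERIV_imp_deriv)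
qed

lemma iterated_deriv_ml_sum:
  assumes "open W" "\<And>k. fsmooth k W f"
  shows "\<exists>qs. ml_ok j k W qs \<and> (\<forall>x\<in>W. \<forall>vs. length vs = j \<longrightarrow> iterated_deriv f vs x = ml_sum qs x vs)"
proof (induction j arbitrary: k)
  case 0
  show ?case using assms by (intro exI[of _ "[(f, [])]"]) auto
next
  case (Suc j)
  then obtain qs where qs: "ml_ok j (Suc k) W qs"
    "\<And>x vs. x \<in> W \<Longrightarrow> length vs = j \<Longrightarrow> iterated_deriv f vs x = ml_sum qs x vs" by metis
  obtain P where P: "\<And>g ls x. (g, ls) \<in> set qs \<Longrightarrow> x \<in> W \<Longrightarrow> (g has_derivative lin_comb (P g) x) (at x)"
    "ml_ok (Suc j) k W (ml_deriv P qs)" using ml_ok_has_derivative[OF qs(1)] by blast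
  have "iterated_deriv f vs x = ml_sum (ml_deriv P qs) x vs" if x: "x \<in> W" and len: "length vs = Suc j" for x vs
  proof -
    obtain h ws where vs: "vs = h # ws" "length ws = j" using len by (auto simp: length_Suc_conv)
    show ?thesis unfolding vs(1)
      using iterated_deriv_step[OF assms(1) x, of f ws qs P] qs(2) vs(2) P(1) x by blast
  qed
  with P(2) show ?case by blast
qed

text \<open>
  On a neighbourhood of each point the iterated directional derivatives are finite sums of
  products of linear functionals; for such sums the error estimates in the definition of \<open>Ck_on\<close>
  reduce to the coefficient functions.
\<close>

theorem Ck_on_smooth_at:
  assumes "open U" "\<And>x. x \<in> U \<Longrightarrow> smooth_at f x"
  shows "Ck_on k U f"
  unfolding Ck_on_def
proof (intro conjI exI[of _ "\<lambda>j x vs. iterated_deriv f vs x"] allI impI ballI)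
  fix j x assume x: "x \<in> U"
  then obtain W where W: "open W" "x \<in> W" "\<And>k. fsmooth k W f" using assms(2) unfolding smooth_at_def by blast
  obtain qs where qs: "ml_ok j (Suc 0) W qs"
    "\<And>y vs. y \<in> W \<Longrightarrow> length vs = j \<Longrightarrow> iterated_deriv f vs y = ml_sum qs y vs"
    using iterated_deriv_ml_sum[OF W(1,3)] by metis
  obtain P where P: "\<And>g ls x. (g, ls) \<in> set qs \<Longrightarrow> x \<in> W \<Longrightarrow> (g has_derivative lin_comb (P g) x) (at x)"
    "ml_ok (Suc j) 0 W (ml_deriv P qs)" using ml_ok_has_derivative[OF qs(1)] by blast
  have step: "iterated_deriv f (h # vs) x = ml_sum (ml_deriv P qs) x (h # vs)" if "length vs = j" for h vs
    using iterated_deriv_step[OF W(1,2), of f vs qs P] qs(2) that P(1) W(2) by blast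
  have qs': "length ls = j \<and> (\<forall>l\<in>set ls. bounded_linear l)" if "(g, ls) \<in> set qs" for g ls
    using qs(1) that by (force simp: ml_ok_def)
  obtain d0 where d0: "d0 > 0" "\<And>y. dist y x < d0 \<Longrightarrow> y \<in> W" using W by (auto simp: open_dist)
  show "multilinear_has_derivative_at j (\<lambda>x vs. iterated_deriv f vs x) (\<lambda>vs. iterated_deriv f vs x) x"
    unfolding multilinear_has_derivative_at_def
  proof (intro conjI allI impI)
    have "bounded_multilinear (Suc j) (ml_sum (ml_deriv P qs) x)" by (rule ml_sum_bounded_multilinear[OF P(2)])
    moreover have "iterated_deriv f vs x = ml_sum (ml_deriv P qs) x vs" if "length vs = Suc j" for vs
      using step that by (cases vs) auto
    ultimately show "bounded_multilinear (Suc j) (\<lambda>vs. iterated_deriv f vs x)"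
      unfolding bounded_multilinear_def multilinear_norm_le_def by simp
  next
    fix e :: real assume "e > 0"
    then obtain d where d: "d > 0" "\<And>h. norm h < d \<Longrightarrow> multilinear_norm_le j
        (\<lambda>vs. ml_sum qs (x + h) vs - ml_sum qs x vs - ml_sum (ml_deriv P qs) x (h # vs)) (e * norm h)"
      using ml_sum_derivative_error[of qs P x j e] P(1) W(2) qs' by blast
    show "\<exists>d>0. \<forall>h. norm h < d \<longrightarrow> multilinear_norm_le j (\<lambda>vs. iterated_deriv f vs (x + h) -
        iterated_deriv f vs x - iterated_deriv f (h # vs) x) (e * norm h)"
    proof (intro exI[of _ "min d d0"] conjI allI impI)
      fix h :: 'a assume h: "norm h < min d d0"
      then have "x + h \<in> W" using d0(2)[of "x + h"] by (simp add: dist_norm)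
      then show "multilinear_norm_le j (\<lambda>vs. iterated_deriv f vs (x + h) -
          iterated_deriv f vs x - iterated_deriv f (h # vs) x) (e * norm h)"
        using d(2)[of h] h step qs(2) W(2) unfolding multilinear_norm_le_def by simp
    qed (use d d0 in auto)
  qed
next
  fix j
  show "multilinear_continuous_on j U (\<lambda>x vs. iterated_deriv f vs x)"
    unfolding multilinear_continuous_on_def
  proof (intro ballI allI impI)
    fix x and e :: real assume x: "x \<in> U" and e: "e > 0"
    then obtain W where W: "open W" "x \<in> W" "\<And>k. fsmooth k W f" using assms(2) unfolding smooth_at_def by blast
    obtain qs where qs: "ml_ok j 0 W qs"
      "\<And>y vs. y \<in> W \<Longrightarrow> length vs = j \<Longrightarrow> iterated_deriv f vs y = ml_sum qs y vs"
      using iterated_deriv_ml_sum[OF W(1,3)] by metis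
    obtain d0 where d0: "d0 > 0" "\<And>y. dist y x < d0 \<Longrightarrow> y \<in> W" using W by (auto simp: open_dist)
    have qs': "length ls = j \<and> (\<forall>l\<in>set ls. bounded_linear l)" "isCont g x" if "(g, ls) \<in> set qs" for g ls
    proof -
      have *: "fsmooth 0 W g \<and> length ls = j \<and> (\<forall>l\<in>set ls. bounded_linear l)"
        using qs(1) that unfolding ml_ok_def by blast
      then show "length ls = j \<and> (\<forall>l\<in>set ls. bounded_linear l)" by blast
      show "isCont g x" using * W(1,2) continuous_on_eq_continuous_at by auto
    qed
    obtain d where d: "d > 0" "\<And>y. dist y x < d \<Longrightarrow>
        multilinear_norm_le j (\<lambda>vs. ml_sum qs y vs - ml_sum qs x vs) e"
      using ml_sum_continuous[of qs x j e] qs' e by blast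
    show "\<exists>d>0. \<forall>y\<in>U. dist y x < d \<longrightarrow>
        multilinear_norm_le j (\<lambda>vs. iterated_deriv f vs y - iterated_deriv f vs x) e"
    proof (intro exI[of _ "min d d0"] conjI ballI impI)
      fix y assume "dist y x < min d d0"
      then show "multilinear_norm_le j (\<lambda>vs. iterated_deriv f vs y - iterated_deriv f vs x) e"
        using d(2)[of y] d0(2)[of y] qs(2) W(2) unfolding multilinear_norm_le_def by simp
    qed (use d d0 in auto)
  qed
qed (use assms in auto)

section \<open>A flat convex function on the line\<close>

text \<open>
  The classical flat functions \<open>exp (-1/s) / s\<^sup>n\<close>. The space that they span
  is closed under differentiation, which gives smoothness at \<open>0\<close> together with smoothness
  elsewhere.
\<close>

definition exp_ramp :: "nat \<Rightarrow> real \<Rightarrow> real" where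
  "exp_ramp n s = (if s > 0 then exp (- inverse s) * inverse s ^ n else 0)"

lemma exp_ramp_tendsto_0: "(exp_ramp n \<longlongrightarrow> 0) (at 0)"
proof -
  have 1: "((\<lambda>x::real. x ^ n / exp x) \<longlongrightarrow> 0) at_top" by (rule tendsto_power_div_exp_0)
  have "((\<lambda>s::real. inverse s ^ n / exp (inverse s)) \<longlongrightarrow> 0) (at_right 0)"
    by (rule filterlim_compose[OF 1 filterlim_inverse_at_top_right])
  then have "(exp_ramp n \<longlongrightarrow> 0) (at_right 0)"
    by (rule Lim_transform_eventually)
      (auto simp: exp_ramp_def eventually_at_filter exp_minus divide_inverse)
  moreover have "(exp_ramp n \<longlongrightarrow> 0) (at_left 0)"
    by (rule tendsto_eventually) (auto simp: exp_ramp_def eventually_at_filter)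
  ultimately show ?thesis by (simp add: filterlim_split_at)
qed

lemma exp_ramp_deriv:
  "(exp_ramp n has_real_derivative exp_ramp (n + 2) s - of_nat n * exp_ramp (n + 1) s) (at s)"
proof -
  consider "s > 0" | "s < 0" | "s = 0" by linarith
  then show ?thesis
  proof cases
    case 1
    have "((\<lambda>s. exp (- inverse s) * inverse s ^ n) has_real_derivative
        exp_ramp (n + 2) s - of_nat n * exp_ramp (n + 1) s) (at s)"
      using 1 by (auto intro!: derivative_eq_intros simp: exp_ramp_def)
        (cases n; simp add: field_simps power2_eq_square)
    then show ?thesis
      by (rule has_field_derivative_transform_within_open[of _ _ _ "{0<..}"]) (use 1 in \<open>auto simp: exp_ramp_def\<close>)
  next
    case 2
    have "((\<lambda>_. 0) has_real_derivative exp_ramp (n + 2) s - of_nat n * exp_ramp (n + 1) s) (at s)"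
      using 2 by (simp add: exp_ramp_def)
    then show ?thesis
      by (rule has_field_derivative_transform_within_open[of _ _ _ "{..<0}"]) (use 2 in \<open>auto simp: exp_ramp_def\<close>)
  next
    case 3
    have "((\<lambda>h. (exp_ramp n (0 + h) - exp_ramp n 0) / h) \<longlongrightarrow> 0) (at 0)"
      by (rule Lim_transform_eventually[OF exp_ramp_tendsto_0[of "Suc n"]])
        (auto simp: exp_ramp_def eventually_at_filter divide_inverse)
    then show ?thesis by (simp add: 3 DERIV_def) (simp add: exp_ramp_def)
  qed
qed

lemma fsmooth_exp_ramp: "fsmooth k UNIV (exp_ramp n)"
proof (induction k arbitrary: n)
  case 0
  then show ?case
    using exp_ramp_deriv by (auto intro!: continuous_at_imp_continuous_on DERIV_isCont)
next
  case (Suc k)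
  let ?ps = "[(\<lambda>s. exp_ramp (n + 2) s + (- of_nat n) * exp_ramp (n + 1) s, \<lambda>h::real. h)]"
  have "(exp_ramp n has_derivative lin_comb ?ps s) (at s)" for s
  proof -
    have "(*) (exp_ramp (n + 2) s - of_nat n * exp_ramp (n + 1) s) = lin_comb ?ps s" by (rule ext) simp
    then show ?thesis using exp_ramp_deriv[of n s] unfolding has_field_derivative_def by metis
  qed
  moreover have "fsmooth k UNIV (\<lambda>s. exp_ramp (n + 2) s + (- of_nat n) * exp_ramp (n + 1) s)"
    by (intro fsmooth_add fsmooth_mult fsmooth_const Suc)
  ultimately show ?case
    by (subst fsmooth.simps, intro exI[of _ ?ps]) (simp add: bounded_linear_ident)
qed

text \<open>
  The factor \<open>s\<close> makes the function convex on the whole line: its second derivative is a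
  multiple of \<open>exp_ramp 3\<close>. The normalisation is \<open>ramp 1 = 1\<close>.
\<close>

definition ramp :: "real \<Rightarrow> real" where
  "ramp s = (if s > 0 then s * exp (1 - inverse s) else 0)"

lemma ramp_eq: "ramp s = exp 1 * (s * exp_ramp 0 s)"
  by (simp add: ramp_def exp_ramp_def exp_diff exp_minus divide_inverse)

lemma smooth_at_ramp: "smooth_at ramp s"
proof (rule smooth_atI[of UNIV])
  have "fsmooth k UNIV (\<lambda>s. exp 1 * (s * exp_ramp 0 s))" for k
    by (intro fsmooth_mult fsmooth_const fsmooth_exp_ramp fsmooth_linear[OF bounded_linear_ident])
  then show "fsmooth k UNIV ramp" for k using ramp_eq by presburger
qed auto

lemma ramp_deriv: "(ramp has_real_derivative exp 1 * (exp_ramp 0 s + exp_ramp 1 s)) (at s)"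
proof -
  have "((\<lambda>s. exp 1 * (s * exp_ramp 0 s)) has_real_derivative exp 1 * (exp_ramp 0 s + s * exp_ramp 2 s)) (at s)"
    using exp_ramp_deriv[of 0 s] by (auto intro!: derivative_eq_intros simp: algebra_simps numeral_2_eq_2)
  moreover have "s * exp_ramp 2 s = exp_ramp 1 s" by (simp add: exp_ramp_def power2_eq_square)
  moreover have "ramp = (\<lambda>s. exp 1 * (s * exp_ramp 0 s))" using ramp_eq by blast
  ultimately show ?thesis by simp
qed

lemma ramp_deriv_deriv:
  "((\<lambda>s. exp 1 * (exp_ramp 0 s + exp_ramp 1 s)) has_real_derivative exp 1 * exp_ramp 3 s) (at s)"
  using exp_ramp_deriv[of 0 s] exp_ramp_deriv[of 1 s]
  by (auto intro!: derivative_eq_intros simp: numeral_3_eq_3 numeral_2_eq_2)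

lemma exp_ramp_nonneg: "0 \<le> exp_ramp n s" and exp_ramp_pos: "s > 0 \<Longrightarrow> 0 < exp_ramp n s"
  by (auto simp: exp_ramp_def)

lemma ramp_simps [simp]: "s \<le> 0 \<Longrightarrow> ramp s = 0" "ramp 1 = 1" "0 \<le> ramp s"
  by (auto simp: ramp_def)

lemma ramp_pos_iff: "0 < ramp s \<longleftrightarrow> 0 < s"
  by (auto simp: ramp_def)

lemma ramp_strict_mono: "0 \<le> s \<Longrightarrow> s < t \<Longrightarrow> ramp s < ramp t"
proof (cases "s = 0")
  case False
  assume "0 \<le> s" "s < t"
  then show ?thesis using False
    by (auto simp: ramp_def intro!: mult_strict_mono)
qed (auto simp: ramp_pos_iff)

lemma ramp_mono: "s \<le> t \<Longrightarrow> ramp s \<le> ramp t"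
  using ramp_strict_mono[of s t] by (cases "s \<le> 0"; cases "s = t") auto

lemma ramp_le_1_iff: "ramp s \<le> 1 \<longleftrightarrow> s \<le> 1"
  using ramp_strict_mono[of 1 s] ramp_mono[of s 1] by (cases "s \<le> 1") auto

lemma ramp_bound: "0 \<le> s \<Longrightarrow> ramp s \<le> exp 1 * s"
  by (auto simp: ramp_def mult.commute[of s] intro!: mult_right_mono)

lemma ramp_isCont: "isCont ramp s"
  by (rule DERIV_isCont[OF ramp_deriv])

lemma ramp_convex: "convex_on UNIV ramp"
proof (rule convex_on_realI[OF _ ramp_deriv])
  fix x y :: real assume "x \<le> y"
  then show "exp 1 * (exp_ramp 0 x + exp_ramp 1 x) \<le> exp 1 * (exp_ramp 0 y + exp_ramp 1 y)"
    by (rule DERIV_nonneg_imp_nondecreasing)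
      (use ramp_deriv_deriv exp_ramp_nonneg in \<open>auto intro!: exI mult_nonneg_nonneg\<close>)
qed auto

lemma ramp_midpoint_less:
  assumes "0 \<le> a" "a < b"
  shows "2 * ramp ((a + b) / 2) < ramp a + ramp b"
proof -
  define m where "m = (a + b) / 2"
  let ?r = "\<lambda>s. exp 1 * (exp_ramp 0 s + exp_ramp 1 s)"
  have m: "a < m" "m < b" using assms by (auto simp: m_def)
  obtain x where x: "a < x" "x < m" "ramp m - ramp a = (m - a) * ?r x"
    using MVT2[OF m(1), of ramp ?r] ramp_deriv by blast
  obtain y where y: "m < y" "y < b" "ramp b - ramp m = (b - m) * ?r y"
    using MVT2[OF m(2), of ramp ?r] ramp_deriv by blast
  have "?r x < ?r y"
  proof (rule DERIV_pos_imp_increasing[of x y ?r])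
    show "x < y" using x y by simp
    fix s assume "x \<le> s"
    then have "s > 0" using x assms by simp
    then show "\<exists>d. ((\<lambda>s. ?r s) has_real_derivative d) (at s) \<and> 0 < d"
      by (intro exI[of _ "exp 1 * exp_ramp 3 s"] conjI ramp_deriv_deriv) (simp add: exp_ramp_pos)
  qed
  then have "(m - a) * ?r x < (m - a) * ?r y" using m(1) by (intro mult_strict_left_mono) auto
  moreover have "b - m = m - a" by (simp add: m_def field_simps)
  ultimately have "ramp m - ramp a < ramp b - ramp m" using x(3) y(3) by presburger
  then show ?thesis by (simp add: m_def)
qed

text \<open>
  Strict convexity fails on the negative half-line, but one positive argument is enough: for
  \<open>a \<le> 0\<close> the midpoint is at most \<open>b / 2\<close>, and \<open>ramp (b / 2)\<close> is less than half of \<open>ramp b\<close>.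
\<close>

lemma ramp_midpoint_eqD:
  assumes eq: "ramp a + ramp b = 2 * ramp ((a + b) / 2 - e)" and "b > 0" "e \<ge> 0"
  shows "a = b" "e = 0"
proof -
  have 1: "ramp ((a + b) / 2 - e) \<le> ramp ((a + b) / 2)" using \<open>e \<ge> 0\<close> by (intro ramp_mono) linarith
  show ab: "a = b"
  proof (rule ccontr)
    assume ne: "a \<noteq> b"
    have "2 * ramp ((a + b) / 2) < ramp a + ramp b"
    proof (cases "a \<ge> 0")
      case True
      then show ?thesis
        using ne ramp_midpoint_less[of a b] ramp_midpoint_less[of b a] assms(2)
        by (cases "a < b") (auto simp: add.commute)
    next
      case False
      have "ramp ((a + b) / 2) \<le> ramp (b / 2)" using False by (intro ramp_mono) auto
      moreover have "2 * ramp (b / 2) < ramp b" using ramp_midpoint_less[of 0 b] assms(2) by simp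
      ultimately show ?thesis using False by simp
    qed
    with 1 eq show False by simp
  qed
  show "e = 0"
  proof (rule ccontr)
    assume "e \<noteq> 0"
    then have e: "e > 0" using assms by simp
    have "ramp (b - e) < ramp b"
    proof (cases "b - e \<ge> 0")
      case True
      then show ?thesis using e by (intro ramp_strict_mono) auto
    next
      case False
      then show ?thesis using assms by (simp add: ramp_pos_iff)
    qed
    with eq ab show False by simp
  qed
qed

text \<open>
  A quantitative form of \<open>ramp_midpoint_eqD\<close>. The sequences lie in a compact set, and every
  cluster point satisfies the equality in that lemma.
\<close>

lemma ramp_gap_tendsto:
  fixes a b e s :: "nat \<Rightarrow> real"
  assumes s: "s \<longlonglongrightarrow> 1/2" and b: "b \<longlonglongrightarrow> z" "z > 0"
    and bdd: "\<forall>\<^sub>F r in sequentially. \<bar>a r\<bar> \<le> K \<and> 0 \<le> e r \<and> e r \<le> K"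
    and gap: "(\<lambda>r. s r * ramp (a r) + (1 - s r) * ramp (b r) - ramp (s r * a r + (1 - s r) * b r - e r)) \<longlonglongrightarrow> 0"
  shows "a \<longlonglongrightarrow> z" "e \<longlonglongrightarrow> 0"
proof -
  have "(\<lambda>r. (a r, e r)) \<longlonglongrightarrow> (z, 0)"
  proof (rule ccontr)
    assume "\<not> (\<lambda>r. (a r, e r)) \<longlonglongrightarrow> (z, 0)"
    then obtain d where d: "d > 0" "\<exists>\<^sub>F r in sequentially. \<not> dist (a r, e r) (z, 0) < d"
      by (auto simp: tendsto_iff not_eventually)
    have "\<exists>\<^sub>F r in sequentially. \<not> dist (a r, e r) (z, 0) < d \<and> \<bar>a r\<bar> \<le> K \<and> 0 \<le> e r \<and> e r \<le> K"
      using frequently_eventually_frequently[OF d(2) bdd] .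
    then obtain f :: "nat \<Rightarrow> nat" where "strict_mono f"
      "\<forall>r. \<not> dist (a (f r), e (f r)) (z, 0) < d \<and> \<bar>a (f r)\<bar> \<le> K \<and> 0 \<le> e (f r) \<and> e (f r) \<le> K"
      using not_eventually_sequentiallyD[of "\<lambda>r. \<not> (\<not> dist (a r, e r) (z, 0) < d \<and> \<bar>a r\<bar> \<le> K \<and> 0 \<le> e r \<and> e r \<le> K)"]
      unfolding frequently_def by auto
    then have f: "strict_mono f" "\<And>r. \<not> dist (a (f r), e (f r)) (z, 0) < d"
      and bdf: "\<And>r. \<bar>a (f r)\<bar> \<le> K" "\<And>r. 0 \<le> e (f r)" "\<And>r. e (f r) \<le> K"
      by auto
    have "bounded (range (\<lambda>r. (a (f r), e (f r))))"
      by (rule bounded_subset[OF bounded_Times[of "{-K..K}" "{0..K}"]])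
        (use bdf in \<open>auto simp: abs_le_iff minus_le_iff\<close>)
    then obtain l g where g: "strict_mono (g :: nat \<Rightarrow> nat)" "((\<lambda>r. (a (f r), e (f r))) \<circ> g) \<longlonglongrightarrow> l"
      using bounded_imp_convergent_subsequence by metis
    obtain a' e' where l: "l = (a', e')" by force
    let ?h = "f \<circ> g"
    have h: "strict_mono ?h" using f(1) g(1) by (rule strict_mono_o)
    have a': "(a \<circ> ?h) \<longlonglongrightarrow> a'" and e': "(e \<circ> ?h) \<longlonglongrightarrow> e'"
      using tendsto_fst[OF g(2)] tendsto_snd[OF g(2)] by (simp_all add: l o_def)
    have s': "(s \<circ> ?h) \<longlonglongrightarrow> 1/2" and b': "(b \<circ> ?h) \<longlonglongrightarrow> z"
      using LIMSEQ_subseq_LIMSEQ[OF s h] LIMSEQ_subseq_LIMSEQ[OF b(1) h] by simp_all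
    have "((\<lambda>r. s r * ramp (a r) + (1 - s r) * ramp (b r) - ramp (s r * a r + (1 - s r) * b r - e r)) \<circ> ?h)
        \<longlonglongrightarrow> 1/2 * ramp a' + (1 - 1/2) * ramp z - ramp (1/2 * a' + (1 - 1/2) * z - e')"
      unfolding o_def using a' e' s' b'
      by (intro tendsto_intros isCont_tendsto_compose[OF ramp_isCont]) (simp_all add: o_def)
    moreover have "((\<lambda>r. s r * ramp (a r) + (1 - s r) * ramp (b r) - ramp (s r * a r + (1 - s r) * b r - e r)) \<circ> ?h) \<longlonglongrightarrow> 0"
      by (rule LIMSEQ_subseq_LIMSEQ[OF gap h])
    ultimately have "1/2 * ramp a' + (1 - 1/2) * ramp z - ramp (1/2 * a' + (1 - 1/2) * z - e') = 0"
      using LIMSEQ_unique by blast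
    then have "ramp a' + ramp z = 2 * ramp ((a' + z) / 2 - e')" by (simp add: field_simps)
    moreover have "e' \<ge> 0" using bdf(2) by (intro LIMSEQ_le_const[OF e']) auto
    ultimately have "a' = z" "e' = 0" using ramp_midpoint_eqD b(2) by blast+
    then have "((\<lambda>r. (a (f r), e (f r))) \<circ> g) \<longlonglongrightarrow> (z, 0)" using g(2) l by simp
    then have "\<forall>\<^sub>F r in sequentially. dist (((\<lambda>r. (a (f r), e (f r))) \<circ> g) r) (z, 0) < d"
      using d(1) by (rule tendstoD)
    then show False using f(2) by (auto simp: eventually_sequentially)
  qed
  from tendsto_fst[OF this] tendsto_snd[OF this] show "a \<longlonglongrightarrow> z" "e \<longlonglongrightarrow> 0" by simp_all
qed

section \<open>Smooth Minkowski functionals\<close>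

lemma is_normD:
  assumes "is_norm p"
  shows "0 \<le> p x" "p x = 0 \<longleftrightarrow> x = 0" "p (c *\<^sub>R x) = \<bar>c\<bar> * p x" "p (x + y) \<le> p x + p y"
  using assms by (auto simp: is_norm_def)

lemma is_norm_minus: "is_norm p \<Longrightarrow> p (- x) = p x"
  using is_normD(3)[of p "-1" x] by simp

lemma is_norm_abs_diff: "is_norm p \<Longrightarrow> \<bar>p x - p y\<bar> \<le> p (x - y)"
  using is_normD(4)[of p "x - y" y] is_normD(4)[of p "y - x" x] is_norm_minus[of p "x - y"]
  by simp

text \<open>
  The radius \<open>1/4\<close> of the inscribed ball is the same for all bodies below. Hence their Minkowski
  functionals have the common Lipschitz constant \<open>4\<close>, and no normalisation is needed when
  infinitely many of them are added.
\<close>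

locale unit_body =
  fixes B :: "'v::real_normed_vector set" and M :: real
  assumes closed_B: "closed B" and convex_B: "convex B"
    and symmetric_B: "x \<in> B \<Longrightarrow> - x \<in> B"
    and small_in_B: "norm x \<le> 1/4 \<Longrightarrow> x \<in> B"
    and bounded_B: "x \<in> B \<Longrightarrow> norm x \<le> M"
begin

definition mink :: "'v \<Rightarrow> real" where
  "mink x = Inf {\<rho>. 0 < \<rho> \<and> inverse \<rho> *\<^sub>R x \<in> B}"

lemma zero_in_B: "0 \<in> B"
  by (rule small_in_B) simp

lemma scale_in_B:
  assumes "x \<in> B" "0 \<le> c" "c \<le> 1"
  shows "c *\<^sub>R x \<in> B"
  using convexD[OF convex_B assms(1) zero_in_B, of c "1 - c"] assms by simp

lemma mink_le: "0 < \<rho> \<Longrightarrow> inverse \<rho> *\<^sub>R x \<in> B \<Longrightarrow> mink x \<le> \<rho>"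
  unfolding mink_def by (rule cInf_lower) (auto intro!: bdd_belowI[of _ 0])

lemma mink_bound: "mink x \<le> 4 * norm x"
proof (cases "x = 0")
  case True
  have "mink x \<le> 0 + e" if "e > 0" for e using mink_le[of e x] that zero_in_B True by simp
  then show ?thesis using True field_le_epsilon[of "mink x" 0] by simp
next
  case False
  show ?thesis
  proof (rule mink_le)
    show "0 < 4 * norm x" using False by simp
    show "inverse (4 * norm x) *\<^sub>R x \<in> B"
      by (rule small_in_B) (simp add: False)
  qed
qed

lemma mink_set_nonempty: "\<exists>\<rho>. 0 < \<rho> \<and> inverse \<rho> *\<^sub>R x \<in> B"
proof (cases "x = 0")
  case True
  then show ?thesis using zero_in_B by (intro exI[of _ 1]) simp
next
  case False
  then show ?thesis
    by (intro exI[of _ "4 * norm x"] conjI small_in_B) simp_all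
qed

lemma mink_nonneg: "0 \<le> mink x"
  unfolding mink_def using mink_set_nonempty[of x] by (intro cInf_greatest) auto

lemma mink_less_imp_in_B:
  assumes "mink x < \<rho>"
  shows "inverse \<rho> *\<^sub>R x \<in> B"
proof -
  obtain \<sigma> where \<sigma>: "0 < \<sigma>" "inverse \<sigma> *\<^sub>R x \<in> B" "\<sigma> < \<rho>"
    using cInf_lessD[OF _ assms[unfolded mink_def]] mink_set_nonempty[of x] by auto
  have "(\<sigma> / \<rho>) *\<^sub>R (inverse \<sigma> *\<^sub>R x) \<in> B" 
    by (rule scale_in_B[OF \<sigma>(2)]) (use \<sigma> in auto)
  moreover have "\<sigma> / \<rho> * inverse \<sigma> = inverse \<rho>" using \<sigma> by (simp add: field_simps)
  ultimately show ?thesis by (simp only: scaleR_scaleR)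
qed

lemma mink_le_iff:
  assumes "0 < \<rho>"
  shows "mink x \<le> \<rho> \<longleftrightarrow> inverse \<rho> *\<^sub>R x \<in> B"
proof
  assume le: "mink x \<le> \<rho>"
  have "(\<lambda>n. inverse (\<rho> + 1 / real (Suc n)) *\<^sub>R x) \<longlonglongrightarrow> inverse (\<rho> + 0) *\<^sub>R x"
    using assms by (intro tendsto_intros LIMSEQ_Suc[OF lim_1_over_n]) auto
  moreover have "inverse (\<rho> + 1 / real (Suc n)) *\<^sub>R x \<in> B" for n
    by (rule mink_less_imp_in_B) (use le in \<open>simp add: add_strict_increasing2 le_less_trans[OF le]\<close>)
  ultimately show "inverse \<rho> *\<^sub>R x \<in> B"
    using closed_sequentially[OF closed_B] by fastforce
qed (rule mink_le[OF assms])

lemma norm_le_mink: "norm x \<le> M * mink x"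
proof -
  have "norm x \<le> M * \<rho>" if "\<rho> > mink x" for \<rho>
  proof -
    have "\<rho> > 0" using that mink_nonneg[of x] by linarith
    then show ?thesis using bounded_B[OF mink_less_imp_in_B[OF that]] by (simp add: field_simps)
  qed
  then have "norm x \<le> M * (mink x + 1 / real (Suc n))" for n by simp
  moreover have "(\<lambda>n. M * (mink x + 1 / real (Suc n))) \<longlonglongrightarrow> M * (mink x + 0)"
    by (intro tendsto_intros LIMSEQ_Suc[OF lim_1_over_n])
  ultimately show ?thesis using LIMSEQ_le_const[of _ "M * (mink x + 0)" "norm x"] by auto
qed

lemma mink_pos: "x \<noteq> 0 \<Longrightarrow> 0 < mink x"
  using norm_le_mink[of x] mink_nonneg[of x] by (cases "mink x = 0") auto

lemma mink_zero: "mink 0 = 0"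
  using mink_bound[of 0] mink_nonneg[of 0] by simp

lemma mink_minus: "mink (- x) = mink x"
proof -
  have "inverse \<rho> *\<^sub>R (- x) \<in> B \<longleftrightarrow> inverse \<rho> *\<^sub>R x \<in> B" for \<rho>
    using symmetric_B[of "inverse \<rho> *\<^sub>R x"] symmetric_B[of "inverse \<rho> *\<^sub>R (- x)"] by auto
  then show ?thesis by (simp add: mink_def)
qed

lemma mink_scale_le:
  assumes "c > 0"
  shows "mink (c *\<^sub>R x) \<le> c * mink x"
proof (cases "x = 0")
  case False
  then have "inverse (mink x) *\<^sub>R x \<in> B" using mink_le_iff[OF mink_pos] by blast
  then show ?thesis using assms mink_pos[OF False] by (intro mink_le) (auto simp: field_simps)
qed (simp add: mink_zero)

lemma mink_scale: "mink (c *\<^sub>R x) = \<bar>c\<bar> * mink x"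
proof -
  have pos: "mink (c *\<^sub>R x) = c * mink x" if "c > 0" for c
  proof (rule antisym[OF mink_scale_le[OF that]])
    have "mink x \<le> inverse c * mink (c *\<^sub>R x)"
      using mink_scale_le[of "inverse c" "c *\<^sub>R x"] that by simp
    then show "c * mink x \<le> mink (c *\<^sub>R x)" using that by (simp add: field_simps)
  qed
  show ?thesis
  proof (cases c "0 :: real" rule: linorder_cases)
    case less
    then show ?thesis using pos[of "- c"] mink_minus[of "c *\<^sub>R x"] by simp
  next
    case greater
    then show ?thesis using pos[of c] by simp
  qed (simp add: mink_zero)
qed

lemma mink_triangle: "mink (x + y) \<le> mink x + mink y"
proof (cases "x = 0 \<or> y = 0")
  case False
  let ?a = "mink x" and ?b = "mink y"
  have pos: "?a > 0" "?b > 0" using False mink_pos by auto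
  have "inverse ?a *\<^sub>R x \<in> B" "inverse ?b *\<^sub>R y \<in> B"
    using mink_le_iff pos by blast+
  then have "(?a / (?a + ?b)) *\<^sub>R (inverse ?a *\<^sub>R x) + (?b / (?a + ?b)) *\<^sub>R (inverse ?b *\<^sub>R y) \<in> B"
    using pos by (intro convexD[OF convex_B]) (auto simp: add_divide_distrib[symmetric])
  moreover have "?a / (?a + ?b) * inverse ?a = inverse (?a + ?b)" "?b / (?a + ?b) * inverse ?b = inverse (?a + ?b)"
    using pos by (simp_all add: field_simps)
  ultimately have "inverse (?a + ?b) *\<^sub>R (x + y) \<in> B" by (simp only: scaleR_scaleR scaleR_add_right)
  then show ?thesis using pos by (intro mink_le) auto
qed (auto simp: mink_zero)

lemma is_norm_mink: "is_norm mink"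
  unfolding is_norm_def
proof (intro conjI allI)
  show "mink x = 0 \<longleftrightarrow> x = 0" for x
    using mink_pos[of x] mink_zero by (cases "x = 0") auto
qed (rule mink_nonneg mink_scale mink_triangle)+

lemma mink_lipschitz: "\<bar>mink y - mink x\<bar> \<le> 4 * norm (y - x)"
  using is_norm_abs_diff[OF is_norm_mink, of y x] mink_bound[of "y - x"] by linarith

lemma mink_tendsto: "(f \<longlongrightarrow> x) F \<Longrightarrow> ((\<lambda>r. mink (f r)) \<longlongrightarrow> mink x) F"
proof -
  assume "(f \<longlongrightarrow> x) F"
  then have "((\<lambda>r. norm (f r - x)) \<longlongrightarrow> 0) F" by (intro tendsto_norm_zero LIM_zero)
  then have 1: "((\<lambda>r. 4 * norm (f r - x)) \<longlongrightarrow> 0) F" by (rule tendsto_mult_right_zero)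
  have "((\<lambda>r. mink (f r) - mink x) \<longlongrightarrow> 0) F"
    by (rule Lim_null_comparison[OF always_eventually 1]) (simp add: mink_lipschitz)
  then show ?thesis by (rule LIM_zero_cancel)
qed

lemma mink_unit_in_B: "x \<noteq> 0 \<Longrightarrow> inverse (mink x) *\<^sub>R x \<in> B"
  using mink_le_iff[OF mink_pos] by blast

lemma mink_unit: "x \<noteq> 0 \<Longrightarrow> mink (inverse (mink x) *\<^sub>R x) = 1"
  using mink_pos[of x] by (simp add: mink_scale)

lemma mink_le_1_iff: "mink x \<le> 1 \<longleftrightarrow> x \<in> B"
  using mink_le_iff[of 1 x] by simp

end

text \<open>
  The sum over all of \<open>I\<close> may diverge away from the body; requiring the bound for finite partial
  sums only gives the body \<open>(\<Sum>i\<in>I. \<Theta> i x) \<le> 1\<close> without speaking about infinite sums.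
\<close>

definition sum_body :: "('i \<Rightarrow> 'v \<Rightarrow> real) \<Rightarrow> 'i set \<Rightarrow> 'v set \<Rightarrow> 'v set" where
  "sum_body \<Theta> I D = {x \<in> D. \<forall>F. finite F \<longrightarrow> F \<subseteq> I \<longrightarrow> (\<Sum>i\<in>F. \<Theta> i x) \<le> 1}"

locale smooth_body =
  fixes \<Theta> :: "'i \<Rightarrow> 'v::real_normed_vector \<Rightarrow> real" and I :: "'i set" and D :: "'v set" and M :: real
  assumes open_D: "open D" and convex_D: "convex D" and symmetric_D: "x \<in> D \<Longrightarrow> - x \<in> D"
    and even: "x \<in> D \<Longrightarrow> i \<in> I \<Longrightarrow> \<Theta> i (- x) = \<Theta> i x"
    and convex: "i \<in> I \<Longrightarrow> convex_on D (\<Theta> i)"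
    and nonneg: "x \<in> D \<Longrightarrow> i \<in> I \<Longrightarrow> 0 \<le> \<Theta> i x"
    and smooth: "x \<in> D \<Longrightarrow> i \<in> I \<Longrightarrow> smooth_at (\<Theta> i) x"
    and small: "norm x \<le> 1/4 \<Longrightarrow> x \<in> D" "norm x \<le> 1/4 \<Longrightarrow> i \<in> I \<Longrightarrow> \<Theta> i x = 0"
    and closed_body: "closed (sum_body \<Theta> I D)"
    and bounded_body: "x \<in> sum_body \<Theta> I D \<Longrightarrow> norm x \<le> M"
    and locally_finite: "x \<in> sum_body \<Theta> I D \<Longrightarrow>
      \<exists>W F. open W \<and> x \<in> W \<and> W \<subseteq> D \<and> finite F \<and> F \<subseteq> I \<and> (\<forall>y\<in>W. \<forall>i\<in>I - F. \<Theta> i y = 0)"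
begin

abbreviation body :: "'v set" where "body \<equiv> sum_body \<Theta> I D"

lemma body_in_D: "x \<in> body \<Longrightarrow> x \<in> D"
  by (simp add: sum_body_def)

lemma convex_on_partial_sum:
  assumes "finite F" "F \<subseteq> I"
  shows "convex_on D (\<lambda>x. \<Sum>i\<in>F. \<Theta> i x)"
  using assms
proof (induction F rule: finite_induct)
  case empty
  then show ?case by (simp add: convex_on_const convex_D)
next
  case (insert i F)
  then show ?case using convex_on_add[of D "\<Theta> i" "\<lambda>x. \<Sum>i\<in>F. \<Theta> i x"] convex by simp
qed

sublocale unit_body body M
proof
  show "convex body"
    unfolding convex_alt
  proof (intro ballI allI impI)
    fix x y and t :: real assume xy: "x \<in> body" "y \<in> body" and t: "0 \<le> t \<and> t \<le> 1"
    have "(\<Sum>i\<in>F. \<Theta> i ((1 - t) *\<^sub>R x + t *\<^sub>R y)) \<le> 1" if F: "finite F" "F \<subseteq> I" for F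
    proof -
      have "(\<Sum>i\<in>F. \<Theta> i ((1 - t) *\<^sub>R x + t *\<^sub>R y)) \<le> (1 - t) * (\<Sum>i\<in>F. \<Theta> i x) + t * (\<Sum>i\<in>F. \<Theta> i y)"
        using convex_onD[OF convex_on_partial_sum[OF F], of t x y] t xy body_in_D by auto
      also have "\<dots> \<le> (1 - t) * 1 + t * 1"
        using xy t F by (intro add_mono mult_left_mono) (auto simp: sum_body_def)
      finally show ?thesis by simp
    qed
    moreover have "(1 - t) *\<^sub>R x + t *\<^sub>R y \<in> D"
      using convex_D xy t body_in_D unfolding convex_alt by blast
    ultimately show "(1 - t) *\<^sub>R x + t *\<^sub>R y \<in> body" by (simp add: sum_body_def)
  qed
  show "- x \<in> body" if "x \<in> body" for x
    using that symmetric_D even unfolding sum_body_def by (auto simp: subset_iff)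
  show "x \<in> body" if "norm x \<le> 1/4" for x
    using small[OF that] by (auto simp: sum_body_def subset_iff)
qed (use closed_body bounded_body in auto)

lemma partial_sum_le:
  assumes "y \<in> W" "W \<subseteq> D" "finite F" "F \<subseteq> I" "\<forall>y\<in>W. \<forall>i\<in>I - F. \<Theta> i y = 0" "finite G" "G \<subseteq> I"
  shows "(\<Sum>i\<in>G. \<Theta> i y) \<le> (\<Sum>i\<in>F. \<Theta> i y)"
proof -
  have "(\<Sum>i\<in>G. \<Theta> i y) = (\<Sum>i\<in>G \<inter> F. \<Theta> i y)"
  proof (rule sum.mono_neutral_right)
    show "\<forall>i\<in>G - G \<inter> F. \<Theta> i y = 0" using assms by blast
  qed (use assms in auto)
  also have "\<dots> \<le> (\<Sum>i\<in>F. \<Theta> i y)"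
    using assms by (intro sum_mono2 nonneg) auto
  finally show ?thesis .
qed

lemma isCont_partial_sum:
  assumes "F \<subseteq> I" "x \<in> D"
  shows "isCont (\<lambda>x. \<Sum>i\<in>F. \<Theta> i x) x"
  using assms smooth by (intro continuous_intros smooth_at_imp_isCont) auto

text \<open>
  If the sum were smaller than \<open>1\<close>, then by continuity one could move outwards along the ray and
  stay in the body.
\<close>

lemma unit_sphere_sum:
  assumes y: "mink y = 1" "y \<in> W" and W: "open W" "W \<subseteq> D"
    and F: "finite F" "F \<subseteq> I" "\<forall>y\<in>W. \<forall>i\<in>I - F. \<Theta> i y = 0"
  shows "(\<Sum>i\<in>F. \<Theta> i y) = 1"
proof (rule ccontr)
  assume "(\<Sum>i\<in>F. \<Theta> i y) \<noteq> 1"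
  moreover have "y \<in> body" using y mink_le_1_iff[of y] by simp
  ultimately have less: "(\<Sum>i\<in>F. \<Theta> i y) < 1" using F by (auto simp: sum_body_def less_le)
  have "((\<lambda>t. t *\<^sub>R y) \<longlongrightarrow> 1 *\<^sub>R y) (at_right 1)" by (intro tendsto_intros)
  then have lim: "((\<lambda>t. t *\<^sub>R y) \<longlongrightarrow> y) (at_right 1)" by simp
  have "\<forall>\<^sub>F t in at_right 1. t *\<^sub>R y \<in> W"
    using topological_tendstoD[OF lim W(1) y(2)] .
  moreover have "\<forall>\<^sub>F t in at_right 1. (\<Sum>i\<in>F. \<Theta> i (t *\<^sub>R y)) < 1"
    using isCont_tendsto_compose[OF isCont_partial_sum lim] y(2) W(2) F(2) less
    by (intro order_tendstoD) auto
  moreover have "\<forall>\<^sub>F t in at_right 1. (1::real) < t" by (simp add: eventually_at_right_less)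
  ultimately have "\<forall>\<^sub>F t in at_right (1::real). t *\<^sub>R y \<in> W \<and> (\<Sum>i\<in>F. \<Theta> i (t *\<^sub>R y)) < 1 \<and> 1 < t"
    by eventually_elim auto
  then obtain t where t: "t *\<^sub>R y \<in> W" "(\<Sum>i\<in>F. \<Theta> i (t *\<^sub>R y)) < 1" "1 < t"
    using eventually_happens'[OF trivial_limit_at_right_real] by blast
  have "(\<Sum>i\<in>G. \<Theta> i (t *\<^sub>R y)) \<le> 1" if "finite G" "G \<subseteq> I" for G
    using partial_sum_le[OF t(1) W(2) F that] t(2) by linarith
  then have "t *\<^sub>R y \<in> body" using t(1) W(2) by (auto simp: sum_body_def)
  then have "mink (t *\<^sub>R y) \<le> 1" by (simp add: mink_le_1_iff)
  then show False using t(3) y by (simp add: mink_scale)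
qed

text \<open>
  By convexity and \<open>\<Phi> 0 = 0\<close> the sum \<open>\<Phi>\<close> grows at least linearly along the ray through \<open>v\<close>.
\<close>

lemma radial_derivative_nonzero:
  assumes F: "finite F" "F \<subseteq> I" and v: "v \<in> D" "(\<Sum>i\<in>F. \<Theta> i v) = 1"
    and D': "((\<lambda>x. \<Sum>i\<in>F. \<Theta> i x) has_derivative D') (at v)"
  shows "D' v \<noteq> 0"
proof
  assume 0: "D' v = 0"
  interpret D': bounded_linear D' by (rule has_derivative_bounded_linear[OF D'])
  let ?\<Phi> = "\<lambda>x. \<Sum>i\<in>F. \<Theta> i x"
  define e where "e = 1 / (2 * norm v + 1)"
  have e: "e > 0" by (simp add: e_def add_nonneg_pos)
  then obtain d where d: "d > 0" "\<And>y. norm (y - v) < d \<Longrightarrow> norm (?\<Phi> y - ?\<Phi> v - D' (y - v)) \<le> e * norm (y - v)"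
    using D' unfolding has_derivative_at_alt by blast
  define t where "t = min 1 (d / (2 * norm v + 1))"
  have t: "0 < t" "t \<le> 1" using d by (auto simp: t_def add_nonneg_pos)
  have "t * norm v \<le> d / (2 * norm v + 1) * norm v" by (intro mult_right_mono) (auto simp: t_def)
  also have "\<dots> = d * (norm v / (2 * norm v + 1))" by simp
  also have "\<dots> < d * 1" using d by (intro mult_strict_left_mono) (auto simp: divide_less_eq add_nonneg_pos)
  also have "\<dots> = d" by simp
  finally have "t * norm v < d" .
  then have "norm (?\<Phi> ((1 - t) *\<^sub>R v) - ?\<Phi> v - D' ((1 - t) *\<^sub>R v - v)) \<le> e * norm ((1 - t) *\<^sub>R v - v)"
    using t by (intro d(2)) (simp add: algebra_simps)
  moreover have "(1 - t) *\<^sub>R v - v = (- t) *\<^sub>R v" by (simp add: algebra_simps)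
  ultimately have "\<bar>?\<Phi> ((1 - t) *\<^sub>R v) - 1\<bar> \<le> e * (t * norm v)"
    using 0 t v(2) by (simp only: D'.scaleR) simp
  moreover have "?\<Phi> ((1 - t) *\<^sub>R v + t *\<^sub>R 0) \<le> (1 - t) * ?\<Phi> v + t * ?\<Phi> 0"
    using t v(1) small(1)[of 0] by (intro convex_onD[OF convex_on_partial_sum[OF F]]) auto
  moreover have "?\<Phi> 0 = 0" using F small(2)[of 0] by (intro sum.neutral) auto
  ultimately have "t \<le> e * (t * norm v)" using v(2) by simp
  then have "1 \<le> e * norm v" using t by (simp add: mult.left_commute[of e t])
  moreover have "e * norm v < 1" by (simp add: e_def divide_less_eq add_nonneg_pos)
  ultimately show False by simp
qed

theorem smooth_at_mink:
  assumes "x \<noteq> 0"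
  shows "smooth_at mink x"
proof -
  let ?u = "\<lambda>x. inverse (mink x) *\<^sub>R x"
  obtain W F where W: "open W" "?u x \<in> W" "W \<subseteq> D"
    and F: "finite F" "F \<subseteq> I" "\<forall>y\<in>W. \<forall>i\<in>I - F. \<Theta> i y = 0"
    using locally_finite[OF mink_unit_in_B[OF assms]] by blast
  let ?\<Phi> = "\<lambda>x. \<Sum>i\<in>F. \<Theta> i x"
  have "smooth_at ?\<Phi> (?u x)" by (intro smooth_at_sum smooth) (use F W in auto)
  then obtain V where V: "open V" "?u x \<in> V" "\<And>k. fsmooth k V ?\<Phi>" unfolding smooth_at_def by blast
  let ?U = "- {0} \<inter> ?u -` (V \<inter> W)"
  have cont: "continuous_on (- {0}) mink"
    by (auto simp: continuous_on_def intro!: mink_tendsto tendsto_intros)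
  have oU: "open ?U"
  proof (rule continuous_open_preimage)
    show "continuous_on (- {0}) ?u"
      using cont mink_pos by (intro continuous_intros) fastforce+
  qed (use V W in auto)
  have "fsmooth k ?U mink" for k
  proof (rule fsmooth_implicit_norm[OF oU _ _ V(3)])
    show "\<bar>mink y - mink x\<bar> \<le> 4 * norm (y - x)" for x y by (rule mink_lipschitz)
    fix y assume y: "y \<in> ?U"
    then show "0 < mink y" "?u y \<in> V" using mink_pos by auto
    show 1: "?\<Phi> (?u y) = 1" using y W F mink_unit by (intro unit_sphere_sum) auto
    fix D' assume "(?\<Phi> has_derivative D') (at (?u y))"
    then show "D' (?u y) \<noteq> 0" using 1 y W F by (intro radial_derivative_nonzero) auto
  qed
  then show ?thesis using oU assms V(2) W(2) by (intro smooth_atI[of ?U]) auto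
qed

text \<open>
  The reason why Minkowski functionals of such bodies see each summand separately. Let \<open>l\<close> be
  the factor that moves the midpoint of \<open>y\<close> and \<open>u\<close> back to the unit sphere; it tends to \<open>1\<close>.
  The point obtained is a convex combination of \<open>y\<close> and of the point \<open>w\<close>, which is a multiple of
  \<open>u\<close> close to \<open>u\<close>. The whole rescaling is put on \<open>u\<close> because near \<open>u\<close> the sum is continuous,
  whereas nothing is known near \<open>y\<close>. The sum over all indices is \<open>1\<close> at this point and at most
  about \<open>1\<close> at \<open>y\<close> and \<open>w\<close>, so the convexity gaps of all summands add up to a null sequence.
\<close>

theorem rotundity_gap:
  fixes y :: "nat \<Rightarrow> 'v"
  assumes u: "mink u = 1" and y: "\<And>r. mink (y r) = 1" and lim: "(\<lambda>r. mink (y r + u)) \<longlonglongrightarrow> 2"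
  obtains s w where "s \<longlonglongrightarrow> 1/2" "w \<longlonglongrightarrow> u"
    "\<And>i. i \<in> I \<Longrightarrow> (\<lambda>r. s r * \<Theta> i (y r) + (1 - s r) * \<Theta> i (w r) - \<Theta> i (s r *\<^sub>R y r + (1 - s r) *\<^sub>R w r)) \<longlonglongrightarrow> 0"
proof -
  define l where "l r = 2 / mink (y r + u)" for r
  define s where "s r = l r / 2" for r
  define w where "w r = (l r / (2 - l r)) *\<^sub>R u" for r
  have "l \<longlonglongrightarrow> 2 / 2" unfolding l_def by (intro tendsto_intros lim) auto
  then have l: "l \<longlonglongrightarrow> 1" by simp
  have "s \<longlonglongrightarrow> 1/2" unfolding s_def by (intro tendsto_intros l) auto
  moreover have "w \<longlonglongrightarrow> (1 / (2 - 1)) *\<^sub>R u" unfolding w_def by (intro tendsto_intros l) auto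
  then have w: "w \<longlonglongrightarrow> u" by simp
  moreover have "(\<lambda>r. s r * \<Theta> i (y r) + (1 - s r) * \<Theta> i (w r) - \<Theta> i (s r *\<^sub>R y r + (1 - s r) *\<^sub>R w r)) \<longlonglongrightarrow> 0"
    (is "?gap \<longlonglongrightarrow> 0") if i: "i \<in> I" for i
  proof -
    have uB: "u \<in> body" using u mink_le_1_iff[of u] by simp
    obtain W F where W: "open W" "u \<in> W" "W \<subseteq> D"
      and F: "finite F" "F \<subseteq> I" "\<forall>y\<in>W. \<forall>i\<in>I - F. \<Theta> i y = 0"
      using locally_finite[OF uB] by blast
    let ?\<Phi> = "\<lambda>x. \<Sum>i\<in>F. \<Theta> i x"
    have "?\<Phi> u = 1" using u W F by (intro unit_sphere_sum) auto
    moreover have "(\<lambda>r. ?\<Phi> (w r)) \<longlonglongrightarrow> ?\<Phi> u"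
      using isCont_tendsto_compose[OF isCont_partial_sum w] F(2) W by auto
    ultimately have \<Phi>: "(\<lambda>r. ?\<Phi> (w r)) \<longlonglongrightarrow> 1" by simp
    have "(\<lambda>r. s r + (1 - s r) * ?\<Phi> (w r) - 1) \<longlonglongrightarrow> 1/2 + (1 - 1/2) * 1 - 1"
      by (intro tendsto_intros \<Phi>) fact+
    then have bound: "(\<lambda>r. s r + (1 - s r) * ?\<Phi> (w r) - 1) \<longlonglongrightarrow> 0" by simp
    have ev: "\<forall>\<^sub>F r in sequentially. 0 \<le> ?gap r \<and> ?gap r \<le> s r + (1 - s r) * ?\<Phi> (w r) - 1"
      using topological_tendstoD[OF w W(1,2)] order_tendstoD(1)[OF lim, of 1, simplified]
    proof eventually_elim
      case (elim r)
      have "mink (y r + u) \<le> 2" using mink_triangle[of "y r" u] y u by simp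
      then have l12: "1 \<le> l r" "l r < 2" using elim(2) by (auto simp: l_def field_simps)
      have s01: "0 \<le> s r" "s r \<le> 1" using l12 by (auto simp: s_def)
      let ?m = "s r *\<^sub>R y r + (1 - s r) *\<^sub>R w r"
      have "(1 - s r) * (l r / (2 - l r)) = l r / 2" using l12 by (simp add: s_def field_simps)
      then have "?m = (l r / 2) *\<^sub>R (y r + u)" by (simp add: w_def scaleR_add_right s_def)
      then have m1: "mink ?m = 1" using elim(2) by (simp add: mink_scale l_def)
      have wD: "w r \<in> D" and yB: "y r \<in> body" using elim(1) W(3) y mink_le_1_iff[of "y r"] by auto
      have yD: "y r \<in> D" by (rule body_in_D[OF yB])
      have mB: "?m \<in> body" using m1 mink_le_1_iff[of ?m] by simp
      have cv: "\<Theta> j ?m \<le> s r * \<Theta> j (y r) + (1 - s r) * \<Theta> j (w r)" if "j \<in> I" for j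
        using convex_onD[OF convex[OF that], of "1 - s r" "y r" "w r"] s01 wD yD by simp
      obtain W' G where G: "open W'" "?m \<in> W'" "W' \<subseteq> D" "finite G" "G \<subseteq> I" "\<forall>y\<in>W'. \<forall>i\<in>I - G. \<Theta> i y = 0"
        using locally_finite[OF mB] by blast
      let ?H = "insert i (F \<union> G)"
      have H: "finite ?H" "?H \<subseteq> I" using F G i by auto
      have "1 = (\<Sum>j\<in>G. \<Theta> j ?m)" using m1 G by (intro unit_sphere_sum[symmetric]) auto
      also have "\<dots> \<le> (\<Sum>j\<in>?H. \<Theta> j ?m)"
        using H nonneg body_in_D[OF mB] by (intro sum_mono2) auto
      also have "\<dots> = \<Theta> i ?m + (\<Sum>j\<in>?H - {i}. \<Theta> j ?m)" using H by (intro sum.remove) auto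
      also have "\<dots> \<le> \<Theta> i ?m + (\<Sum>j\<in>?H - {i}. s r * \<Theta> j (y r) + (1 - s r) * \<Theta> j (w r))"
        using H cv by (intro add_left_mono sum_mono) auto
      also have "\<dots> = (\<Sum>j\<in>?H. s r * \<Theta> j (y r) + (1 - s r) * \<Theta> j (w r)) - ?gap r"
        using H(1) by (subst (2) sum.remove[of _ i]) auto
      also have "(\<Sum>j\<in>?H. s r * \<Theta> j (y r) + (1 - s r) * \<Theta> j (w r)) =
          s r * (\<Sum>j\<in>?H. \<Theta> j (y r)) + (1 - s r) * (\<Sum>j\<in>?H. \<Theta> j (w r))"
        by (simp only: sum.distrib sum_distrib_left)
      also have "\<dots> \<le> s r * 1 + (1 - s r) * ?\<Phi> (w r)"
        using H yB s01 partial_sum_le[OF elim(1) W(3) F H]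
        by (intro add_mono mult_left_mono) (auto simp: sum_body_def)
      finally show ?case using cv[OF i] by simp
    qed
    show ?thesis
      by (rule tendsto_sandwich[OF _ _ tendsto_const bound]) (use ev in \<open>auto elim: eventually_mono\<close>)
  qed
  ultimately show ?thesis by (rule that)
qed

end

section \<open>Jumps of continuous functions on an ordinal interval\<close>

lemma ordinal_nearby_below:
  fixes f :: "'a::{wellorder, order_top, linorder_topology} \<Rightarrow>\<^sub>C real"
  assumes "y < t" "e > 0"
  obtains b where "b < t" "\<And>s. b < s \<Longrightarrow> s \<le> t \<Longrightarrow> \<bar>f s - f t\<bar> < e"
proof -
  have "open (f -` ball (f t) e)"
    by (rule open_vimage) auto
  moreover have "t \<in> f -` ball (f t) e" using assms by simp
  ultimately obtain b where b: "b < t" "{b<..t} \<subseteq> f -` ball (f t) e"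
    using open_left assms(1) by metis
  show ?thesis
  proof (rule that[OF b(1)])
    fix s assume "b < s" "s \<le> t"
    then have "s \<in> f -` ball (f t) e" using b(2) by auto
    then show "\<bar>f s - f t\<bar> < e" by (simp add: dist_real_def abs_minus_commute)
  qed
qed

definition nxt :: "'a::wellorder \<Rightarrow> 'a" where
  "nxt t = (LEAST s. t < s)"

lemma less_nxt:
  fixes t :: "'a::{wellorder, order_top}"
  assumes "t \<noteq> top"
  shows "t < nxt t"
  unfolding nxt_def by (rule LeastI[of _ top]) (use assms in \<open>simp add: top.not_eq_extremum\<close>)

lemma nxt_le: "t < s \<Longrightarrow> nxt t \<le> s"
  unfolding nxt_def by (rule Least_le)

lemma less_nxt_iff: "t \<noteq> top \<Longrightarrow> s < nxt t \<longleftrightarrow> s \<le> t"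
  for t :: "'a::{wellorder, order_top}"
  using less_nxt[of t] nxt_le[of t s] by force

text \<open>
  The function is thought of as continued by \<open>0\<close> beyond the last point. The jump there is
  therefore its last value, and every nonzero function has a nonzero jump.
\<close>

definition jump :: "('a::{wellorder, order_top, linorder_topology} \<Rightarrow>\<^sub>C real) \<Rightarrow> 'a \<Rightarrow> real" where
  "jump f t = f t - (if t = top then 0 else f (nxt t))"

lemma bounded_linear_eval: "bounded_linear (\<lambda>f :: 'a::topological_space \<Rightarrow>\<^sub>C real. f t)"
proof (rule bounded_linear_intro[where K = 1])
  show "norm (apply_bcontfun f t) \<le> norm f * 1" for f :: "'a \<Rightarrow>\<^sub>C real"
    using norm_bounded[of f t] by simp
qed simp_all

lemma bounded_linear_jump: "bounded_linear (\<lambda>f. jump f t)"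
proof (cases "t = top")
  case False
  then show ?thesis
    using bounded_linear_sub[OF bounded_linear_eval bounded_linear_eval, of t "nxt t"] by (simp add: jump_def)
qed (simp add: jump_def bounded_linear_eval)

lemma jump_diff: "jump (f - g) t = jump f t - jump g t"
  and jump_scaleR: "jump (c *\<^sub>R f) t = c * jump f t"
  by (auto simp: jump_def algebra_simps)

lemma abs_eval_le: "\<bar>apply_bcontfun f t\<bar> \<le> norm f" for f :: "'a::topological_space \<Rightarrow>\<^sub>C real"
  using norm_bounded[of f t] by simp

lemma abs_jump_le: "\<bar>jump f t\<bar> \<le> 2 * norm f"
  using abs_eval_le[of f t] abs_eval_le[of f "nxt t"] by (auto simp: jump_def)

text \<open>
  Infinitely many large jumps would have an increasing sequence of positions, whose limit is a
  point of discontinuity.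
\<close>

lemma finite_big_jumps:
  fixes f :: "'a::{wellorder, order_top, linorder_topology} \<Rightarrow>\<^sub>C real"
  assumes "e > 0"
  shows "finite {t. \<bar>jump f t\<bar> \<ge> e}"
proof -
  have "finite {t. t < a \<and> \<bar>jump f t\<bar> \<ge> e}" for a
  proof (induction a rule: less_induct)
    case (less a)
    show ?case
    proof (cases "\<exists>y. y < a")
      case True
      then obtain y where "y < a" by blast
      then obtain b where b: "b < a" "\<And>s. b < s \<Longrightarrow> s \<le> a \<Longrightarrow> \<bar>f s - f a\<bar> < e / 2"
        using ordinal_nearby_below[of y a "e / 2" f] assms by auto
      have "\<bar>jump f t\<bar> < e" if t: "b < t" "t < a" for t
      proof -
        have "t \<noteq> top" using t(2) by auto
        moreover have "\<bar>f t - f a\<bar> < e / 2" using b(2) t by auto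
        moreover have "\<bar>f (nxt t) - f a\<bar> < e / 2"
          using less_nxt[OF \<open>t \<noteq> top\<close>] nxt_le[OF t(2)] t by (intro b(2)) auto
        ultimately have "\<bar>f t - f (nxt t)\<bar> < e" by linarith
        then show ?thesis using \<open>t \<noteq> top\<close> by (simp add: jump_def)
      qed
      then have "{t. t < a \<and> \<bar>jump f t\<bar> \<ge> e} \<subseteq> insert b {t. t < b \<and> \<bar>jump f t\<bar> \<ge> e}"
        by (force simp: not_less[symmetric])
      then show ?thesis using less[OF b(1)] finite_subset by blast
    qed auto
  qed
  moreover have "{t. \<bar>jump f t\<bar> \<ge> e} \<subseteq> insert top {t. t < top \<and> \<bar>jump f t\<bar> \<ge> e}"
    by (auto simp: top.not_eq_extremum[symmetric])
  ultimately show ?thesis using finite_subset by blast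
qed

text \<open>
  Take the last point at which the norm is attained: at the next point, if there is one, the
  absolute value is smaller.
\<close>

lemma norm_attained_with_jump:
  fixes f :: "'a::{wellorder, order_top, linorder_topology} \<Rightarrow>\<^sub>C real"
  assumes "f \<noteq> 0"
  obtains t where "\<bar>f t\<bar> = norm f" "jump f t \<noteq> 0"
proof -
  have "{..top} = (UNIV :: 'a set)" by auto
  then have cU: "compact (UNIV :: 'a set)" using compact_ordinal_atMost[of "top :: 'a"] by simp
  let ?S = "{t. \<bar>f t\<bar> = norm f}"
  have cont: "continuous_on UNIV (\<lambda>t. \<bar>f t\<bar>)" by (intro continuous_intros) auto
  obtain t where t: "\<And>s. \<bar>f s\<bar> \<le> \<bar>f t\<bar>"
    using continuous_attains_sup[OF cU _ cont] by auto
  have "norm f \<le> \<bar>f t\<bar>" using t by (intro norm_bound) auto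
  then have "t \<in> ?S" using abs_eval_le[of f t] by simp
  moreover have "closed ?S" using cont by (intro closed_Collect_eq) auto
  then have "compact ?S" using compact_Int_closed[OF cU] by simp
  ultimately obtain s where s: "s \<in> ?S" "\<And>t. t \<in> ?S \<Longrightarrow> t \<le> s"
    using compact_attains_sup[of ?S] by blast
  have "jump f s \<noteq> 0"
  proof (cases "s = top")
    case True
    then show ?thesis using s(1) assms by (auto simp: jump_def)
  next
    case False
    then have "nxt s \<notin> ?S" using s(2) less_nxt[OF False] by force
    then show ?thesis using s(1) False by (auto simp: jump_def)
  qed
  with s(1) that show ?thesis by auto
qed

lemma constant_without_jumps:
  fixes f :: "'a::{wellorder, order_top, linorder_topology} \<Rightarrow>\<^sub>C real"
  assumes "b \<le> t" "\<And>s. b \<le> s \<Longrightarrow> s < t \<Longrightarrow> jump f s = 0"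
  shows "f t = f b"
  using assms
proof (induction t rule: less_induct)
  case (less t)
  show ?case
  proof (cases "b = t")
    case False
    then have bt: "b < t" using less.prems by simp
    show ?thesis
    proof (rule ccontr)
      assume "f t \<noteq> f b"
      then obtain c where c: "c < t" "\<And>s. c < s \<Longrightarrow> s \<le> t \<Longrightarrow> \<bar>f s - f t\<bar> < \<bar>f t - f b\<bar>"
        using ordinal_nearby_below[OF bt, of "\<bar>f t - f b\<bar>" f] by auto
      let ?m = "max b c"
      have m: "b \<le> ?m" "?m < t" using bt c(1) by auto
      then have mtop: "?m \<noteq> top" using top_greatest[of t] by (metis leD)
      have fm: "f ?m = f b" using less.IH[OF m(2) m(1)] less.prems(2) m(2) by auto
      have "jump f ?m = 0" using less.prems(2) m by auto
      then have "f (nxt ?m) = f b" using fm mtop by (simp add: jump_def)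
      moreover have "\<bar>f (nxt ?m) - f t\<bar> < \<bar>f t - f b\<bar>"
        using less_nxt[OF mtop] nxt_le[OF m(2)] by (intro c(2)) auto
      ultimately show False by (simp add: abs_minus_commute)
    qed
  qed simp
qed

text \<open>
  The oscillation condition is arranged so that the induction does not lose accuracy: at a point
  \<open>a\<close> all values on some \<open>(b, a]\<close> are close to each other, and a jump \<open>c\<close> in \<open>[b, a)\<close>, if there
  is one, is added as a separator between the points up to \<open>c\<close>, which are covered by the
  induction hypothesis, and those above \<open>c\<close>. If there is none, the function is constant on \<open>[b,
  a]\<close>.
\<close>

lemma finitely_many_jumps_control:
  fixes f :: "'a::{wellorder, order_top, linorder_topology} \<Rightarrow>\<^sub>C real"
  assumes "e > 0"
  obtains A where "finite A" "\<And>t. t \<in> A \<Longrightarrow> jump f t \<noteq> 0"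
    "\<And>s t. s \<le> t \<Longrightarrow> (\<And>b. b \<in> A \<Longrightarrow> s \<le> b \<Longrightarrow> \<not> b < t) \<Longrightarrow> \<bar>f s - f t\<bar> \<le> e"
proof -
  have "\<exists>A. finite A \<and> (\<forall>t\<in>A. jump f t \<noteq> 0) \<and>
    (\<forall>s t. s \<le> t \<and> t \<le> a \<and> (\<forall>b\<in>A. s \<le> b \<longrightarrow> \<not> b < t) \<longrightarrow> \<bar>f s - f t\<bar> \<le> e)" for a
  proof (induction a rule: less_induct)
    case (less a)
    show ?case
    proof (cases "\<exists>y. y < a")
      case False
      then have "s = t" if "s \<le> t" "t \<le> a" for s t
        using that by (metis leD le_less order.trans)
      then show ?thesis using assms by (intro exI[of _ "{}"]) force
    next
      case True
      then obtain y where "y < a" by blast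
      then obtain b where b: "b < a" "\<And>s. b < s \<Longrightarrow> s \<le> a \<Longrightarrow> \<bar>f s - f a\<bar> < e / 2"
        using ordinal_nearby_below[of y a "e / 2" f] assms by auto
      have close: "\<bar>f s - f t\<bar> \<le> e" if "b < s" "s \<le> t" "t \<le> a" for s t
      proof -
        have "\<bar>f s - f a\<bar> < e / 2" by (rule b(2)) (use that in auto)
        moreover have "\<bar>f t - f a\<bar> < e / 2" by (rule b(2)) (use that in auto)
        ultimately show ?thesis by linarith
      qed
      show ?thesis
      proof (cases "\<exists>c. b \<le> c \<and> c < a \<and> jump f c \<noteq> 0")
        case True
        then obtain c where c: "b \<le> c" "c < a" "jump f c \<noteq> 0" by blast
        obtain A where A: "finite A" "\<forall>t\<in>A. jump f t \<noteq> 0"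
          "\<forall>s t. s \<le> t \<and> t \<le> c \<and> (\<forall>b\<in>A. s \<le> b \<longrightarrow> \<not> b < t) \<longrightarrow> \<bar>f s - f t\<bar> \<le> e"
          using less[OF c(2)] by (elim exE conjE)
        have "\<bar>f s - f t\<bar> \<le> e" if st: "s \<le> t" "t \<le> a" "\<forall>b\<in>insert c A. s \<le> b \<longrightarrow> \<not> b < t" for s t
        proof (cases "t \<le> c")
          case True
          then show ?thesis using A(3)[rule_format, of s t] st by simp
        next
          case False
          then have "c < s" using st by auto
          then show ?thesis using close c st by auto
        qed
        moreover have "finite (insert c A)" "\<forall>t\<in>insert c A. jump f t \<noteq> 0" using A(1,2) c(3) by auto
        ultimately show ?thesis by blast
      next
        case False
        then have const: "f t = f b" if "b \<le> t" "t \<le> a" for t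
          using that by (intro constant_without_jumps) auto
        obtain A where A: "finite A" "\<forall>t\<in>A. jump f t \<noteq> 0"
          "\<forall>s t. s \<le> t \<and> t \<le> b \<and> (\<forall>b\<in>A. s \<le> b \<longrightarrow> \<not> b < t) \<longrightarrow> \<bar>f s - f t\<bar> \<le> e"
          using less[OF b(1)] by (elim exE conjE)
        have "\<bar>f s - f t\<bar> \<le> e" if st: "s \<le> t" "t \<le> a" "\<forall>b\<in>A. s \<le> b \<longrightarrow> \<not> b < t" for s t
        proof -
          consider "t \<le> b" | "b \<le> s" | "s < b" "b < t" by force
          then show ?thesis
          proof cases
            case 1
            then show ?thesis using A(3)[rule_format, of s t] st by simp
          next
            case 2
            then show ?thesis using const[of s] const[of t] st assms by auto
          next
            case 3
            have "\<bar>f s - f b\<bar> \<le> e" using 3 st by (intro A(3)[rule_format]) force+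
            then show ?thesis using const[of t] 3 st by simp
          qed
        qed
        then show ?thesis using A(1,2) by blast
      qed
    qed
  qed
  from this[of top] that show ?thesis by (metis top_greatest)
qed

text \<open>
  The points of \<open>A\<close> cut the interval into the pieces \<open>(b, c]\<close>, which are open because \<open>(b, c]\<close>
  is also the interval of all points between \<open>b\<close> and the successor of \<open>c\<close>. Sending each piece to
  its right end point is therefore continuous.
\<close>

definition ceil_in :: "'a set \<Rightarrow> 'a \<Rightarrow> 'a::{wellorder, order_top, linorder_topology}" where
  "ceil_in A t = Min {b \<in> insert top A. t \<le> b}"

lemma ceil_in:
  assumes "finite A"
  shows "ceil_in A t \<in> insert top A" "t \<le> ceil_in A t"
    "b \<in> insert top A \<Longrightarrow> t \<le> b \<Longrightarrow> ceil_in A t \<le> b"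
proof -
  have fin: "finite {b \<in> insert top A. t \<le> b}" using assms by simp
  have "ceil_in A t \<in> {b \<in> insert top A. t \<le> b}"
    unfolding ceil_in_def by (rule Min_in[OF fin]) auto
  then show "ceil_in A t \<in> insert top A" "t \<le> ceil_in A t" by auto
  show "ceil_in A t \<le> b" if "b \<in> insert top A" "t \<le> b"
    unfolding ceil_in_def using that by (intro Min_le[OF fin]) auto
qed

lemma ceil_in_locally_constant:
  fixes t :: "'a::{wellorder, order_top, linorder_topology}"
  assumes "finite A"
  shows "\<forall>\<^sub>F s in nhds t. ceil_in A s = ceil_in A t"
proof -
  let ?c = "ceil_in A"
  have "\<forall>\<^sub>F s in nhds t. s \<le> ?c t"
  proof (cases "?c t = top")
    case False
    have "open {..<nxt (?c t)}" by simp
    then have "\<forall>\<^sub>F s in nhds t. s \<in> {..<nxt (?c t)}"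
      by (rule eventually_nhds_in_open) (use False ceil_in(2)[OF assms] in \<open>simp add: less_nxt_iff\<close>)
    then show ?thesis using False by (simp add: less_nxt_iff)
  qed simp
  moreover have "\<forall>\<^sub>F s in nhds t. \<forall>b\<in>{b \<in> A. b < t}. b < s"
  proof (rule eventually_ball_finite)
    show "\<forall>b\<in>{b \<in> A. b < t}. \<forall>\<^sub>F s in nhds t. b < s"
      using eventually_nhds_in_open[of "{_<..}" t] by force
  qed (use assms in simp)
  ultimately show ?thesis
  proof eventually_elim
    case (elim s)
    have "?c s \<le> ?c t" using elim(1) ceil_in[OF assms] by blast
    moreover have "\<not> ?c s < ?c t"
    proof
      assume less: "?c s < ?c t"
      then have "?c s < t" using ceil_in(3)[OF assms, of "?c s" t] ceil_in(1)[OF assms, of s] by force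
      moreover have "?c s \<in> A" using ceil_in(1)[OF assms, of s] less by (metis insertE not_less top_greatest)
      ultimately show False using elim(2) ceil_in(2)[OF assms, of s] by force
    qed
    ultimately show ?case by simp
  qed
qed

definition step :: "'a set \<Rightarrow> ('a::{wellorder, order_top, linorder_topology} \<Rightarrow>\<^sub>C real) \<Rightarrow> ('a \<Rightarrow>\<^sub>C real)" where
  "step A f = Bcontfun (\<lambda>t. f (ceil_in A t))"

lemma apply_step:
  fixes f :: "'a::{wellorder, order_top, linorder_topology} \<Rightarrow>\<^sub>C real"
  assumes "finite A"
  shows "step A f t = f (ceil_in A t)"
proof -
  have "isCont (\<lambda>t. f (ceil_in A t)) t" for t
    unfolding isCont_def
  proof (rule tendsto_eventually)
    have "\<forall>\<^sub>F s in nhds t. f (ceil_in A s) = f (ceil_in A t)"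
      using ceil_in_locally_constant[OF assms, of t] by eventually_elim simp
    then show "\<forall>\<^sub>F s in at t. f (ceil_in A s) = f (ceil_in A t)"
      by (simp add: eventually_nhds_conv_at)
  qed
  then have "continuous_on UNIV (\<lambda>t. f (ceil_in A t))" by (auto intro: continuous_at_imp_continuous_on)
  then have "(\<lambda>t. f (ceil_in A t)) \<in> bcontfun"
    by (rule bcontfun_normI[of _ "norm f"]) (rule norm_bounded)
  then show ?thesis by (simp add: step_def Bcontfun_inverse)
qed

lemma norm_step_le:
  fixes f :: "'a::{wellorder, order_top, linorder_topology} \<Rightarrow>\<^sub>C real"
  assumes "finite A" "\<And>b. b \<in> insert top A \<Longrightarrow> \<bar>f b\<bar> \<le> c"
  shows "norm (step A f) \<le> c"
  using assms ceil_in(1)[OF assms(1)] by (intro norm_bound) (simp add: apply_step)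

lemma bounded_linear_step:
  fixes A :: "'a::{wellorder, order_top, linorder_topology} set"
  assumes "finite A"
  shows "bounded_linear (step A)"
proof (rule bounded_linear_intro[where K = 1])
  show "norm (step A f) \<le> norm f * 1" for f :: "'a \<Rightarrow>\<^sub>C real"
    using norm_step_le[OF assms, of f "norm f"] abs_eval_le[of f] by simp
qed (auto intro!: bcontfun_eqI simp: apply_step[OF assms])

lemma step_approximates:
  fixes f :: "'a::{wellorder, order_top, linorder_topology} \<Rightarrow>\<^sub>C real"
  assumes "e > 0"
  obtains d where "d > 0" "\<And>A. finite A \<Longrightarrow> {t. \<bar>jump f t\<bar> \<ge> d} \<subseteq> A \<Longrightarrow> norm (f - step A f) \<le> e"
proof -
  obtain A0 where A0: "finite A0" "\<And>t. t \<in> A0 \<Longrightarrow> jump f t \<noteq> 0"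
    "\<And>s t. s \<le> t \<Longrightarrow> (\<And>b. b \<in> A0 \<Longrightarrow> s \<le> b \<Longrightarrow> \<not> b < t) \<Longrightarrow> \<bar>f s - f t\<bar> \<le> e"
    using finitely_many_jumps_control[OF assms, of f] by blast
  define d where "d = Min (insert 1 ((\<lambda>t. \<bar>jump f t\<bar>) ` A0))"
  show ?thesis
  proof (rule that[of d])
    show "d > 0" using A0(1,2) by (auto simp: d_def)
    fix A assume A: "finite A" "{t. \<bar>jump f t\<bar> \<ge> d} \<subseteq> A"
    have "d \<le> \<bar>jump f t\<bar>" if "t \<in> A0" for t
      unfolding d_def using A0(1) that by (intro Min_le) auto
    then have sub: "A0 \<subseteq> A" using A(2) by auto
    have "\<bar>f t - f (ceil_in A t)\<bar> \<le> e" for t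
    proof (rule A0(3)[OF ceil_in(2)[OF A(1)]])
      fix b assume "b \<in> A0" "t \<le> b"
      then show "\<not> b < ceil_in A t" using ceil_in(3)[OF A(1), of b t] sub by auto
    qed
    then show "norm (f - step A f) \<le> e" by (intro norm_bound) (simp add: apply_step[OF A(1)])
  qed
qed

section \<open>A smooth norm on the continuous functions\<close>

text \<open>
  Joint convexity of \<open>(b, c) \<mapsto> b\<^sup>2 / c\<close>, combined with its monotonicity in \<open>c\<close>.
\<close>

lemma power2_over_linear_convex:
  fixes b1 b2 c1 c2 t c :: real
  assumes "c1 > 0" "c2 > 0" "0 \<le> t" "t \<le> 1" and c: "(1 - t) * c1 + t * c2 \<le> c"
  shows "((1 - t) * b1 + t * b2)\<^sup>2 / c \<le> (1 - t) * (b1\<^sup>2 / c1) + t * (b2\<^sup>2 / c2)"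
proof -
  define x y p q where "x = b1 / c1" "y = b2 / c2" "p = (1 - t) * c1" "q = t * c2"
  note defs = this
  have pq: "0 \<le> p" "0 \<le> q" using assms(1-4) by (simp_all add: defs)
  moreover have "0 < p \<or> 0 < q" using assms(1-4) by (cases "t = 0") (simp_all add: defs)
  ultimately have pq_pos: "0 < p + q" by linarith
  have "0 \<le> p * q * (x - y)\<^sup>2" using pq by simp
  then have "(p * x + q * y)\<^sup>2 \<le> (p * x\<^sup>2 + q * y\<^sup>2) * (p + q)"
    by (simp add: power2_eq_square algebra_simps)
  also have "\<dots> \<le> (p * x\<^sup>2 + q * y\<^sup>2) * c" using pq c by (intro mult_left_mono) (auto simp: defs)
  finally have "(p * x + q * y)\<^sup>2 / c \<le> p * x\<^sup>2 + q * y\<^sup>2"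
    using pq_pos c by (simp add: defs divide_le_eq)
  moreover have "p * x = (1 - t) * b1" "q * y = t * b2" using assms(1,2) by (simp_all add: defs)
  moreover have "p * x\<^sup>2 = (1 - t) * (b1\<^sup>2 / c1)" "q * y\<^sup>2 = t * (b2\<^sup>2 / c2)"
    using assms(1,2) by (simp_all add: defs power2_eq_square)
  ultimately show ?thesis by simp
qed

lemma power2_le_if_abs_le: "\<bar>x\<bar> \<le> c \<Longrightarrow> x\<^sup>2 \<le> c\<^sup>2" for x c :: real
  by (metis abs_ge_zero power2_abs power_mono)

lemma convex_combination_power2:
  "((1 - t) * a + t * b)\<^sup>2 = (1 - t) * a\<^sup>2 + t * b\<^sup>2 - t * (1 - t) * (a - b)\<^sup>2" for a b t :: real
  by (simp add: power2_eq_square algebra_simps)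

lemma ramp_convex_combination:
  assumes "0 \<le> t" "t \<le> 1" "z \<le> (1 - t) * a + t * b"
  shows "ramp z \<le> (1 - t) * ramp a + t * ramp b"
  using ramp_mono[OF assms(3)] convex_onD[OF ramp_convex assms(1,2), of a b] by simp

lemma jump_minus: "jump (- f) t = - jump f t"
  using jump_scaleR[of "-1" f t] by simp

lemma jump_add: "jump (f + g) t = jump f t + jump g t"
  by (simp add: jump_def)

text \<open>
  The supremum norm may be attained at infinitely many points, so summands that depend on the
  single values \<open>f t\<close> would not be locally finite. Here a
  point \<open>t\<close> counts only if the jump at \<open>t\<close> is large compared with the distance of \<open>f t\<close> from
  \<open>\<plusminus>1\<close>. Inside the open unit ball this singles out finitely many points locally. The quotient
  blows up at the boundary of the ball, so that the last point at which the norm is attained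
  keeps the body off the unit sphere, no matter how small its jump is.
\<close>

definition sup_term :: "'a::{wellorder, order_top, linorder_topology} \<Rightarrow> ('a \<Rightarrow>\<^sub>C real) \<Rightarrow> real" where
  "sup_term t f = ramp ((jump f t)\<^sup>2 / (1 - (f t)\<^sup>2) - 1)"

lemma eval_in_unit_ball: "norm f < 1 \<Longrightarrow> 0 < 1 - (apply_bcontfun f t)\<^sup>2"
  for f :: "'a::topological_space \<Rightarrow>\<^sub>C real"
  using abs_eval_le[of f t] by (simp add: abs_square_less_1)

lemma smooth_at_sup_term:
  assumes "norm f < 1"
  shows "smooth_at (sup_term t) f"
proof -
  have e: "smooth_at (\<lambda>f. apply_bcontfun f t) f" and j: "smooth_at (\<lambda>f. jump f t) f"
    by (rule smooth_at_linear[OF bounded_linear_eval], rule smooth_at_linear[OF bounded_linear_jump])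
  have "smooth_at (\<lambda>f. (jump f t)\<^sup>2 * inverse (1 - (f t)\<^sup>2) - 1) f"
    using eval_in_unit_ball[OF assms, of t]
    by (intro smooth_at_diff smooth_at_mult smooth_at_power2 smooth_at_inverse smooth_at_const e j) simp
  from smooth_at_compose[OF this smooth_at_ramp] show ?thesis
    by (simp add: sup_term_def[abs_def] divide_inverse)
qed

lemma convex_on_sup_term: "convex_on (ball 0 1) (sup_term t)"
proof (rule convex_onI)
  fix s :: real and f g :: "'a \<Rightarrow>\<^sub>C real"
  assume s: "0 < s" "s < 1" and "f \<in> ball 0 1" "g \<in> ball 0 1"
  then have pos: "0 < 1 - (f t)\<^sup>2" "0 < 1 - (g t)\<^sup>2" using eval_in_unit_ball by auto
  let ?h = "(1 - s) *\<^sub>R f + s *\<^sub>R g"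
  have ht: "?h t = (1 - s) * f t + s * g t" "jump ?h t = (1 - s) * jump f t + s * jump g t"
    by (simp_all add: jump_add jump_scaleR)
  have "(1 - s) * (1 - (f t)\<^sup>2) + s * (1 - (g t)\<^sup>2) = 1 - (?h t)\<^sup>2 - s * (1 - s) * (f t - g t)\<^sup>2"
    unfolding ht convex_combination_power2 by (simp add: algebra_simps)
  also have "\<dots> \<le> 1 - (?h t)\<^sup>2" using s by simp
  finally have "(jump ?h t)\<^sup>2 / (1 - (?h t)\<^sup>2) \<le>
      (1 - s) * ((jump f t)\<^sup>2 / (1 - (f t)\<^sup>2)) + s * ((jump g t)\<^sup>2 / (1 - (g t)\<^sup>2))"
    unfolding ht(2) using s by (intro power2_over_linear_convex pos) auto
  then show "sup_term t ?h \<le> (1 - s) * sup_term t f + s * sup_term t g"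
    unfolding sup_term_def using s by (intro ramp_convex_combination) (auto simp: algebra_simps)
qed simp

lemma sup_term_le_1_iff:
  assumes "norm f < 1"
  shows "sup_term t f \<le> 1 \<longleftrightarrow> (jump f t)\<^sup>2 \<le> 2 * (1 - (f t)\<^sup>2)"
  unfolding sup_term_def ramp_le_1_iff
  using eval_in_unit_ball[OF assms, of t] by (simp add: field_simps)

lemma sup_term_eq_0:
  assumes "norm f < 1" "(jump f t)\<^sup>2 \<le> 1 - (f t)\<^sup>2"
  shows "sup_term t f = 0"
  unfolding sup_term_def using eval_in_unit_ball[OF assms(1), of t] assms(2)
  by (intro ramp_simps(1)) (simp add: field_simps)

text \<open>
  Closedness is where the blow-up is needed: a limit of norm \<open>1\<close> would have a point with \<open>\<bar>f t\<bar>
  = 1\<close> and nonzero jump, against the limit of the inequalities \<open>(jump f t)\<^sup>2 \<le> 2 * (1 - (f t)\<^sup>2)\<close>.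
\<close>

lemma smooth_body_sup_term:
  "smooth_body (sup_term :: 'a::{wellorder, order_top, linorder_topology} \<Rightarrow> _) UNIV (ball 0 1) 1"
proof
  fix f :: "'a \<Rightarrow>\<^sub>C real" and t :: 'a
  show "f \<in> ball 0 1" if "norm f \<le> 1/4" using that by simp
  show "sup_term t f = 0" if "norm f \<le> 1/4"
  proof (rule sup_term_eq_0)
    have "\<bar>jump f t\<bar> \<le> 1/2" using abs_jump_le[of f t] that by linarith
    then have "(jump f t)\<^sup>2 \<le> (1/2)\<^sup>2" by (rule power2_le_if_abs_le)
    moreover have "\<bar>f t\<bar> \<le> 1/4" using abs_eval_le[of f t] that by linarith
    then have "(f t)\<^sup>2 \<le> (1/4)\<^sup>2" by (rule power2_le_if_abs_le)
    ultimately show "(jump f t)\<^sup>2 \<le> 1 - (f t)\<^sup>2" by (simp add: power2_eq_square)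
  qed (use that in simp)
next
  show "closed (sum_body (sup_term :: 'a \<Rightarrow> _) UNIV (ball 0 1))"
    unfolding closed_sequential_limits
  proof (intro allI impI, elim conjE)
    fix fs and f :: "'a \<Rightarrow>\<^sub>C real"
    assume body: "\<forall>n. fs n \<in> sum_body sup_term UNIV (ball 0 1)" and lim: "fs \<longlonglongrightarrow> f"
    have ball: "norm (fs n) < 1" for n using body by (auto simp: sum_body_def)
    have sum: "(\<Sum>t\<in>F. sup_term t (fs n)) \<le> 1" if "finite F" for F n
      using body that by (auto simp: sum_body_def)
    have "norm f \<le> 1" by (rule tendsto_upperbound[OF tendsto_norm[OF lim]]) (use ball in \<open>auto intro!: always_eventually less_imp_le\<close>)
    moreover have "norm f \<noteq> 1"
    proof
      assume 1: "norm f = 1"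
      then have "f \<noteq> 0" by auto
      then obtain t where "\<bar>f t\<bar> = norm f" "jump f t \<noteq> 0" by (rule norm_attained_with_jump)
      with 1 have t: "\<bar>f t\<bar> = 1" "jump f t \<noteq> 0" by auto
      have "(jump (fs n) t)\<^sup>2 \<le> 2 * (1 - (fs n t)\<^sup>2)" for n
        using sum[of "{t}" n] ball by (simp add: sup_term_le_1_iff)
      moreover have "(\<lambda>n. (jump (fs n) t)\<^sup>2) \<longlonglongrightarrow> (jump f t)\<^sup>2"
        by (intro tendsto_intros bounded_linear.tendsto[OF bounded_linear_jump lim])
      moreover have "(\<lambda>n. 2 * (1 - (fs n t)\<^sup>2)) \<longlonglongrightarrow> 2 * (1 - (f t)\<^sup>2)"
        by (intro tendsto_intros bounded_linear.tendsto[OF bounded_linear_eval lim])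
      ultimately have "(jump f t)\<^sup>2 \<le> 2 * (1 - (f t)\<^sup>2)" by (intro LIMSEQ_le) auto
      moreover have "(f t)\<^sup>2 = 1" using t(1) by (simp add: power2_eq_1_iff abs_if split: if_splits)
      ultimately show False using t(2) by simp
    qed
    ultimately have f1: "norm f < 1" by simp
    have "(\<Sum>t\<in>F. sup_term t f) \<le> 1" if F: "finite F" for F
    proof (rule tendsto_upperbound)
      show "(\<lambda>n. \<Sum>t\<in>F. sup_term t (fs n)) \<longlonglongrightarrow> (\<Sum>t\<in>F. sup_term t f)"
        by (intro tendsto_sum isCont_tendsto_compose[OF _ lim] smooth_at_imp_isCont smooth_at_sup_term f1)
    qed (use sum[OF F] in auto)
    with f1 show "f \<in> sum_body sup_term UNIV (ball 0 1)" by (simp add: sum_body_def)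
  qed
next
  fix f :: "'a \<Rightarrow>\<^sub>C real" assume "f \<in> sum_body sup_term UNIV (ball 0 1)"
  then have f1: "norm f < 1" by (simp add: sum_body_def)
  then show "norm f \<le> 1" by simp
  define d where "d = (1 - norm f) / 4"
  have d: "0 < d" "norm f = 1 - 4 * d" "d \<le> 1/4"
    using f1 by (simp_all add: d_def field_simps)
  let ?F = "{t. \<bar>jump f t\<bar> \<ge> d}"
  have "sup_term t g = 0" if g: "g \<in> ball f d" and t: "t \<notin> ?F" for g t
  proof (rule sup_term_eq_0)
    have gf: "norm (g - f) < d" using g by (simp add: dist_norm norm_minus_commute)
    then have n: "norm g \<le> 1 - 3 * d" using norm_triangle_sub[of g f] d by linarith
    then show "norm g < 1" using d by linarith
    have "\<bar>jump g t - jump f t\<bar> \<le> 2 * d" using abs_jump_le[of "g - f" t] gf by (simp add: jump_diff)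
    then have "\<bar>jump g t\<bar> \<le> 3 * d" using t by auto
    then have "(jump g t)\<^sup>2 \<le> (3 * d)\<^sup>2" by (rule power2_le_if_abs_le)
    moreover have "\<bar>g t\<bar> \<le> 1 - 3 * d" using n abs_eval_le[of g t] by linarith
    then have "(g t)\<^sup>2 \<le> (1 - 3 * d)\<^sup>2" by (rule power2_le_if_abs_le)
    moreover have "(3 * d)\<^sup>2 + (1 - 3 * d)\<^sup>2 \<le> 1"
    proof -
      have "d * d \<le> d * (1/4)" using d by (intro mult_left_mono) auto
      then show ?thesis using d by (simp add: power2_eq_square algebra_simps)
    qed
    ultimately show "(jump g t)\<^sup>2 \<le> 1 - (g t)\<^sup>2" by linarith
  qed
  moreover have "ball f d \<subseteq> ball 0 1"
  proof
    fix g assume "g \<in> ball f d"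
    then have "norm (g - f) < d" by (simp add: dist_norm norm_minus_commute)
    then have "norm g < 1" using norm_triangle_sub[of g f] d by linarith
    then show "g \<in> ball 0 1" by simp
  qed
  ultimately show "\<exists>W F. open W \<and> f \<in> W \<and> W \<subseteq> ball 0 1 \<and> finite F \<and> F \<subseteq> UNIV \<and>
      (\<forall>y\<in>W. \<forall>i\<in>UNIV - F. sup_term i y = 0)"
    using d(1) finite_big_jumps[OF d(1), of f] by (intro exI[of _ "ball f d"] exI[of _ ?F]) auto
qed (auto simp: sup_term_def jump_minus intro: smooth_at_sup_term convex_on_sup_term)

definition smooth_sup_norm :: "('a::{wellorder, order_top, linorder_topology} \<Rightarrow>\<^sub>C real) \<Rightarrow> real" where
  "smooth_sup_norm = unit_body.mink (sum_body sup_term UNIV (ball 0 1))"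

interpretation sup_body: smooth_body "sup_term :: 'a::{wellorder, order_top, linorder_topology} \<Rightarrow> _"
    UNIV "ball 0 1" 1
  rewrites "unit_body.mink (sum_body sup_term UNIV (ball 0 1)) = (smooth_sup_norm :: ('a \<Rightarrow>\<^sub>C real) \<Rightarrow> real)"
  by (rule smooth_body_sup_term) (simp add: smooth_sup_norm_def)

lemmas is_norm_smooth_sup_norm = sup_body.is_norm_mink
lemmas smooth_sup_norm_le = sup_body.mink_bound
lemmas smooth_at_smooth_sup_norm = sup_body.smooth_at_mink

lemma norm_le_smooth_sup_norm: "norm f \<le> smooth_sup_norm f"
  using sup_body.norm_le_mink[of f] by simp

section \<open>Bodies that select finite sets of jumps\<close>

text \<open>
  A smooth function on the whole space that vanishes near the origin, where the norm itself is
  not differentiable.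
\<close>

definition excess :: "('a::{wellorder, order_top, linorder_topology} \<Rightarrow>\<^sub>C real) \<Rightarrow> real" where
  "excess u = ramp ((smooth_sup_norm u)\<^sup>2 - 1)"

lemma excess_nonneg: "0 \<le> excess u"
  by (simp add: excess_def)

lemma smooth_sup_norm_minus: "smooth_sup_norm (- u) = smooth_sup_norm u"
  by (rule is_norm_minus[OF is_norm_smooth_sup_norm])

lemma smooth_sup_norm_scale: "smooth_sup_norm (c *\<^sub>R u) = \<bar>c\<bar> * smooth_sup_norm u"
  by (rule is_normD(3)[OF is_norm_smooth_sup_norm])

lemma smooth_sup_norm_nonneg: "0 \<le> smooth_sup_norm u"
  by (rule is_normD(1)[OF is_norm_smooth_sup_norm])

lemma excess_minus: "excess (- u) = excess u"
  by (simp add: excess_def smooth_sup_norm_minus)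

lemma excess_eq_0: "smooth_sup_norm u \<le> 1 \<Longrightarrow> excess u = 0"
  unfolding excess_def using smooth_sup_norm_nonneg[of u]
  by (intro ramp_simps(1)) (simp add: power_le_one)

lemma excess_le: "excess u \<le> 3 * (smooth_sup_norm u)\<^sup>2"
proof (cases "0 \<le> (smooth_sup_norm u)\<^sup>2 - 1")
  case True
  have "excess u \<le> exp 1 * ((smooth_sup_norm u)\<^sup>2 - 1)" unfolding excess_def by (rule ramp_bound[OF True])
  also have "\<dots> \<le> 3 * ((smooth_sup_norm u)\<^sup>2 - 1)" using True exp_le by (intro mult_right_mono) auto
  finally show ?thesis by simp
next
  case False
  then show ?thesis by (simp add: excess_def)
qed

lemma smooth_at_excess: "smooth_at excess u"
proof (cases "u = 0")
  case True
  show ?thesis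
  proof (rule smooth_at_cong[of "\<lambda>_. 0" u "ball 0 (1/4)"])
    fix v :: "'a \<Rightarrow>\<^sub>C real" assume "v \<in> ball 0 (1/4)"
    then have "smooth_sup_norm v \<le> 1" using smooth_sup_norm_le[of v] by simp
    then show "0 = excess v" by (simp add: excess_eq_0)
  qed (use True in auto)
next
  case False
  have "smooth_at (\<lambda>u. (smooth_sup_norm u)\<^sup>2 - 1) u"
    by (intro smooth_at_diff smooth_at_power2 smooth_at_smooth_sup_norm False smooth_at_const)
  from smooth_at_compose[OF this smooth_at_ramp] show ?thesis by (simp add: excess_def[abs_def])
qed

lemma excess_convex:
  assumes t: "0 \<le> t" "t \<le> 1"
  shows "excess ((1 - t) *\<^sub>R u + t *\<^sub>R v) \<le> (1 - t) * excess u + t * excess v"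
  unfolding excess_def
proof (rule ramp_convex_combination[OF t])
  let ?N = smooth_sup_norm
  have "?N ((1 - t) *\<^sub>R u + t *\<^sub>R v) \<le> (1 - t) * ?N u + t * ?N v"
    using is_normD(4)[OF is_norm_smooth_sup_norm, of "(1 - t) *\<^sub>R u" "t *\<^sub>R v"] t
    by (simp add: smooth_sup_norm_scale)
  then have "(?N ((1 - t) *\<^sub>R u + t *\<^sub>R v))\<^sup>2 \<le> ((1 - t) * ?N u + t * ?N v)\<^sup>2"
    by (intro power_mono smooth_sup_norm_nonneg)
  also have "\<dots> \<le> (1 - t) * (?N u)\<^sup>2 + t * (?N v)\<^sup>2"
    unfolding convex_combination_power2 using t by simp
  finally show "(?N ((1 - t) *\<^sub>R u + t *\<^sub>R v))\<^sup>2 - 1 \<le> (1 - t) * ((?N u)\<^sup>2 - 1) + t * ((?N v)\<^sup>2 - 1)"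
    by (simp add: algebra_simps)
qed

definition mean_square :: "'a::{wellorder, order_top, linorder_topology} set \<Rightarrow> ('a \<Rightarrow>\<^sub>C real) \<Rightarrow> real" where
  "mean_square A u = (\<Sum>b\<in>insert top A. (u b)\<^sup>2) / card (insert top A)"

definition remainder :: "'a::{wellorder, order_top, linorder_topology} set \<Rightarrow> ('a \<Rightarrow>\<^sub>C real) \<Rightarrow> real" where
  "remainder A u = mean_square A u + excess (u - step A u)"

text \<open>
  Maximising the first sum over \<open>A\<close> selects the points with \<open>(jump u b)\<^sup>2 > 8\<close>. Because each
  point has the fixed cost \<open>8\<close>, a wrong decision about a jump that is clearly smaller or clearly
  larger loses an amount that is bounded below independently of \<open>u\<close>. The remainder measures how
  \<open>u\<close> behaves apart from these jumps; its factor \<open>k\<close> will be so small that it cannot influence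
  the selection.
\<close>

definition jump_score :: "real \<Rightarrow> 'a::{wellorder, order_top, linorder_topology} set \<Rightarrow> ('a \<Rightarrow>\<^sub>C real) \<Rightarrow> real" where
  "jump_score k A u = (\<Sum>b\<in>A. (jump u b)\<^sup>2 - 8) + k * remainder A u"

text \<open>
  The quadratic part of the score, by which its convexity is strict.
\<close>

definition score_defect :: "real \<Rightarrow> 'a::{wellorder, order_top, linorder_topology} set \<Rightarrow> ('a \<Rightarrow>\<^sub>C real) \<Rightarrow> real" where
  "score_defect k A u = (\<Sum>b\<in>A. (jump u b)\<^sup>2) + k * mean_square A u"

lemma mean_square_nonneg: "0 \<le> mean_square A u"
  by (simp add: mean_square_def sum_nonneg)

lemma remainder_nonneg: "0 \<le> remainder A u"
  by (simp add: remainder_def mean_square_nonneg excess_nonneg)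

lemma mean_square_le:
  fixes u :: "'a::{wellorder, order_top, linorder_topology} \<Rightarrow>\<^sub>C real"
  assumes "finite A"
  shows "mean_square A u \<le> (norm u)\<^sup>2"
proof -
  have "(\<Sum>b\<in>insert top A. (u b)\<^sup>2) \<le> of_nat (card (insert top A)) * (norm u)\<^sup>2"
    by (intro sum_bounded_above power2_le_if_abs_le abs_eval_le)
  then show ?thesis unfolding mean_square_def
    using assms by (simp add: divide_le_eq mult.commute card_gt_0_iff)
qed

lemma mean_square_ge:
  fixes u :: "'a::{wellorder, order_top, linorder_topology} \<Rightarrow>\<^sub>C real"
  assumes "finite A" "b \<in> insert top A"
  shows "(u b)\<^sup>2 \<le> real (card (insert top A)) * mean_square A u"
proof -
  have "(u b)\<^sup>2 \<le> (\<Sum>b\<in>insert top A. (u b)\<^sup>2)"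
    using assms by (intro member_le_sum) auto
  then show ?thesis using assms by (simp add: mean_square_def)
qed

lemma remainder_le:
  fixes u :: "'a::{wellorder, order_top, linorder_topology} \<Rightarrow>\<^sub>C real"
  assumes "finite A"
  shows "remainder A u \<le> 200 * (smooth_sup_norm u)\<^sup>2"
proof -
  let ?N = smooth_sup_norm
  have "mean_square A u \<le> (?N u)\<^sup>2"
    using mean_square_le[OF assms, of u] power_mono[OF norm_le_smooth_sup_norm[of u] norm_ge_zero, of 2] by linarith
  moreover have "?N (u - step A u) \<le> 8 * ?N u"
  proof -
    have "norm (u - step A u) \<le> norm u + norm u"
      using norm_triangle_ineq4[of u "step A u"] norm_step_le[OF assms, of u "norm u"] abs_eval_le[of u] by simp
    then show ?thesis
      using smooth_sup_norm_le[of "u - step A u"] norm_le_smooth_sup_norm[of u] by linarith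
  qed
  then have "(?N (u - step A u))\<^sup>2 \<le> (8 * ?N u)\<^sup>2" by (intro power_mono smooth_sup_norm_nonneg)
  then have "excess (u - step A u) \<le> 192 * (?N u)\<^sup>2"
    using excess_le[of "u - step A u"] by (simp add: power_mult_distrib)
  ultimately show ?thesis by (simp add: remainder_def) (smt (verit) zero_le_power2)
qed

lemma jump_score_convex:
  assumes A: "finite A" and t: "0 \<le> t" "t \<le> 1" and k: "0 \<le> k"
  shows "jump_score k A ((1 - t) *\<^sub>R u + t *\<^sub>R v) \<le>
    (1 - t) * jump_score k A u + t * jump_score k A v - t * (1 - t) * score_defect k A (u - v)"
proof -
  let ?w = "(1 - t) *\<^sub>R u + t *\<^sub>R v" and ?n = "real (card (insert top A))"
  have j: "(\<Sum>b\<in>A. (jump ?w b)\<^sup>2 - 8) = (1 - t) * (\<Sum>b\<in>A. (jump u b)\<^sup>2 - 8) +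
      t * (\<Sum>b\<in>A. (jump v b)\<^sup>2 - 8) - t * (1 - t) * (\<Sum>b\<in>A. (jump (u - v) b)\<^sup>2)"
    by (simp only: jump_add jump_scaleR jump_diff convex_combination_power2 sum_distrib_left
        sum.distrib[symmetric] sum_subtractf[symmetric]) (simp add: algebra_simps)
  have "(\<Sum>b\<in>insert top A. (?w b)\<^sup>2) = (1 - t) * (\<Sum>b\<in>insert top A. (u b)\<^sup>2) +
      t * (\<Sum>b\<in>insert top A. (v b)\<^sup>2) - t * (1 - t) * (\<Sum>b\<in>insert top A. ((u - v) b)\<^sup>2)"
    by (simp only: plus_bcontfun.rep_eq scaleR_bcontfun.rep_eq minus_bcontfun.rep_eq real_scaleR_def
        convex_combination_power2 sum_distrib_left sum.distrib[symmetric] sum_subtractf[symmetric])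
  then have m: "mean_square A ?w = (1 - t) * mean_square A u + t * mean_square A v -
      t * (1 - t) * mean_square A (u - v)"
    unfolding mean_square_def by (simp add: add_divide_distrib diff_divide_distrib)
  interpret S: bounded_linear "step A" by (rule bounded_linear_step[OF A])
  have "?w - step A ?w = (1 - t) *\<^sub>R (u - step A u) + t *\<^sub>R (v - step A v)"
    by (simp add: S.add S.scaleR scaleR_diff_right)
  then have "excess (?w - step A ?w) \<le> (1 - t) * excess (u - step A u) + t * excess (v - step A v)"
    using excess_convex[OF t] by metis
  then have "remainder A ?w \<le> (1 - t) * remainder A u + t * remainder A v - t * (1 - t) * mean_square A (u - v)"
    unfolding remainder_def m by (simp add: algebra_simps)
  from mult_left_mono[OF this k] show ?thesis
    unfolding jump_score_def score_defect_def j by (simp add: algebra_simps)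
qed

lemma jump_score_minus:
  assumes "finite A"
  shows "jump_score k A (- u) = jump_score k A u"
proof -
  interpret S: bounded_linear "step A" by (rule bounded_linear_step[OF assms])
  have "- u - step A (- u) = - (u - step A u)" using S.scaleR[of "- 1" u] by simp
  then have "excess (- u - step A (- u)) = excess (u - step A u)" using excess_minus by metis
  then show ?thesis by (simp add: jump_score_def remainder_def mean_square_def jump_minus)
qed

lemma smooth_at_eval: "smooth_at (\<lambda>u. apply_bcontfun u b) u"
  by (rule smooth_at_linear[OF bounded_linear_eval])

lemma smooth_at_jump: "smooth_at (\<lambda>u. jump u b) u"
  by (rule smooth_at_linear[OF bounded_linear_jump])

lemma smooth_at_jump_score:
  assumes "finite A"
  shows "smooth_at (jump_score k A) u"
proof -
  have "bounded_linear (\<lambda>u. u - step A u)"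
    by (intro bounded_linear_sub bounded_linear_ident bounded_linear_step assms)
  then have e: "smooth_at (\<lambda>u. excess (u - step A u)) u"
    by (rule smooth_at_precompose_linear) (rule smooth_at_excess)
  show ?thesis
    unfolding jump_score_def[abs_def] remainder_def mean_square_def divide_inverse
    by (intro smooth_at_add smooth_at_mult smooth_at_sum smooth_at_diff smooth_at_power2
        smooth_at_const smooth_at_eval smooth_at_jump e)
qed

lemma isCont_jump_score: "finite A \<Longrightarrow> isCont (jump_score k A) u"
  by (rule smooth_at_imp_isCont[OF smooth_at_jump_score])

text \<open>
  By \<open>remainder_le\<close> this keeps the weighted remainder below \<open>1\<close> as long as the smooth norm is at
  most \<open>2 * R\<close>.
\<close>

definition weight :: "real \<Rightarrow> real" where
  "weight R = 1 / (1000 * R\<^sup>2)"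

text \<open>
  The index \<open>None\<close> makes the body bounded; it is inactive where the smooth norm is at most \<open>R\<close>.
  Where it is inactive, the largest score of a unit vector lies between \<open>m\<close> and \<open>m + 1\<close>. So the
  larger \<open>m\<close>, the smaller the value \<open>\<rho>\<close> of the Minkowski functional at a given \<open>f\<close>, and the
  smaller the jumps of \<open>f\<close> that count after division by \<open>\<rho>\<close>.
\<close>

definition lur_term :: "real \<Rightarrow> real \<Rightarrow> 'a::{wellorder, order_top, linorder_topology} set option \<Rightarrow> ('a \<Rightarrow>\<^sub>C real) \<Rightarrow> real" where
  "lur_term m R i u = (case i of None \<Rightarrow> excess (inverse R *\<^sub>R u) | Some A \<Rightarrow> ramp (jump_score (weight R) A u - m))"

definition lur_index :: "'a set option set" where
  "lur_index = insert None (Some ` {A. finite A})"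

lemma weight_remainder:
  assumes "finite A" "R > 0" "(smooth_sup_norm u)\<^sup>2 \<le> 4 * R\<^sup>2"
  shows "0 \<le> weight R * remainder A u" "weight R * remainder A u \<le> 1"
proof -
  show "0 \<le> weight R * remainder A u" by (simp add: weight_def remainder_nonneg)
  have "remainder A u \<le> 1000 * R\<^sup>2" using remainder_le[OF assms(1), of u] assms(3) zero_le_power2[of R] by linarith
  then show "weight R * remainder A u \<le> 1" using assms(2) by (simp add: weight_def divide_le_eq)
qed

lemma lur_term_in_body:
  assumes "u \<in> sum_body (lur_term m R) lur_index UNIV" "R > 0"
  shows "(smooth_sup_norm u)\<^sup>2 \<le> 2 * R\<^sup>2" "finite A \<Longrightarrow> jump_score (weight R) A u \<le> m + 1"
proof -
  have le: "lur_term m R i u \<le> 1" if "i \<in> lur_index" for i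
    using assms(1) that by (auto simp: sum_body_def dest!: spec[of _ "{i}"])
  show "jump_score (weight R) A u \<le> m + 1" if "finite A"
    using le[of "Some A"] that by (simp add: lur_term_def lur_index_def ramp_le_1_iff)
  have "(smooth_sup_norm (inverse R *\<^sub>R u))\<^sup>2 \<le> 2"
    using le[of None] by (simp add: lur_term_def lur_index_def excess_def ramp_le_1_iff)
  then show "(smooth_sup_norm u)\<^sup>2 \<le> 2 * R\<^sup>2"
    using assms(2) by (simp add: smooth_sup_norm_scale power_mult_distrib power_inverse field_simps)
qed

lemma smooth_at_lur_term: "i \<in> lur_index \<Longrightarrow> smooth_at (lur_term m R i) u"
proof (cases i)
  case None
  have "smooth_at (\<lambda>u. excess (inverse R *\<^sub>R u)) u"
    by (rule smooth_at_precompose_linear[OF bounded_linear_scaleR_right]) (rule smooth_at_excess)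
  then show ?thesis by (simp add: lur_term_def[abs_def] None)
next
  case (Some A)
  assume "i \<in> lur_index"
  then have "finite A" by (auto simp: lur_index_def Some)
  then have "smooth_at (\<lambda>u. jump_score (weight R) A u - m) u"
    by (intro smooth_at_diff smooth_at_jump_score smooth_at_const)
  from smooth_at_compose[OF this smooth_at_ramp] show ?thesis by (simp add: lur_term_def[abs_def] Some)
qed

lemma convex_on_lur_term:
  assumes "i \<in> lur_index"
  shows "convex_on UNIV (lur_term m R i)"
proof (rule convex_onI)
  fix t and u v :: "'a \<Rightarrow>\<^sub>C real" assume t: "0 < t" "t < (1::real)"
  let ?w = "(1 - t) *\<^sub>R u + t *\<^sub>R v"
  show "lur_term m R i ?w \<le> (1 - t) * lur_term m R i u + t * lur_term m R i v"
  proof (cases i)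
    case None
    have eq: "inverse R *\<^sub>R ?w = (1 - t) *\<^sub>R (inverse R *\<^sub>R u) + t *\<^sub>R (inverse R *\<^sub>R v)"
      by (simp add: scaleR_add_right mult.commute)
    show ?thesis
      unfolding lur_term_def None option.case eq using t by (intro excess_convex) auto
  next
    case (Some A)
    have A: "finite A" using assms by (auto simp: lur_index_def Some)
    have w: "0 \<le> weight R" by (simp add: weight_def)
    have "0 \<le> score_defect (weight R) A (u - v)"
      by (simp add: score_defect_def sum_nonneg mean_square_nonneg w)
    then have "jump_score (weight R) A ?w \<le> (1 - t) * jump_score (weight R) A u + t * jump_score (weight R) A v"
      using jump_score_convex[OF A _ _ w, of t u v] t by (smt (verit) mult_nonneg_nonneg)
    then show ?thesis
      unfolding lur_term_def Some option.case using t
      by (intro ramp_convex_combination) (auto simp: algebra_simps)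
  qed
qed simp

text \<open>
  Only the local finiteness is not routine. Near a point \<open>u\<close> of the body let \<open>B\<close> be the finite
  set of its jumps of size at least \<open>1\<close>. A set \<open>A\<close> that is not contained in \<open>B\<close> pays at least
  \<open>4\<close> for its points outside \<open>B\<close> and gains at most \<open>1\<close> from the remainder, so its score stays
  below the score of \<open>A \<inter> B\<close>, which is less than \<open>m + 2\<close>, by at least \<open>3\<close>.
\<close>

lemma smooth_body_lur_term:
  assumes m: "1 \<le> m" and R: "1 \<le> R"
  shows "smooth_body (lur_term m R :: 'a::{wellorder, order_top, linorder_topology} set option \<Rightarrow> _) lur_index UNIV (2 * R)"
proof
  fix u :: "'a \<Rightarrow>\<^sub>C real" and i :: "'a set option" assume i: "i \<in> lur_index"
  then have fin: "finite A" if "i = Some A" for A using that by (auto simp: lur_index_def)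
  show "lur_term m R i (- u) = lur_term m R i u"
    using excess_minus[of "inverse R *\<^sub>R u"] fin by (auto simp: lur_term_def jump_score_minus split: option.splits)
  show "0 \<le> lur_term m R i u" by (simp add: lur_term_def excess_nonneg split: option.splits)
  show "lur_term m R i u = 0" if small: "norm u \<le> 1/4"
  proof (cases i)
    case None
    have "inverse R * smooth_sup_norm u \<le> 1 * 1"
      using small smooth_sup_norm_le[of u] R
      by (intro mult_mono) (auto simp: smooth_sup_norm_nonneg inverse_le_1_iff)
    then show ?thesis using R by (simp add: None lur_term_def excess_eq_0 smooth_sup_norm_scale)
  next
    case (Some A)
    have "smooth_sup_norm u \<le> 1" using small smooth_sup_norm_le[of u] by simp
    then have "(smooth_sup_norm u)\<^sup>2 \<le> 1" using smooth_sup_norm_nonneg[of u] by (simp add: power_le_one)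
    moreover have "1 \<le> R\<^sup>2" using R by (simp add: one_le_power)
    ultimately have "weight R * remainder A u \<le> 1"
      using R by (intro weight_remainder fin Some) linarith+
    moreover have "(jump u b)\<^sup>2 \<le> 8" for b
    proof -
      have "\<bar>jump u b\<bar> \<le> 1" using abs_jump_le[of u b] small by linarith
      from power2_le_if_abs_le[OF this] show ?thesis by simp
    qed
    then have "(\<Sum>b\<in>A. (jump u b)\<^sup>2 - 8) \<le> 0" by (intro sum_nonpos) simp
    ultimately show ?thesis using m by (simp add: Some lur_term_def jump_score_def)
  qed
next
  show "closed (sum_body (lur_term m R) lur_index (UNIV :: ('a \<Rightarrow>\<^sub>C real) set))"
  proof -
    have eq: "sum_body (lur_term m R) lur_index (UNIV :: ('a \<Rightarrow>\<^sub>C real) set) =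
        (\<Inter>F\<in>{F. finite F \<and> F \<subseteq> lur_index}. {u. (\<Sum>i\<in>F. lur_term m R i u) \<le> 1})"
      by (auto simp: sum_body_def)
    show ?thesis unfolding eq
    proof (intro closed_INT ballI)
      fix F :: "'a set option set" assume "F \<in> {F. finite F \<and> F \<subseteq> lur_index}"
      then have F: "F \<subseteq> lur_index" by simp
      have "isCont (\<lambda>u. \<Sum>i\<in>F. lur_term m R i u) u" for u
        by (intro continuous_intros smooth_at_imp_isCont smooth_at_lur_term) (use F in auto)
      then show "closed {u. (\<Sum>i\<in>F. lur_term m R i u) \<le> 1}"
        by (intro closed_Collect_le continuous_at_imp_continuous_on) auto
    qed
  qed
next
  fix u :: "'a \<Rightarrow>\<^sub>C real" assume u: "u \<in> sum_body (lur_term m R) lur_index UNIV"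
  have R0: "0 < R" using R by simp
  note N = lur_term_in_body(1)[OF u R0]
  note score = lur_term_in_body(2)[OF u R0]
  have "(2 * R)\<^sup>2 = 4 * R\<^sup>2" by (simp add: power_mult_distrib)
  then have "(smooth_sup_norm u)\<^sup>2 \<le> (2 * R)\<^sup>2" using N zero_le_power2[of R] by linarith
  then have "smooth_sup_norm u \<le> 2 * R" by (rule power2_le_imp_le) (use R0 in simp)
  then show "norm u \<le> 2 * R" using norm_le_smooth_sup_norm[of u] by linarith
  let ?B = "{b. \<bar>jump u b\<bar> \<ge> 1}"
  have B: "finite ?B" by (rule finite_big_jumps) simp
  let ?W = "ball u (1/2) \<inter> {v. smooth_sup_norm v < 2 * R} \<inter>
    (\<Inter>A\<in>Pow ?B. {v. jump_score (weight R) A v < m + 2})"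
  let ?F = "insert None (Some ` Pow ?B)"
  have W: "open ?W"
  proof (intro open_Int open_INT ballI)
    show "finite (Pow ?B)" using B by simp
    show "open {v. smooth_sup_norm v < 2 * R}"
      by (intro open_Collect_less continuous_intros)
        (auto simp: continuous_on_def intro: sup_body.mink_tendsto)
    fix A assume "A \<in> Pow ?B"
    then have "finite A" using B finite_subset by auto
    then show "open {v. jump_score (weight R) A v < m + 2}"
      by (intro open_Collect_less continuous_at_imp_continuous_on) (auto intro: isCont_jump_score)
  qed simp
  have uW: "u \<in> ?W"
  proof -
    have "0 < R\<^sup>2" using R0 by simp
    moreover have "(2 * R)\<^sup>2 = 4 * R\<^sup>2" by (simp add: power_mult_distrib)
    ultimately have "(smooth_sup_norm u)\<^sup>2 < (2 * R)\<^sup>2" using N by linarith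
    then have "smooth_sup_norm u < 2 * R" by (rule power2_less_imp_less) (use R0 in simp)
    moreover have "jump_score (weight R) A u < m + 2" if "A \<in> Pow ?B" for A
    proof -
      have "finite A" using that B finite_subset by auto
      then show ?thesis using score[of A] by linarith
    qed
    ultimately show ?thesis by simp
  qed
  have zero: "lur_term m R i v = 0" if v: "v \<in> ?W" and i: "i \<in> lur_index - ?F" for v i
  proof -
    obtain A where A: "i = Some A" "finite A" using i unfolding lur_index_def by blast
    then have AB: "\<not> A \<subseteq> ?B" using i by blast
    have "smooth_sup_norm v < 2 * R" using v by blast
    then have "(smooth_sup_norm v)\<^sup>2 \<le> (2 * R)\<^sup>2" using smooth_sup_norm_nonneg[of v] by (intro power_mono) linarith+
    moreover have "(2 * R)\<^sup>2 = 4 * R\<^sup>2" by (simp add: power_mult_distrib)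
    ultimately have "(smooth_sup_norm v)\<^sup>2 \<le> 4 * R\<^sup>2" by linarith
    note w = weight_remainder[OF _ R0 this]
    have "jump_score (weight R) (A \<inter> ?B) v < m + 2" using v by blast
    then have 1: "(\<Sum>b\<in>A \<inter> ?B. (jump v b)\<^sup>2 - 8) < m + 2"
      using w(1)[of "A \<inter> ?B"] A(2) by (simp add: jump_score_def)
    have "(jump v b)\<^sup>2 - 8 \<le> - 4" if "b \<in> A - ?B" for b
    proof -
      have "v \<in> ball u (1/2)" using v by blast
      then have "norm (v - u) < 1/2" by (simp add: dist_norm norm_minus_commute)
      then have "\<bar>jump v b - jump u b\<bar> \<le> 1" using abs_jump_le[of "v - u" b] by (simp add: jump_diff)
      then have "\<bar>jump v b\<bar> \<le> 2" using that by auto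
      from power2_le_if_abs_le[OF this] show ?thesis by simp
    qed
    then have "(\<Sum>b\<in>A - ?B. (jump v b)\<^sup>2 - 8) \<le> of_nat (card (A - ?B)) * (- 4)"
      by (intro sum_bounded_above) auto
    moreover have "card (A - ?B) \<ge> 1"
    proof -
      have "A - ?B \<noteq> {}" using AB by blast
      then show ?thesis using A(2) card_gt_0_iff[of "A - ?B"] by (simp add: Suc_le_eq)
    qed
    ultimately have 2: "(\<Sum>b\<in>A - ?B. (jump v b)\<^sup>2 - 8) \<le> - 4" by linarith
    have "(\<Sum>b\<in>A. (jump v b)\<^sup>2 - 8) = (\<Sum>b\<in>A \<inter> ?B. (jump v b)\<^sup>2 - 8) + (\<Sum>b\<in>A - ?B. (jump v b)\<^sup>2 - 8)"
      by (rule sum.Int_Diff[OF A(2)])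
    then have "jump_score (weight R) A v \<le> m" using 1 2 w(2)[OF A(2)] by (simp add: jump_score_def)
    then show ?thesis by (simp add: A(1) lur_term_def)
  qed
  show "\<exists>W F. open W \<and> u \<in> W \<and> W \<subseteq> UNIV \<and> finite F \<and> F \<subseteq> lur_index \<and>
      (\<forall>y\<in>W. \<forall>i\<in>lur_index - F. lur_term m R i y = 0)"
  proof (intro exI[of _ ?W] exI[of _ ?F] conjI ballI)
    show "finite ?F" using B by simp
    have "finite A" if "A \<in> Pow ?B" for A using that B finite_subset by auto
    then show "?F \<subseteq> lur_index" unfolding lur_index_def by blast
  qed (rule W uW subset_UNIV zero, assumption?)+
qed (auto intro: convex_on_lur_term smooth_at_lur_term)

definition lur_norm :: "real \<Rightarrow> real \<Rightarrow> ('a::{wellorder, order_top, linorder_topology} \<Rightarrow>\<^sub>C real) \<Rightarrow> real" where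
  "lur_norm m R = unit_body.mink (sum_body (lur_term m R) lur_index UNIV)"

section \<open>Convergence from rotundity\<close>

lemma tendsto_zero_if_power2:
  assumes "((\<lambda>r. (g r)\<^sup>2) \<longlongrightarrow> 0) F"
  shows "(g \<longlongrightarrow> (0::real)) F"
  using tendsto_real_sqrt[OF assms] by (simp add: tendsto_rabs_zero_iff)

text \<open>
  The bound on \<open>m\<close> does not involve \<open>R\<close>, so that \<open>m\<close> can be chosen before \<open>R\<close>.
\<close>

lemma lur_body_contains:
  fixes f :: "'a::{wellorder, order_top, linorder_topology} \<Rightarrow>\<^sub>C real"
  assumes R: "1 \<le> R" "smooth_sup_norm f \<le> R"
    and m: "1 + (\<Sum>b | (jump f b)\<^sup>2 \<ge> 8. (jump f b)\<^sup>2) \<le> m"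
  shows "f \<in> sum_body (lur_term m R) lur_index UNIV"
proof -
  let ?B = "{b. (jump f b)\<^sup>2 \<ge> 8}"
  have "?B \<subseteq> {b. \<bar>jump f b\<bar> \<ge> 1}"
  proof (intro subsetI CollectI)
    fix b assume "b \<in> ?B"
    then show "\<bar>jump f b\<bar> \<ge> 1" using power_le_one[of "\<bar>jump f b\<bar>" 2] by (cases "\<bar>jump f b\<bar> \<le> 1") auto
  qed
  then have B: "finite ?B" using finite_big_jumps[of 1 f] finite_subset by auto
  have "lur_term m R i f = 0" if "i \<in> lur_index" for i
  proof (cases i)
    case None
    have "smooth_sup_norm (inverse R *\<^sub>R f) \<le> 1" using R by (simp add: smooth_sup_norm_scale field_simps)
    then show ?thesis by (simp add: lur_term_def None excess_eq_0)
  next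
    case (Some A)
    have A: "finite A" using that by (auto simp: Some lur_index_def)
    have "(smooth_sup_norm f)\<^sup>2 \<le> R\<^sup>2" using R(2) by (intro power_mono smooth_sup_norm_nonneg)
    then have w: "weight R * remainder A f \<le> 1"
      using R zero_le_power2[of R] by (intro weight_remainder A) linarith+
    have "(\<Sum>b\<in>A. (jump f b)\<^sup>2 - 8) \<le> (\<Sum>b\<in>A. if b \<in> ?B then (jump f b)\<^sup>2 else 0)"
      by (intro sum_mono) auto
    also have "\<dots> = (\<Sum>b\<in>A \<inter> ?B. (jump f b)\<^sup>2)" by (rule sum.inter_restrict[OF A, symmetric])
    also have "\<dots> \<le> (\<Sum>b\<in>?B. (jump f b)\<^sup>2)" using B by (intro sum_mono2) auto
    finally have "jump_score (weight R) A f \<le> m" using w m by (simp add: jump_score_def)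
    then show ?thesis by (simp add: lur_term_def Some)
  qed
  then show ?thesis by (auto simp: sum_body_def intro!: order_trans[OF eq_refl[OF sum.neutral]])
qed

text \<open>
  Otherwise adding the point would raise the score by at least \<open>16 - 8 - 1\<close>, beyond \<open>m + 1\<close>.
\<close>

lemma active_set_contains_big_jumps:
  assumes body: "u \<in> sum_body (lur_term m R) lur_index UNIV" and R: "1 \<le> R"
    and A: "finite A" "jump_score (weight R) A u > m" and b: "\<bar>jump u b\<bar> \<ge> 4"
  shows "b \<in> A"
proof (rule ccontr)
  assume nb: "b \<notin> A"
  have R0: "0 < R" using R by simp
  note body' = lur_term_in_body[OF body R0]
  have N: "(smooth_sup_norm u)\<^sup>2 \<le> 4 * R\<^sup>2" using body'(1) zero_le_power2[of R] by linarith
  have "jump_score (weight R) (insert b A) u \<le> m + 1" using A by (intro body') simp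
  moreover have "(jump u b)\<^sup>2 \<ge> 16" using power_mono[OF b, of 2] by simp
  ultimately show False
    using A nb weight_remainder[OF A(1) R0 N] weight_remainder[of "insert b A", OF _ R0 N]
    by (simp add: jump_score_def)
qed

lemma jump_score_lower: "finite A \<Longrightarrow> 0 \<le> k \<Longrightarrow> - 8 * real (card A) \<le> jump_score k A u"
proof -
  assume "finite A" "0 \<le> k"
  have "of_nat (card A) * (- 8) \<le> (\<Sum>b\<in>A. (jump u b)\<^sup>2 - 8)" by (intro sum_bounded_below) simp
  moreover have "0 \<le> k * remainder A u" using \<open>0 \<le> k\<close> by (simp add: remainder_nonneg)
  ultimately show ?thesis by (simp add: jump_score_def)
qed

text \<open>
  The convexity gap of the summand of \<open>A\<close> tends to \<open>0\<close>. Since this summand is positive at \<open>u\<close>,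
  strict convexity of \<open>ramp\<close> yields convergence of the scores, and the gap between the score and
  its convex combination tends to \<open>0\<close>, hence so does the quadratic defect. What remains of the
  score after subtracting the convergent quadratic terms is the excess.
\<close>

lemma rotundity_on_active_set:
  fixes u :: "'a::{wellorder, order_top, linorder_topology} \<Rightarrow>\<^sub>C real" and y :: "nat \<Rightarrow> ('a \<Rightarrow>\<^sub>C real)"
  assumes m: "1 \<le> m" and R: "1 \<le> R"
    and u: "lur_norm m R u = 1" and y: "\<And>r. lur_norm m R (y r) = 1"
    and lim: "(\<lambda>r. lur_norm m R (y r + u)) \<longlonglongrightarrow> 2"
    and A: "finite A" "jump_score (weight R) A u > m"
  shows "b \<in> insert top A \<Longrightarrow> (\<lambda>r. y r b) \<longlonglongrightarrow> u b"
    "(\<lambda>r. excess (y r - step A (y r))) \<longlonglongrightarrow> excess (u - step A u)"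
proof -
  interpret L: smooth_body "lur_term m R :: 'a set option \<Rightarrow> _" lur_index UNIV "2 * R"
    rewrites "unit_body.mink (sum_body (lur_term m R) lur_index UNIV) = (lur_norm m R :: ('a \<Rightarrow>\<^sub>C real) \<Rightarrow> real)"
    by (rule smooth_body_lur_term[OF m R]) (simp add: lur_norm_def)
  let ?k = "weight R" and ?n = "real (card (insert top A))"
  let ?J = "jump_score ?k A" and ?Q = "score_defect ?k A"
  have k: "0 < ?k" using R by (simp add: weight_def)
  have n: "0 < ?n" using A by (simp add: card_gt_0_iff)
  obtain s w where s: "s \<longlonglongrightarrow> 1/2" and w: "w \<longlonglongrightarrow> u" and gap: "\<And>i. i \<in> lur_index \<Longrightarrow>
      (\<lambda>r. s r * lur_term m R i (y r) + (1 - s r) * lur_term m R i (w r) -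
        lur_term m R i (s r *\<^sub>R y r + (1 - s r) *\<^sub>R w r)) \<longlonglongrightarrow> 0"
    using L.rotundity_gap[OF u y lim] by blast
  let ?mid = "\<lambda>r. s r *\<^sub>R y r + (1 - s r) *\<^sub>R w r"
  let ?a = "\<lambda>r. ?J (y r) - m" and ?b = "\<lambda>r. ?J (w r) - m" and ?z = "?J u - m"
  let ?e = "\<lambda>r. s r * ?J (y r) + (1 - s r) * ?J (w r) - ?J (?mid r)"
  have Jw: "(\<lambda>r. ?J (w r)) \<longlonglongrightarrow> ?J u"
    by (rule isCont_tendsto_compose[OF isCont_jump_score[OF A(1)] w])
  have b: "?b \<longlonglongrightarrow> ?z" by (intro tendsto_intros Jw)
  have s01: "\<forall>\<^sub>F r in sequentially. 1/4 < s r \<and> s r < 3/4"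
    using order_tendstoD[OF s, of "1/4"] order_tendstoD(2)[OF s, of "3/4"] by (auto elim: eventually_elim2)
  have def_le: "s r * (1 - s r) * ?Q (y r - w r) \<le> ?e r" if "1/4 < s r" "s r < 3/4" for r
    using jump_score_convex[OF A(1), of "1 - s r" ?k "y r" "w r"] that k by (simp add: mult.commute)
  have Q: "0 \<le> ?Q v" for v using k by (simp add: score_defect_def sum_nonneg mean_square_nonneg)
  have Jy: "?J (y r) \<le> m + 1" for r
    using lur_term_in_body(2)[of "y r" m R A] y L.mink_le_1_iff[of "y r"] R A by simp
  have low: "- 8 * real (card A) \<le> ?J v" for v using jump_score_lower[OF A(1)] k by simp
  define K where "K = 2 + 16 * real (card A) + 2 * m + \<bar>?J u\<bar>"
  have bdd: "\<forall>\<^sub>F r in sequentially. \<bar>?a r\<bar> \<le> K \<and> 0 \<le> ?e r \<and> ?e r \<le> K"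
    using s01 order_tendstoD(2)[OF Jw, of "?J u + 1", simplified]
  proof eventually_elim
    case (elim r)
    have "0 \<le> s r * (1 - s r) * ?Q (y r - w r)" using elim Q by (intro mult_nonneg_nonneg) auto
    then have "0 \<le> ?e r" using def_le[of r] elim by linarith
    moreover have "s r * ?J (y r) \<le> s r * (m + 1)" using elim Jy by (intro mult_left_mono) auto
    moreover have "s r * (m + 1) \<le> 1 * (m + 1)" using elim m by (intro mult_right_mono) auto
    ultimately have sJ: "0 \<le> ?e r" "s r * ?J (y r) \<le> m + 1" by simp_all
    have "(1 - s r) * ?J (w r) \<le> (1 - s r) * (\<bar>?J u\<bar> + 1)" using elim by (intro mult_left_mono) auto
    moreover have "(1 - s r) * (\<bar>?J u\<bar> + 1) \<le> 1 * (\<bar>?J u\<bar> + 1)" using elim by (intro mult_right_mono) auto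
    ultimately have "(1 - s r) * ?J (w r) \<le> \<bar>?J u\<bar> + 1" by simp
    with sJ show ?case
      using low[of "y r"] low[of "?mid r"] Jy[of r] m unfolding K_def by linarith
  qed
  have "(\<lambda>r. s r * ramp (?a r) + (1 - s r) * ramp (?b r) - ramp (s r * ?a r + (1 - s r) * ?b r - ?e r)) \<longlonglongrightarrow> 0"
  proof -
    have eq: "s r * ?a r + (1 - s r) * ?b r - ?e r = ?J (?mid r) - m" for r by (simp add: algebra_simps)
    show ?thesis unfolding eq using gap[of "Some A"] A(1) by (simp add: lur_term_def lur_index_def)
  qed
  note lims = ramp_gap_tendsto[OF s b _ bdd this]
  have "?a \<longlonglongrightarrow> ?z" and e0: "?e \<longlonglongrightarrow> 0" using lims A(2) by simp_all
  then have Jlim: "(\<lambda>r. ?J (y r)) \<longlonglongrightarrow> ?J u" using tendsto_add[of ?a ?z sequentially "\<lambda>_. m" m] by simp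
  have Q0: "(\<lambda>r. ?Q (y r - w r)) \<longlonglongrightarrow> 0"
  proof (rule tendsto_sandwich[OF _ _ tendsto_const])
    show "(\<lambda>r. 16 * ?e r) \<longlonglongrightarrow> 0" using tendsto_mult_left[OF e0, of 16] by simp
    show "\<forall>\<^sub>F r in sequentially. ?Q (y r - w r) \<le> 16 * ?e r"
      using s01
    proof eventually_elim
      case (elim r)
      have "1/4 * (1/4) \<le> s r * (1 - s r)" using elim by (intro mult_mono) auto
      then have "1/16 * ?Q (y r - w r) \<le> s r * (1 - s r) * ?Q (y r - w r)"
        using Q by (intro mult_right_mono) auto
      also have "\<dots> \<le> ?e r" using def_le[of r] elim by blast
      finally have "16 * (1/16 * ?Q (y r - w r)) \<le> 16 * ?e r" by (rule mult_left_mono) simp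
      then show ?case by simp
    qed
  qed (use Q in simp)
  have square0: "(\<lambda>r. g (y r)) \<longlonglongrightarrow> g u"
    if g: "bounded_linear g" and C: "\<And>v. (g v)\<^sup>2 \<le> C * ?Q v" for g :: "('a \<Rightarrow>\<^sub>C real) \<Rightarrow> real" and C
  proof -
    have lim: "(\<lambda>r. C * ?Q (y r - w r)) \<longlonglongrightarrow> 0" by (rule tendsto_mult_right_zero[OF Q0])
    have "(\<lambda>r. (g (y r - w r))\<^sup>2) \<longlonglongrightarrow> 0"
      by (rule tendsto_sandwich[OF _ _ tendsto_const lim]) (use C in simp_all)
    then have "(\<lambda>r. g (y r - w r)) \<longlonglongrightarrow> 0" by (rule tendsto_zero_if_power2)
    from tendsto_add[OF this bounded_linear.tendsto[OF g w]] show ?thesis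
      by (simp add: linear_diff[OF bounded_linear.linear[OF g]])
  qed
  have jumps: "(\<lambda>r. jump (y r) b) \<longlonglongrightarrow> jump u b" if "b \<in> A" for b
  proof (rule square0[OF bounded_linear_jump, of b 1])
    fix v :: "'a \<Rightarrow>\<^sub>C real"
    have "(jump v b)\<^sup>2 \<le> (\<Sum>b\<in>A. (jump v b)\<^sup>2)" using that A(1) by (intro member_le_sum) auto
    moreover have "0 \<le> ?k * mean_square A v" using k by (simp add: mean_square_nonneg)
    ultimately show "(jump v b)\<^sup>2 \<le> 1 * ?Q v" by (simp add: score_defect_def)
  qed
  show vals: "(\<lambda>r. y r b) \<longlonglongrightarrow> u b" if "b \<in> insert top A" for b
  proof (rule square0[OF bounded_linear_eval, of b "?n / ?k"])
    fix v :: "'a \<Rightarrow>\<^sub>C real"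
    have "?k * mean_square A v \<le> ?Q v" by (simp add: score_defect_def sum_nonneg)
    then have "mean_square A v \<le> ?Q v / ?k" using k by (simp add: field_simps)
    then have "?n * mean_square A v \<le> ?n * (?Q v / ?k)" using n by (intro mult_left_mono) auto
    then show "(v b)\<^sup>2 \<le> ?n / ?k * ?Q v" using mean_square_ge[OF A(1) that, of v] by simp
  qed
  have "(\<lambda>r. inverse ?k * (?J (y r) - (\<Sum>b\<in>A. (jump (y r) b)\<^sup>2 - 8)) - mean_square A (y r)) \<longlonglongrightarrow>
      inverse ?k * (?J u - (\<Sum>b\<in>A. (jump u b)\<^sup>2 - 8)) - mean_square A u"
    unfolding mean_square_def divide_inverse by (intro tendsto_intros Jlim jumps vals)
  moreover have "inverse ?k * (?J v - (\<Sum>b\<in>A. (jump v b)\<^sup>2 - 8)) - mean_square A v = excess (v - step A v)" for v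
    using k by (simp add: jump_score_def remainder_def mult.assoc[symmetric])
  ultimately show "(\<lambda>r. excess (y r - step A (y r))) \<longlonglongrightarrow> excess (u - step A u)" by simp
qed

text \<open>
  Choose \<open>\<sigma>\<close> so small that all jumps of \<open>f\<close> needed for a step approximation are at least \<open>4 *
  \<sigma>\<close>, then \<open>m\<close> so large that the value \<open>\<rho>\<close> of the norm at \<open>f\<close> is at most \<open>\<sigma>\<close> for all large \<open>R\<close>,
  and then \<open>R\<close> so large that the index \<open>None\<close> is inactive at \<open>u = f / \<rho>\<close>. Some finite set \<open>A\<close>
  must then be active at \<open>u\<close>, and it contains all these jumps. So \<open>f\<close> is close to its step
  function over \<open>A\<close>. For the normalised vectors \<open>y\<close>, the values on \<open>A\<close> converge to those of \<open>u\<close>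
  and the excess bounds the distance to the step function over \<open>A\<close> as well; hence \<open>y\<close> is close
  to \<open>u\<close>.
\<close>

theorem lur_norm_detects:
  fixes f :: "'a::{wellorder, order_top, linorder_topology} \<Rightarrow>\<^sub>C real"
  assumes f: "f \<noteq> 0" and e: "e > 0"
  shows "\<exists>M N :: nat. \<forall>xs.
    (\<lambda>r. lur_norm (real (Suc M)) (real (Suc N)) (xs r)) \<longlonglongrightarrow> lur_norm (real (Suc M)) (real (Suc N)) f \<longrightarrow>
    (\<lambda>r. lur_norm (real (Suc M)) (real (Suc N)) (xs r + f)) \<longlonglongrightarrow> 2 * lur_norm (real (Suc M)) (real (Suc N)) f \<longrightarrow>
    (\<forall>\<^sub>F r in sequentially. norm (xs r - f) < e)"
proof -
  \<comment> \<open>The final estimate loses the factor \<open>6 * 8 = 48\<close> and one further summand \<open>c\<close>.\<close>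
  define c where "c = e / 50"
  have c: "c > 0" using e by (simp add: c_def)
  obtain d where d: "d > 0" "\<And>A. finite A \<Longrightarrow> {t. \<bar>jump f t\<bar> \<ge> d} \<subseteq> A \<Longrightarrow> norm (f - step A f) \<le> c"
    using step_approximates[OF c, of f] by blast
  define \<sigma> where "\<sigma> = min (d / 4) c"
  have \<sigma>: "\<sigma> > 0" "\<sigma> \<le> d / 4" "\<sigma> \<le> c" using d c by (auto simp: \<sigma>_def)
  let ?g = "inverse \<sigma> *\<^sub>R f"
  obtain b0 where b0: "jump f b0 \<noteq> 0" using norm_attained_with_jump[OF f] by blast
  obtain M :: nat where M: "1 + (\<Sum>b | (jump ?g b)\<^sup>2 \<ge> 8. (jump ?g b)\<^sup>2) \<le> real M" using real_arch_simple by blast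
  define m where "m = real (Suc M)"
  have m: "1 \<le> m" "1 + (\<Sum>b | (jump ?g b)\<^sup>2 \<ge> 8. (jump ?g b)\<^sup>2) \<le> m" using M by (auto simp: m_def)
  obtain N :: nat where N: "max (smooth_sup_norm ?g) (smooth_sup_norm f * (m + 9) / \<bar>jump f b0\<bar>) \<le> real N"
    using real_arch_simple by blast
  define R where "R = real (Suc N)"
  have R: "1 \<le> R" "smooth_sup_norm ?g \<le> R" "smooth_sup_norm f * (m + 9) / \<bar>jump f b0\<bar> \<le> R"
    using N by (auto simp: R_def)
  have R0: "0 < R" using R by simp
  interpret L: smooth_body "lur_term m R :: 'a set option \<Rightarrow> _" lur_index UNIV "2 * R"
    rewrites "unit_body.mink (sum_body (lur_term m R) lur_index UNIV) = (lur_norm m R :: ('a \<Rightarrow>\<^sub>C real) \<Rightarrow> real)"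
    by (rule smooth_body_lur_term[OF m(1) R(1)]) (simp add: lur_norm_def)
  let ?q = "lur_norm m R :: ('a \<Rightarrow>\<^sub>C real) \<Rightarrow> real"
  define \<rho> where "\<rho> = ?q f"
  have \<rho>0: "\<rho> > 0" unfolding \<rho>_def by (rule L.mink_pos[OF f])
  have \<rho>\<sigma>: "\<rho> \<le> \<sigma>"
    unfolding \<rho>_def by (rule L.mink_le[OF \<sigma>(1) lur_body_contains[OF R(1,2) m(2)]])
  define u where "u = inverse \<rho> *\<^sub>R f"
  have fu: "f = \<rho> *\<^sub>R u" using \<rho>0 by (simp add: u_def)
  have uB: "u \<in> L.body" unfolding u_def \<rho>_def by (rule L.mink_unit_in_B[OF f])
  have u1: "?q u = 1" unfolding u_def \<rho>_def by (rule L.mink_unit[OF f])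
  have Nu: "smooth_sup_norm u \<le> R"
  proof -
    have w: "0 \<le> weight R * remainder {b0} u" by (simp add: weight_def remainder_nonneg)
    have "jump_score (weight R) {b0} u \<le> m + 1" by (rule lur_term_in_body(2)[OF uB R0]) simp
    then have "(jump u b0)\<^sup>2 \<le> m + 9" using w by (simp add: jump_score_def)
    also have "\<dots> \<le> (m + 9)\<^sup>2" using m(1) by (intro self_le_power) auto
    finally have "\<bar>jump u b0\<bar> \<le> m + 9" using m(1) abs_le_square_iff[of "jump u b0" "m + 9"] by simp
    then have "\<bar>jump f b0\<bar> \<le> \<rho> * (m + 9)" using \<rho>0 by (simp add: u_def jump_scaleR abs_mult field_simps)
    then have "smooth_sup_norm f * \<bar>jump f b0\<bar> \<le> smooth_sup_norm f * (\<rho> * (m + 9))"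
      by (intro mult_left_mono smooth_sup_norm_nonneg)
    then have "smooth_sup_norm f / \<rho> \<le> smooth_sup_norm f * (m + 9) / \<bar>jump f b0\<bar>"
      using \<rho>0 b0 by (simp add: field_simps)
    then show ?thesis using R(3) \<rho>0 by (simp add: u_def smooth_sup_norm_scale divide_inverse mult.commute)
  qed
  obtain A where A: "finite A" "jump_score (weight R) A u > m"
  proof -
    obtain W F where WF: "open W" "u \<in> W" "finite F" "F \<subseteq> lur_index" "\<forall>y\<in>W. \<forall>i\<in>lur_index - F. lur_term m R i y = 0"
      using L.locally_finite[OF uB] by blast
    have "(\<Sum>i\<in>F. lur_term m R i u) = 1" using WF u1 by (intro L.unit_sphere_sum) auto
    then obtain i where i: "i \<in> F" "lur_term m R i u \<noteq> 0" by (metis sum.neutral zero_neq_one)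
    have "smooth_sup_norm (inverse R *\<^sub>R u) \<le> 1" using Nu R0 by (simp add: smooth_sup_norm_scale field_simps)
    then have "lur_term m R None u = 0" by (simp add: lur_term_def excess_eq_0)
    then obtain A where "i = Some A" using i(2) by (cases i) auto
    with i WF(4) have "finite A" "jump_score (weight R) A u > m"
      by (auto simp: lur_index_def lur_term_def not_le[symmetric])
    then show thesis by (rule that)
  qed
  have "{t. \<bar>jump f t\<bar> \<ge> d} \<subseteq> A"
  proof
    fix t assume "t \<in> {t. \<bar>jump f t\<bar> \<ge> d}"
    then have "4 * \<rho> \<le> \<bar>jump f t\<bar>" using \<rho>\<sigma> \<sigma>(2) by simp
    then have "4 \<le> \<bar>jump u t\<bar>" using \<rho>0 by (simp add: u_def jump_scaleR abs_mult field_simps)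
    then show "t \<in> A" by (rule active_set_contains_big_jumps[OF uB R(1) A])
  qed
  then have "norm (f - step A f) \<le> c" by (rule d(2)[OF A(1)])
  moreover have "f - step A f = \<rho> *\<^sub>R (u - step A u)"
    by (simp add: fu linear_cmul[OF bounded_linear.linear[OF bounded_linear_step[OF A(1)]]] scaleR_diff_right)
  ultimately have "\<rho> * norm (u - step A u) \<le> c" using \<rho>0 by (simp only: norm_scaleR abs_of_pos)
  then have u_step: "norm (u - step A u) \<le> c / \<rho>" using \<rho>0 by (simp add: field_simps)
  \<comment> \<open>The bound \<open>2\<close> keeps \<open>(C / 2)\<^sup>2 - 1\<close> in the range where \<open>ramp\<close> is strictly increasing.\<close>
  define C where "C = max 2 (8 * (c / \<rho>))"
  have C: "2 \<le> C" "8 * (c / \<rho>) \<le> C" by (auto simp: C_def)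
  have \<rho>C: "\<rho> * C \<le> 8 * c"
  proof -
    have "\<rho> * C = max (\<rho> * 2) (8 * c)" unfolding C_def using \<rho>0 by (simp add: max_mult_distrib_left)
    then show ?thesis using \<rho>\<sigma> \<sigma>(3) c by simp
  qed
  have excess_u: "excess (u - step A u) < ramp (C\<^sup>2 - 1)"
  proof -
    have "smooth_sup_norm (u - step A u) \<le> C / 2"
      using smooth_sup_norm_le[of "u - step A u"] u_step C by linarith
    then have "(smooth_sup_norm (u - step A u))\<^sup>2 \<le> (C / 2)\<^sup>2" by (intro power_mono smooth_sup_norm_nonneg)
    then have "excess (u - step A u) \<le> ramp ((C / 2)\<^sup>2 - 1)" unfolding excess_def by (intro ramp_mono) simp
    also have "\<dots> < ramp (C\<^sup>2 - 1)"
    proof (rule ramp_strict_mono)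
      have "1 \<le> (C / 2)\<^sup>2" using C(1) by (intro one_le_power) simp
      then show "0 \<le> (C / 2)\<^sup>2 - 1" by simp
      show "(C / 2)\<^sup>2 - 1 < C\<^sup>2 - 1" using C(1) by (simp add: power_divide)
    qed
    finally show ?thesis .
  qed
  have "\<forall>\<^sub>F r in sequentially. norm (xs r - f) < e"
    if xs: "(\<lambda>r. ?q (xs r)) \<longlonglongrightarrow> ?q f" "(\<lambda>r. ?q (xs r + f)) \<longlonglongrightarrow> 2 * ?q f" for xs
  proof -
    \<comment> \<open>For the finitely many \<open>r\<close> with \<open>xs r = 0\<close> any unit vector will do.\<close>
    define y where "y r = (if xs r = 0 then u else inverse (?q (xs r)) *\<^sub>R xs r)" for r
    have y1: "?q (y r) = 1" for r using u1 L.mink_unit[of "xs r"] by (simp add: y_def)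
    have lim_\<rho>: "(\<lambda>r. ?q (xs r)) \<longlonglongrightarrow> \<rho>" using xs(1) by (simp add: \<rho>_def)
    have ev_pos: "\<forall>\<^sub>F r in sequentially. \<rho> / 2 < ?q (xs r) \<and> ?q (xs r) < 2 * \<rho>"
      using order_tendstoD(1)[OF lim_\<rho>, of "\<rho> / 2"] order_tendstoD(2)[OF lim_\<rho>, of "2 * \<rho>"] \<rho>0
      by (auto elim: eventually_elim2)
    have xs_y: "xs r = ?q (xs r) *\<^sub>R y r" if "\<rho> / 2 < ?q (xs r)" for r
      using that \<rho>0 L.mink_zero by (auto simp: y_def)
    have lim2: "(\<lambda>r. ?q (y r + u)) \<longlonglongrightarrow> 2"
    proof -
      have "(\<lambda>r. inverse \<rho> * ?q (xs r + f)) \<longlonglongrightarrow> inverse \<rho> * (2 * \<rho>)"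
        using xs(2) unfolding \<rho>_def by (intro tendsto_intros)
      moreover have "inverse \<rho> * (2 * \<rho>) = 2" using \<rho>0 by simp
      ultimately have 1: "(\<lambda>r. inverse \<rho> * ?q (xs r + f)) \<longlonglongrightarrow> 2" by metis
      have "(\<lambda>r. \<bar>1 - inverse \<rho> * ?q (xs r)\<bar>) \<longlonglongrightarrow> \<bar>1 - inverse \<rho> * \<rho>\<bar>"
        by (intro tendsto_intros lim_\<rho>)
      then have 2: "(\<lambda>r. \<bar>1 - inverse \<rho> * ?q (xs r)\<bar>) \<longlonglongrightarrow> 0" using \<rho>0 by simp
      have "(\<lambda>r. ?q (y r + u) - inverse \<rho> * ?q (xs r + f)) \<longlonglongrightarrow> 0"
      proof (rule Lim_null_comparison[OF _ 2])
        show "\<forall>\<^sub>F r in sequentially. norm (?q (y r + u) - inverse \<rho> * ?q (xs r + f)) \<le> \<bar>1 - inverse \<rho> * ?q (xs r)\<bar>"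
          using ev_pos
        proof eventually_elim
          case (elim r)
          have "inverse \<rho> * ?q (xs r + f) = ?q (inverse \<rho> *\<^sub>R (xs r + f))"
            using \<rho>0 by (simp add: L.mink_scale)
          moreover have "(y r + u) - inverse \<rho> *\<^sub>R (xs r + f) = (1 - inverse \<rho> * ?q (xs r)) *\<^sub>R y r"
            using xs_y[of r] elim by (simp add: u_def scaleR_add_right scaleR_diff_left) (metis scaleR_scaleR)
          ultimately show ?case
            using is_norm_abs_diff[OF L.is_norm_mink, of "y r + u" "inverse \<rho> *\<^sub>R (xs r + f)"]
              \<rho>0 by (simp add: L.mink_scale y1)
        qed
      qed
      from tendsto_add[OF this 1] show ?thesis by simp
    qed
    note active = rotundity_on_active_set[OF m(1) R(1) u1 y1 lim2 A]
    have "\<forall>\<^sub>F r in sequentially. excess (y r - step A (y r)) < ramp (C\<^sup>2 - 1)"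
      by (rule order_tendstoD(2)[OF active(2) excess_u])
    moreover have "\<forall>\<^sub>F r in sequentially. \<forall>b\<in>insert top A. \<bar>y r b - u b\<bar> < C"
    proof (rule eventually_ball_finite)
      show "\<forall>b\<in>insert top A. \<forall>\<^sub>F r in sequentially. \<bar>y r b - u b\<bar> < C"
      proof
        fix b assume "b \<in> insert top A"
        from tendstoD[OF active(1)[OF this], of C] C(1)
        show "\<forall>\<^sub>F r in sequentially. \<bar>y r b - u b\<bar> < C" by (simp add: dist_real_def)
      qed
    qed (use A in simp)
    moreover have "\<forall>\<^sub>F r in sequentially. \<bar>?q (xs r) - \<rho>\<bar> * norm u < c"
    proof (rule order_tendstoD(2))
      show "(\<lambda>r. \<bar>?q (xs r) - \<rho>\<bar> * norm u) \<longlonglongrightarrow> \<bar>\<rho> - \<rho>\<bar> * norm u" by (intro tendsto_intros lim_\<rho>)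
    qed (use c in simp)
    ultimately show ?thesis using ev_pos
    proof eventually_elim
      case (elim r)
      let ?v = "y r - step A (y r)"
      have "smooth_sup_norm ?v \<le> C"
      proof (rule ccontr)
        assume "\<not> smooth_sup_norm ?v \<le> C"
        then have "C\<^sup>2 \<le> (smooth_sup_norm ?v)\<^sup>2" using C(1) by (intro power_mono) auto
        then have "ramp (C\<^sup>2 - 1) \<le> excess ?v" unfolding excess_def by (intro ramp_mono) simp
        then show False using elim(1) by simp
      qed
      then have 1: "norm (y r - step A (y r)) \<le> C" using norm_le_smooth_sup_norm[of ?v] by linarith
      have 2: "norm (step A (y r) - step A u) \<le> C"
      proof -
        have "step A (y r) - step A u = step A (y r - u)"
          by (simp add: linear_diff[OF bounded_linear.linear[OF bounded_linear_step[OF A(1)]]])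
        moreover have "norm (step A (y r - u)) \<le> C"
          using elim(2) by (intro norm_step_le A(1)) auto
        ultimately show ?thesis by simp
      qed
      have 3: "norm (step A u - u) \<le> C"
        using u_step C \<rho>0 c by (simp add: norm_minus_commute)
      have "y r - u = (y r - step A (y r)) + (step A (y r) - step A u) + (step A u - u)" by simp
      then have yu: "norm (y r - u) \<le> 3 * C"
        using 1 2 3 norm_triangle_ineq[of "(y r - step A (y r)) + (step A (y r) - step A u)" "step A u - u"]
          norm_triangle_ineq[of "y r - step A (y r)" "step A (y r) - step A u"] by simp
      have "xs r - f = ?q (xs r) *\<^sub>R (y r - u) + (?q (xs r) - \<rho>) *\<^sub>R u"
        using xs_y[of r] elim(4) by (subst fu) (simp add: algebra_simps)
      then have "norm (xs r - f) \<le> ?q (xs r) * norm (y r - u) + \<bar>?q (xs r) - \<rho>\<bar> * norm u"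
        using norm_triangle_ineq[of "?q (xs r) *\<^sub>R (y r - u)" "(?q (xs r) - \<rho>) *\<^sub>R u"] L.mink_nonneg[of "xs r"]
        by simp
      also have "?q (xs r) * norm (y r - u) \<le> (2 * \<rho>) * (3 * C)"
        using elim(4) yu \<rho>0 by (intro mult_mono) auto
      also have "\<dots> = 6 * (\<rho> * C)" by simp
      also have "\<dots> \<le> 6 * (8 * c)" by (rule mult_left_mono[OF \<rho>C]) simp
      finally show ?case using elim(3) c by (simp add: c_def)
    qed
  qed
  then show ?thesis unfolding m_def R_def by blast
qed

section \<open>Square sums of sequences of norms\<close>

lemma lipschitz_derivative_bound:
  fixes f :: "'v::real_normed_vector \<Rightarrow> real"
  assumes D: "(f has_derivative D) (at x)" and lip: "\<And>y. \<bar>f y - f x\<bar> \<le> C * norm (y - x)"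
  shows "\<bar>D h\<bar> \<le> C * norm h"
proof -
  have "((\<lambda>t. (f (x + t *\<^sub>R h) - f x) / t) \<longlongrightarrow> D h) (at 0)"
    using directional_DERIV[OF D] by (simp add: DERIV_def)
  then have lim: "((\<lambda>t. \<bar>(f (x + t *\<^sub>R h) - f x) / t\<bar>) \<longlongrightarrow> \<bar>D h\<bar>) (at 0)" by (rule tendsto_rabs)
  have "\<bar>(f (x + t *\<^sub>R h) - f x) / t\<bar> \<le> C * norm h" if "t \<noteq> 0" for t
    using lip[of "x + t *\<^sub>R h"] that by (simp add: abs_divide divide_le_eq ac_simps)
  then have "\<forall>\<^sub>F t in at 0. \<bar>(f (x + t *\<^sub>R h) - f x) / t\<bar> \<le> C * norm h"
    by (auto simp: eventually_at_filter)
  from tendsto_upperbound[OF lim this] show ?thesis by simp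
qed

lemma is_norm_L2_set:
  assumes I: "finite I" "i0 \<in> I" and q: "\<And>i. i \<in> I \<Longrightarrow> is_norm (q i)" and a: "\<And>i. i \<in> I \<Longrightarrow> 0 < a i"
  shows "is_norm (\<lambda>x. L2_set (\<lambda>i. a i * q i x) I)"
  unfolding is_norm_def
proof (intro conjI allI)
  fix x y and c :: real
  show "0 \<le> L2_set (\<lambda>i. a i * q i x) I" by (rule L2_set_nonneg)
  have "L2_set (\<lambda>i. a i * q i x) I = 0 \<longleftrightarrow> (\<forall>i\<in>I. a i * q i x = 0)" by (rule L2_set_eq_0_iff[OF I(1)])
  also have "\<dots> \<longleftrightarrow> x = 0" using is_normD(2)[OF q, of _ x] a I(2) by fastforce
  finally show "L2_set (\<lambda>i. a i * q i x) I = 0 \<longleftrightarrow> x = 0" .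
  have "L2_set (\<lambda>i. a i * q i (c *\<^sub>R x)) I = L2_set (\<lambda>i. \<bar>c\<bar> * (a i * q i x)) I"
    using is_normD(3)[OF q] by (intro L2_set_cong) auto
  then show "L2_set (\<lambda>i. a i * q i (c *\<^sub>R x)) I = \<bar>c\<bar> * L2_set (\<lambda>i. a i * q i x) I"
    by (simp add: L2_set_right_distrib)
  have le: "a i * q i (x + y) \<le> a i * q i x + a i * q i y" if "i \<in> I" for i
    unfolding distrib_left[symmetric] using is_normD(4)[OF q[OF that], of x y] a[OF that] by simp
  have nonneg: "0 \<le> a i * q i (x + y)" if "i \<in> I" for i
    using is_normD(1)[OF q[OF that], of "x + y"] a[OF that] by simp
  have "L2_set (\<lambda>i. a i * q i (x + y)) I \<le> L2_set (\<lambda>i. a i * q i x + a i * q i y) I"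
    by (rule L2_set_mono[OF le nonneg])
  also have "\<dots> \<le> L2_set (\<lambda>i. a i * q i x) I + L2_set (\<lambda>i. a i * q i y) I"
    by (rule L2_set_triangle_ineq)
  finally show "L2_set (\<lambda>i. a i * q i (x + y)) I \<le> L2_set (\<lambda>i. a i * q i x) I + L2_set (\<lambda>i. a i * q i y) I" .
qed

lemma sqrt_diff_le: "0 \<le> a \<Longrightarrow> a \<le> b \<Longrightarrow> sqrt b - sqrt a \<le> sqrt (b - a)"
  using sqrt_add_le_add_sqrt[of a "b - a"] by simp

text \<open>
  The weights \<open>2\<^sup>-\<^sup>n\<close> suffice because the norms have a common Lipschitz constant.
\<close>

locale norm_sequence =
  fixes q :: "nat \<Rightarrow> 'v::real_normed_vector \<Rightarrow> real" and C :: real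
  assumes norm_q: "is_norm (q n)" and q_le: "q n x \<le> 4 * norm x" and le_q0: "norm x \<le> C * q 0 x"
    and smooth_q: "x \<noteq> 0 \<Longrightarrow> smooth_at (q n) x"
begin

lemmas q_nonneg = is_normD(1)[OF norm_q]
lemmas q_triangle = is_normD(4)[OF norm_q]

definition summand :: "nat \<Rightarrow> 'v \<Rightarrow> real" where
  "summand n x = (1/2) ^ n * (q n x)\<^sup>2"

definition total :: "'v \<Rightarrow> real" where
  "total x = (\<Sum>n. summand n x)"

definition p :: "'v \<Rightarrow> real" where
  "p x = sqrt (total x)"

definition p_approx :: "nat \<Rightarrow> 'v \<Rightarrow> real" where
  "p_approx N x = sqrt (\<Sum>n<Suc N. summand n x)"

lemma summand_nonneg: "0 \<le> summand n x"
  by (simp add: summand_def)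

lemma summand_le: "summand n x \<le> 16 * (norm x)\<^sup>2 * (1/2) ^ n"
proof -
  have "(q n x)\<^sup>2 \<le> (4 * norm x)\<^sup>2" by (rule power_mono[OF q_le q_nonneg])
  then have "(1/2) ^ n * (q n x)\<^sup>2 \<le> (1/2) ^ n * (4 * norm x)\<^sup>2" by (intro mult_left_mono) auto
  then show ?thesis by (simp add: summand_def power_mult_distrib mult.commute)
qed

lemma summable_bound: "summable (\<lambda>n. 16 * (norm x)\<^sup>2 * (1/2) ^ n :: real)"
  by (intro summable_mult summable_geometric) simp

lemma summable_summand: "summable (\<lambda>n. summand n x)"
  by (rule summable_comparison_test'[OF summable_bound[of x], of 0]) (use summand_le summand_nonneg in simp)

lemma partial_le_total: "(\<Sum>n<N. summand n x) \<le> total x"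
  unfolding total_def by (intro sum_le_suminf summable_summand) (auto intro: summand_nonneg)

lemma summand_le_total: "summand n x \<le> total x"
proof -
  have "summand n x \<le> (\<Sum>n<Suc n. summand n x)" by (simp add: sum_nonneg summand_nonneg)
  then show ?thesis using partial_le_total[of x "Suc n"] by linarith
qed

lemma total_minus_partial: "total x - (\<Sum>n<N. summand n x) \<le> 32 * (norm x)\<^sup>2 * (1/2) ^ N"
proof -
  have "total x - (\<Sum>n<N. summand n x) = (\<Sum>n. summand (n + N) x)"
    unfolding total_def using suminf_minus_initial_segment[OF summable_summand, of N x] by simp
  also have "\<dots> \<le> (\<Sum>n. (16 * (norm x)\<^sup>2 * (1/2) ^ N) * (1/2) ^ n)"
  proof (rule suminf_le)
    show "summand (n + N) x \<le> (16 * (norm x)\<^sup>2 * (1/2) ^ N) * (1/2) ^ n" for n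
      using summand_le[of "n + N" x] by (simp add: power_add mult.commute mult.left_commute)
    show "summable (\<lambda>n. summand (n + N) x)" by (subst summable_iff_shift) (rule summable_summand)
    show "summable (\<lambda>n. (16 * (norm x)\<^sup>2 * (1/2) ^ N) * (1/2::real) ^ n)"
      by (intro summable_mult summable_geometric) simp
  qed
  also have "\<dots> = (16 * (norm x)\<^sup>2 * (1/2) ^ N) * (\<Sum>n. (1/2::real) ^ n)"
    by (intro suminf_mult summable_geometric) simp
  also have "(\<Sum>n. (1/2::real) ^ n) = 2" by (subst suminf_geometric) auto
  finally show ?thesis by simp
qed

lemma total_nonneg: "0 \<le> total x"
  using partial_le_total[of x 0] by simp

lemma p_power2: "(p x)\<^sup>2 = total x"
  by (simp add: p_def total_nonneg)

lemma p_nonneg: "0 \<le> p x"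
  by (simp add: p_def total_nonneg)

lemma p_le: "p x \<le> 6 * norm x"
proof -
  have "total x \<le> 32 * (norm x)\<^sup>2" using total_minus_partial[of x 0] by simp
  also have "\<dots> \<le> (6 * norm x)\<^sup>2" by (simp add: power_mult_distrib)
  finally show ?thesis unfolding p_def by (intro real_le_lsqrt) auto
qed

lemma q0_le_p: "q 0 x \<le> p x"
proof -
  have "(q 0 x)\<^sup>2 \<le> total x" using summand_le_total[of 0 x] by (simp add: summand_def)
  then show ?thesis unfolding p_def by (rule real_le_rsqrt)
qed

lemma p_approx_error: "\<bar>p_approx N x - p x\<bar> \<le> norm x * (6 * sqrt ((1/2) ^ Suc N))"
proof -
  have "p_approx N x \<le> p x" unfolding p_approx_def p_def by (intro real_sqrt_le_mono partial_le_total)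
  moreover have "p x - p_approx N x \<le> sqrt (total x - (\<Sum>n<Suc N. summand n x))"
    unfolding p_approx_def p_def by (intro sqrt_diff_le partial_le_total sum_nonneg summand_nonneg)
  moreover have "\<dots> \<le> sqrt ((6 * norm x)\<^sup>2 * (1/2) ^ Suc N)"
  proof (rule real_sqrt_le_mono)
    \<comment> \<open>The square \<open>36\<close> above \<open>32\<close> avoids an irrational constant.\<close>
    have "32 * (norm x)\<^sup>2 * (1/2) ^ Suc N \<le> (6 * norm x)\<^sup>2 * (1/2) ^ Suc N"
      by (intro mult_right_mono) (auto simp: power_mult_distrib)
    then show "total x - (\<Sum>n<Suc N. summand n x) \<le> (6 * norm x)\<^sup>2 * (1/2) ^ Suc N"
      using total_minus_partial[of x "Suc N"] by linarith
  qed
  moreover have "\<dots> = norm x * (6 * sqrt ((1/2) ^ Suc N))"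
    unfolding real_sqrt_mult[of "(6 * norm x)\<^sup>2"] real_sqrt_abs by simp
  ultimately show ?thesis by linarith
qed

lemma error_tendsto_0: "(\<lambda>N. 6 * sqrt ((1/2::real) ^ Suc N)) \<longlonglongrightarrow> 0"
proof -
  have "(\<lambda>N. 6 * sqrt ((1/2::real) ^ Suc N)) \<longlonglongrightarrow> 6 * sqrt 0"
    by (intro tendsto_intros LIMSEQ_Suc LIMSEQ_power_zero) simp
  then show ?thesis by simp
qed

lemma p_approx_tendsto: "(\<lambda>N. p_approx N x) \<longlonglongrightarrow> p x"
proof -
  have "(\<lambda>N. norm x * (6 * sqrt ((1/2::real) ^ Suc N))) \<longlonglongrightarrow> 0"
    by (rule tendsto_mult_right_zero[OF error_tendsto_0])
  then have "(\<lambda>N. p_approx N x - p x) \<longlonglongrightarrow> 0"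
    by (rule Lim_null_comparison[rotated]) (use p_approx_error in simp)
  then show ?thesis by (rule LIM_zero_cancel)
qed

lemma p_approx_uniform_limit:
  assumes "bounded B"
  shows "uniform_limit B p_approx p sequentially"
proof -
  obtain K where K: "K > 0" "\<And>x. x \<in> B \<Longrightarrow> norm x \<le> K" using assms bounded_pos by metis
  show ?thesis
  proof (rule uniform_limitI)
    fix e :: real assume e: "e > 0"
    have "(\<lambda>N. K * (6 * sqrt ((1/2::real) ^ Suc N))) \<longlonglongrightarrow> 0"
      by (rule tendsto_mult_right_zero[OF error_tendsto_0])
    then have "\<forall>\<^sub>F N in sequentially. K * (6 * sqrt ((1/2::real) ^ Suc N)) < e"
      using e by (rule order_tendstoD(2))
    then show "\<forall>\<^sub>F N in sequentially. \<forall>x\<in>B. dist (p_approx N x) (p x) < e"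
    proof eventually_elim
      case (elim N)
      have "norm x * (6 * sqrt ((1/2) ^ Suc N)) \<le> K * (6 * sqrt ((1/2) ^ Suc N))" if "x \<in> B" for x
        using K(2)[OF that] by (intro mult_right_mono) auto
      then show ?case
        using elim order_trans[OF p_approx_error[of N]] unfolding dist_real_def by (meson le_less_trans)
    qed
  qed
qed

lemma is_norm_p_approx: "is_norm (p_approx N)"
proof -
  have "p_approx N = (\<lambda>x. L2_set (\<lambda>n. sqrt ((1/2) ^ n) * q n x) {..<Suc N})"
    by (auto simp: p_approx_def L2_set_def summand_def power_mult_distrib)
  moreover have "is_norm (\<lambda>x. L2_set (\<lambda>n. sqrt ((1/2) ^ n) * q n x) {..<Suc N})"
    by (rule is_norm_L2_set[of _ 0]) (auto intro: norm_q)
  ultimately show ?thesis by simp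
qed

lemma is_norm_p: "is_norm p"
  unfolding is_norm_def
proof (intro conjI allI)
  fix x y and c :: real
  show "0 \<le> p x" by (rule p_nonneg)
  show "p x = 0 \<longleftrightarrow> x = 0"
    using q0_le_p[of x] is_normD(1,2)[OF norm_q, of 0 x] p_le[of x] p_nonneg[of x] by auto
  show "p (c *\<^sub>R x) = \<bar>c\<bar> * p x"
  proof (rule LIMSEQ_unique[OF p_approx_tendsto])
    show "(\<lambda>N. p_approx N (c *\<^sub>R x)) \<longlonglongrightarrow> \<bar>c\<bar> * p x"
      unfolding is_normD(3)[OF is_norm_p_approx] by (intro tendsto_intros p_approx_tendsto)
  qed
  show "p (x + y) \<le> p x + p y"
    by (rule LIMSEQ_le[OF p_approx_tendsto tendsto_add[OF p_approx_tendsto p_approx_tendsto]])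
      (use is_normD(4)[OF is_norm_p_approx] in blast)
qed

lemma equivalent_norm_p: "equivalent_norm p"
proof -
  have "norm x \<le> (\<bar>C\<bar> + 1) * p x" for x
  proof -
    have "norm x \<le> C * q 0 x" by (rule le_q0)
    also have "\<dots> \<le> (\<bar>C\<bar> + 1) * p x" using q0_le_p q_nonneg by (intro mult_mono) auto
    finally show ?thesis .
  qed
  then have "1 / (\<bar>C\<bar> + 1) * norm x \<le> p x" for x by (simp add: field_simps)
  then show ?thesis unfolding equivalent_norm_def using is_norm_p p_le
    by (intro conjI exI[of _ "1 / (\<bar>C\<bar> + 1)"] exI[of _ 6]) auto
qed

lemma Cinf_smooth_norm_p_approx: "Cinf_smooth_norm (p_approx N)"
  unfolding Cinf_smooth_norm_def Ck_smooth_norm_def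
proof (intro allI conjI is_norm_p_approx Ck_on_smooth_at)
  fix x :: 'v assume "x \<in> - {0}"
  then have x: "x \<noteq> 0" by simp
  have "smooth_at (\<lambda>x. \<Sum>n<Suc N. (1/2) ^ n * (q n x)\<^sup>2) x"
    by (intro smooth_at_sum smooth_at_mult smooth_at_const smooth_at_power2 smooth_q x)
  moreover have "0 < p_approx N x" using is_normD(1,2)[OF is_norm_p_approx, of N x] x by (simp add: less_le)
  ultimately have "smooth_at (\<lambda>x. sqrt (\<Sum>n<Suc N. (1/2) ^ n * (q n x)\<^sup>2)) x"
    by (intro smooth_at_sqrt) (simp_all add: p_approx_def summand_def)
  then show "smooth_at (p_approx N) x" by (simp add: p_approx_def[abs_def] summand_def)
qed (rule open_Compl[OF closed_singleton])

lemma q_lipschitz: "\<bar>q n y - q n x\<bar> \<le> 4 * norm (y - x)"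
  using is_norm_abs_diff[OF norm_q, of n y x] q_le[of n "y - x"] by linarith

text \<open>
  The squares are differentiated term by term on a ball that avoids the origin, where the
  derivatives of the summands are bounded by a multiple of \<open>2\<^sup>-\<^sup>n\<close>.
\<close>

lemma Ck_smooth_norm_p: "Ck_smooth_norm 1 p"
proof -
  have "\<forall>n. \<exists>D. continuous_on (- {0}) D \<and> (\<forall>x\<in>- {0}. (q n has_derivative blinfun_apply (D x)) (at x))"
    using Ck_on_1_iff[of "- {0}"] Ck_on_smooth_at[of "- {0}" "q _" 1] smooth_q by blast
  then obtain D where D: "\<And>n. continuous_on (- {0}) (D n)"
    "\<And>n x. x \<noteq> 0 \<Longrightarrow> (q n has_derivative blinfun_apply (D n x)) (at x)" by (metis ComplI singletonD)
  have normD: "norm (D n x) \<le> 4" if "x \<noteq> 0" for n x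
    using lipschitz_derivative_bound[OF D(2)[OF that] q_lipschitz] by (intro norm_blinfun_bound) auto
  define F where "F n x = ((1/2) ^ n * (2 * q n x)) *\<^sub>R D n x" for n x
  define G where "G x = (\<Sum>n. F n x)" for x
  have F_deriv: "(summand n has_derivative blinfun_apply (F n x)) (at x)" if "x \<noteq> 0" for n x
  proof -
    have "((\<lambda>x. (1/2) ^ n * (q n x)\<^sup>2) has_derivative (\<lambda>h. (1/2) ^ n * (of_nat 2 * D n x h * q n x ^ (2 - 1)))) (at x)"
      by (intro has_derivative_mult_right has_derivative_power D(2) that)
    moreover have "(\<lambda>h. (1/2) ^ n * (of_nat 2 * D n x h * q n x ^ (2 - 1))) = blinfun_apply (F n x)"
      by (rule ext) (simp add: F_def scaleR_blinfun.rep_eq)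
    ultimately show ?thesis by (simp add: summand_def[abs_def])
  qed
  have F_bound: "norm (F n x) \<le> 32 * norm x * (1/2) ^ n" if "x \<noteq> 0" for n x
  proof -
    have "norm (F n x) = (1/2) ^ n * (2 * q n x) * norm (D n x)" by (simp add: F_def q_nonneg)
    also have "\<dots> \<le> (1/2) ^ n * (2 * (4 * norm x)) * 4"
      using q_le q_nonneg normD[OF that] by (intro mult_mono mult_left_mono) auto
    finally show ?thesis by (simp add: ac_simps)
  qed
  have local: "continuous (at x) G \<and> (total has_derivative blinfun_apply (G x)) (at x)" if x: "x \<noteq> 0" for x
  proof -
    let ?S = "ball x (norm x)"
    have S: "y \<noteq> 0" "norm y \<le> 2 * norm x" if "y \<in> ?S" for y
      using that norm_triangle_sub[of y x] by (auto simp: dist_norm norm_minus_commute)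
    have xS: "x \<in> ?S" using x by simp
    have ul: "uniform_limit ?S (\<lambda>N y. \<Sum>n<N. F n y) G sequentially"
      unfolding G_def
    proof (rule Weierstrass_m_test)
      show "norm (F n y) \<le> 64 * norm x * (1/2) ^ n" if "y \<in> ?S" for n y
      proof -
        have "32 * norm y * (1/2) ^ n \<le> 32 * (2 * norm x) * (1/2) ^ n"
          using S(2)[OF that] by (intro mult_right_mono) auto
        also have "\<dots> = 64 * norm x * (1/2) ^ n" by simp
        finally show ?thesis by (rule order_trans[OF F_bound[OF S(1)[OF that]]])
      qed
      show "summable (\<lambda>n. 64 * norm x * (1/2) ^ n :: real)" by (intro summable_mult summable_geometric) simp
    qed
    have cont: "continuous_on ?S (F n)" for n
    proof -
      have "continuous_on ?S (D n)" by (rule continuous_on_subset[OF D(1)]) (use S(1) in auto)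
      moreover have "continuous_on ?S (q n)"
        using D(2) S(1) by (intro continuous_at_imp_continuous_on ballI) (blast intro: has_derivative_continuous)
      ultimately show ?thesis unfolding F_def by (intro continuous_intros)
    qed
    have "continuous_on ?S G"
      by (rule uniform_limit_theorem[OF _ ul]) (auto intro!: always_eventually continuous_on_sum cont)
    then have "continuous (at x) G" using xS continuous_on_eq_continuous_at[OF open_ball] by blast
    moreover have "\<exists>g. \<forall>y\<in>?S. (\<lambda>n. summand n y) sums g y \<and> (g has_derivative blinfun_apply (G y)) (at y within ?S)"
    proof (rule has_derivative_series[where f' = "\<lambda>n y. blinfun_apply (F n y)"])
      show "(summand n has_derivative blinfun_apply (F n y)) (at y within ?S)" if "y \<in> ?S" for n y
        by (rule has_derivative_at_withinI[OF F_deriv[OF S(1)[OF that]]])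
      fix e :: real assume "e > 0"
      from uniform_limitD[OF ul this]
      show "\<forall>\<^sub>F n in sequentially. \<forall>y\<in>?S. \<forall>h. norm ((\<Sum>i<n. F i y h) - G y h) \<le> e * norm h"
      proof eventually_elim
        case (elim n)
        show ?case
        proof (intro ballI allI)
          fix y h :: 'v assume "y \<in> ?S"
          then have "norm ((\<Sum>i<n. F i y) - G y) \<le> e" using elim by (auto simp: dist_norm less_imp_le)
          then have "norm ((\<Sum>i<n. F i y) - G y) * norm h \<le> e * norm h" by (intro mult_right_mono) auto
          then show "norm ((\<Sum>i<n. F i y h) - G y h) \<le> e * norm h"
            using norm_blinfun[of "(\<Sum>i<n. F i y) - G y" h]
            by (simp add: blinfun.diff_left blinfun.sum_left)
        qed
      qed
    next
      show "(\<lambda>n. summand n x) sums total x" unfolding total_def by (rule summable_sums[OF summable_summand])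
    qed (use xS in auto)
    then obtain g where g: "\<And>y. y \<in> ?S \<Longrightarrow> (\<lambda>n. summand n y) sums g y"
      "\<And>y. y \<in> ?S \<Longrightarrow> (g has_derivative blinfun_apply (G y)) (at y within ?S)" by blast
    have "(g has_derivative blinfun_apply (G x)) (at x)"
      using g(2)[OF xS] xS by (simp add: at_within_open[of x ?S])
    then have "(total has_derivative blinfun_apply (G x)) (at x)"
      by (rule has_derivative_transform_within_open[OF _ open_ball xS])
        (use g(1) in \<open>simp add: total_def sums_iff\<close>)
    ultimately show ?thesis by blast
  qed
  have p_pos: "0 < p x" if "x \<noteq> 0" for x
    using is_normD(1,2)[OF is_norm_p, of x] that by (simp add: less_le)
  define P where "P x = (inverse (p x) / 2) *\<^sub>R G x" for x
  have deriv: "(p has_derivative blinfun_apply (P x)) (at x)" if "x \<noteq> 0" for x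
  proof -
    have "0 < total x" using p_pos[OF that] by (simp add: p_def)
    then have "((\<lambda>x. sqrt (total x)) has_derivative (\<lambda>h. inverse (sqrt (total x)) / 2 * G x h)) (at x)"
      using has_derivative_compose[of total "blinfun_apply (G x)" x UNIV sqrt "(*) (inverse (sqrt (total x)) / 2)"]
        local[OF that] DERIV_real_sqrt[of "total x"] by (simp add: has_field_derivative_def)
    moreover have "(\<lambda>h. inverse (sqrt (total x)) / 2 * G x h) = blinfun_apply (P x)"
      by (rule ext) (simp add: P_def p_def scaleR_blinfun.rep_eq)
    ultimately show ?thesis by (simp add: p_def[abs_def])
  qed
  have "continuous_on (- {0}) P"
  proof (rule continuous_at_imp_continuous_on, rule ballI)
    fix x :: 'v assume "x \<in> - {0}"
    then have x: "x \<noteq> 0" by simp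
    have "isCont p x" by (rule has_derivative_continuous[OF deriv[OF x]])
    then show "isCont P x"
      unfolding P_def using local[OF x] p_pos[OF x] by (intro continuous_intros) auto
  qed
  then have "Ck_on 1 (- {0}) p"
    using deriv by (subst Ck_on_1_iff) (auto intro!: exI[of _ P])
  then show ?thesis by (simp add: Ck_smooth_norm_def is_norm_p)
qed

text \<open>
  Each summand contributes a nonnegative amount to \<open>2 * (p (xs r))\<^sup>2 + 2 * (p x)\<^sup>2 - (p (xs r +
  x))\<^sup>2\<close>, so all the contributions tend to \<open>0\<close>.
\<close>

lemma LUR_norm_p:
  assumes detect: "\<And>x xs. (\<And>n. (\<lambda>r. q n (xs r)) \<longlonglongrightarrow> q n x) \<Longrightarrow>
    (\<And>n. (\<lambda>r. q n (xs r + x)) \<longlonglongrightarrow> 2 * q n x) \<Longrightarrow> xs \<longlonglongrightarrow> x"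
  shows "LUR_norm p"
  unfolding LUR_norm_def
proof (intro conjI allI impI)
  show "is_norm p" by (rule is_norm_p)
  fix x xs
  assume lim: "(\<lambda>r. 2 * (p (xs r))\<^sup>2 + 2 * (p x)\<^sup>2 - (p (xs r + x))\<^sup>2) \<longlonglongrightarrow> 0"
  let ?d = "\<lambda>n r. 2 * (q n (xs r))\<^sup>2 + 2 * (q n x)\<^sup>2 - (q n (xs r + x))\<^sup>2"
  have square: "(q n (xs r) - q n x)\<^sup>2 \<le> ?d n r" for n r
  proof -
    have "(q n (xs r + x))\<^sup>2 \<le> (q n (xs r) + q n x)\<^sup>2" by (rule power_mono[OF q_triangle q_nonneg])
    then show ?thesis by (simp add: power2_eq_square algebra_simps)
  qed
  have d_nonneg: "0 \<le> ?d n r" for n r using square[of n r] zero_le_power2[of "q n (xs r) - q n x"] by linarith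
  have d0: "?d n \<longlonglongrightarrow> 0" for n
  proof (rule tendsto_sandwich[OF _ _ tendsto_const])
    show "(\<lambda>r. 2 ^ n * (2 * (p (xs r))\<^sup>2 + 2 * (p x)\<^sup>2 - (p (xs r + x))\<^sup>2)) \<longlonglongrightarrow> 0"
      by (rule tendsto_mult_right_zero[OF lim])
    have "?d n r \<le> 2 ^ n * (2 * (p (xs r))\<^sup>2 + 2 * (p x)\<^sup>2 - (p (xs r + x))\<^sup>2)" for r
    proof -
      have sums: "(\<lambda>n. 2 * summand n (xs r) + 2 * summand n x - summand n (xs r + x)) sums
          (2 * total (xs r) + 2 * total x - total (xs r + x))"
        unfolding total_def by (intro sums_add sums_diff sums_mult summable_sums summable_summand)
      have eq: "2 * summand n (xs r) + 2 * summand n x - summand n (xs r + x) = (1/2) ^ n * ?d n r" for n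
        by (simp add: summand_def algebra_simps)
      have "(\<Sum>k\<in>{n}. (1/2) ^ k * ?d k r) \<le> (\<Sum>k. (1/2) ^ k * ?d k r)"
        by (rule sum_le_suminf) (use sums d_nonneg in \<open>auto simp: eq sums_iff\<close>)
      then have "(1/2) ^ n * ?d n r \<le> 2 * total (xs r) + 2 * total x - total (xs r + x)"
        using sums by (simp add: eq sums_iff)
      then have "2 ^ n * ((1/2) ^ n * ?d n r) \<le> 2 ^ n * (2 * total (xs r) + 2 * total x - total (xs r + x))"
        by (intro mult_left_mono) auto
      then show ?thesis by (simp add: p_power2 mult.assoc[symmetric] power_mult_distrib[symmetric])
    qed
    then show "\<forall>\<^sub>F r in sequentially. ?d n r \<le> 2 ^ n * (2 * (p (xs r))\<^sup>2 + 2 * (p x)\<^sup>2 - (p (xs r + x))\<^sup>2)"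
      by simp
  qed (use d_nonneg in simp)
  have q_lim: "(\<lambda>r. q n (xs r)) \<longlonglongrightarrow> q n x" for n
  proof -
    have "(\<lambda>r. (q n (xs r) - q n x)\<^sup>2) \<longlonglongrightarrow> 0"
      by (rule tendsto_sandwich[OF _ _ tendsto_const d0[of n]]) (use square in auto)
    then have "(\<lambda>r. q n (xs r) - q n x) \<longlonglongrightarrow> 0" by (rule tendsto_zero_if_power2)
    then show ?thesis by (rule LIM_zero_cancel)
  qed
  have "(\<lambda>r. q n (xs r + x)) \<longlonglongrightarrow> 2 * q n x" for n
  proof -
    have "(\<lambda>r. sqrt (2 * (q n (xs r))\<^sup>2 + 2 * (q n x)\<^sup>2 - ?d n r)) \<longlonglongrightarrow> sqrt (2 * (q n x)\<^sup>2 + 2 * (q n x)\<^sup>2 - 0)"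
      by (intro tendsto_intros q_lim d0)
    moreover have "sqrt (2 * (q n x)\<^sup>2 + 2 * (q n x)\<^sup>2 - 0) = 2 * q n x"
      by (rule real_sqrt_unique) (auto simp: power_mult_distrib q_nonneg)
    ultimately show ?thesis by (simp add: q_nonneg)
  qed
  with q_lim have "xs \<longlonglongrightarrow> x" by (rule detect)
  then have "(\<lambda>r. norm (xs r - x)) \<longlonglongrightarrow> 0" by (intro tendsto_norm_zero LIM_zero)
  then have "(\<lambda>r. 6 * norm (xs r - x)) \<longlonglongrightarrow> 0" by (rule tendsto_mult_right_zero)
  then show "(\<lambda>r. p (xs r - x)) \<longlonglongrightarrow> 0"
    by (rule tendsto_sandwich[OF _ _ tendsto_const, rotated -1]) (use p_le p_nonneg in auto)
qed

end

section \<open>A smooth locally uniformly rotund norm\<close>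

theorem corollary3p2:
  shows "\<exists>p :: ('a :: {wellorder, order_top, linorder_topology} \<Rightarrow>\<^sub>C real) \<Rightarrow> real.
           equivalent_norm p \<and> Ck_smooth_norm 1 p \<and> LUR_norm p \<and>
           (\<exists>q :: nat \<Rightarrow> ('a \<Rightarrow>\<^sub>C real) \<Rightarrow> real.
              (\<forall>n. Cinf_smooth_norm (q n)) \<and>
              (\<forall>B. bounded B \<longrightarrow> uniform_limit B q p sequentially))"
proof -
  define q :: "nat \<Rightarrow> ('a \<Rightarrow>\<^sub>C real) \<Rightarrow> real" where
    "q n = lur_norm (real (Suc (fst (prod_decode n)))) (real (Suc (snd (prod_decode n))))" for n
  have q_eq: "q (prod_encode (M, N)) = lur_norm (real (Suc M)) (real (Suc N))" for M N
    by (simp add: q_def)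
  define C where "C = 2 * real (Suc (snd (prod_decode 0)))"
  interpret Q: norm_sequence q C
  proof
    fix n and f :: "'a \<Rightarrow>\<^sub>C real"
    interpret L: smooth_body "lur_term (real (Suc (fst (prod_decode n)))) (real (Suc (snd (prod_decode n)))) :: 'a set option \<Rightarrow> _"
        lur_index UNIV "2 * real (Suc (snd (prod_decode n)))"
      rewrites "unit_body.mink (sum_body (lur_term (real (Suc (fst (prod_decode n)))) (real (Suc (snd (prod_decode n)))))
        lur_index UNIV) = q n"
      by (rule smooth_body_lur_term) (simp_all add: q_def lur_norm_def)
    show "is_norm (q n)" by (rule L.is_norm_mink)
    show "q n f \<le> 4 * norm f" by (rule L.mink_bound)
    show "smooth_at (q n) f" if "f \<noteq> 0" by (rule L.smooth_at_mink[OF that])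
    interpret L0: smooth_body "lur_term (real (Suc (fst (prod_decode 0)))) (real (Suc (snd (prod_decode 0)))) :: 'a set option \<Rightarrow> _"
        lur_index UNIV "2 * real (Suc (snd (prod_decode 0)))"
      rewrites "unit_body.mink (sum_body (lur_term (real (Suc (fst (prod_decode 0)))) (real (Suc (snd (prod_decode 0)))))
        lur_index UNIV) = q 0"
      by (rule smooth_body_lur_term) (simp_all add: q_def lur_norm_def)
    show "norm f \<le> C * q 0 f" unfolding C_def by (rule L0.norm_le_mink)
  qed
  have "xs \<longlonglongrightarrow> f"
    if q: "\<And>n. (\<lambda>r. q n (xs r)) \<longlonglongrightarrow> q n f" "\<And>n. (\<lambda>r. q n (xs r + f)) \<longlonglongrightarrow> 2 * q n f" for f xs
  proof (cases "f = 0")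
    case True
    have "(\<lambda>r. q 0 (xs r)) \<longlonglongrightarrow> 0" using q(1)[of 0] is_normD(2)[OF Q.norm_q, of 0 f] True by simp
    then have "(\<lambda>r. C * q 0 (xs r)) \<longlonglongrightarrow> 0" by (rule tendsto_mult_right_zero)
    then have "xs \<longlonglongrightarrow> 0" by (rule Lim_null_comparison[rotated]) (use Q.le_q0 in simp)
    then show ?thesis using True by simp
  next
    case False
    show ?thesis
    proof (rule tendstoI)
      fix e :: real assume "e > 0"
      then obtain M N :: nat where MN: "\<And>xs.
          (\<lambda>r. lur_norm (real (Suc M)) (real (Suc N)) (xs r)) \<longlonglongrightarrow> lur_norm (real (Suc M)) (real (Suc N)) f \<Longrightarrow>
          (\<lambda>r. lur_norm (real (Suc M)) (real (Suc N)) (xs r + f)) \<longlonglongrightarrow> 2 * lur_norm (real (Suc M)) (real (Suc N)) f \<Longrightarrow>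
          \<forall>\<^sub>F r in sequentially. norm (xs r - f) < e"
        using lur_norm_detects[OF False] by meson
      show "\<forall>\<^sub>F r in sequentially. dist (xs r) f < e"
        unfolding dist_norm using q[of "prod_encode (M, N)"] by (intro MN) (simp_all only: q_eq)
    qed
  qed
  then have "LUR_norm Q.p" by (rule Q.LUR_norm_p)
  then show ?thesis
    using Q.equivalent_norm_p Q.Ck_smooth_norm_p Q.Cinf_smooth_norm_p_approx Q.p_approx_uniform_limit
    by (intro exI[of _ Q.p] exI[of _ Q.p_approx] conjI allI impI) auto
qed

end
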